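(* Let $\mathbb{I}$ be the set of irreducible elements of $\mathbb{M}$. The sets $\mathbb{I}$ and $\mathbb{M}\setminus\mathbb{I}$ are dense subsets of $\mathbb{M}$. Moreover, the set $\mathbb{I}$ is a $G_\delta$ subset of $\mathbb{M}$.
   Context: A metric measure space is a triple $\mathcal{X}=(X,r_X,\mu_X)$ where $(X,r_X)$ is a complete separable metric space and $\mu_X$ is a Borel probability measure on $X$ with full support. Two such spaces are equivalent if there is an isometry from one onto the other that maps the first probability measure to the second by push-forward. $\mathbb{M}$ denotes the set of equivalence classes, and a class is not distinguished from its representatives. $\mathcal{E}\in\mathbb{M}$ is the class of one-point spaces. For $\mathcal{Y},\mathcal{Z}\in\mathbb{M}$, $\mathcal{Y}\boxplus\mathcal{Z}:=(Y\times Z,\,r_Y\oplus r_Z,\,\mu_Y\otimes\mu_Z)$ with $(r_Y\oplus r_Z)((y',z'),(y'',z''))=r_Y(y',y'')+r_Z(z',z'')$. $\mathbb{M}$ carries the topology of the Gromov–Prohorov metric $d_{\mathrm{GPr}}(\mathcal{X},\mathcal{Y}):=\inf d_{\mathrm{Pr}}^{(Z,r_Z)}(\mu_X\circ\phi_X^{-1},\mu_Y\circ\phi_Y^{-1})$, where the infimum is over all metric spaces $(Z,r_Z)$ and isometric embeddings $\phi_X:X\to Z$, $\phi_Y:Y\to Z$, and $d_{\mathrm{Pr}}^{(Z,r_Z)}$ is the Prohorov metric on probability measures on $(Z,r_Z)$. Partial order: $\mathcal{Y}\le\mathcal{Z}$ if $\mathcal{Z}=\mathcal{Y}\boxplus\mathcal{X}$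 for some $\mathcal{X}\in\mathbb{M}$. An element $\mathcal{X}\in\mathbb{M}$ is irreducible if $\mathcal{X}\ne\mathcal{E}$ and $\mathcal{Y}\le\mathcal{X}$ for $\mathcal{Y}\in\mathbb{M}$ implies that $\mathcal{Y}$ is either $\mathcal{E}$ or $\mathcal{X}$. *)

theory Defs
  imports "HOL-Probability.Probability"
begin

section \<open>Metric measure spaces\<close>

definition borel_metric :: "'a metric \<Rightarrow> 'a measure" where
  "borel_metric m = sigma (mspace m) {U. openin (mtopology_of m) U}"

type_synonym 'a metric_measure = "'a metric \<times> 'a measure"

definition mm_space :: "'a metric_measure \<Rightarrow> bool" where
  "mm_space X \<longleftrightarrow> (case X of (m, \<mu>) \<Rightarrow>
     mcomplete_of m \<and> separable_space (mtopology_of m) \<and>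
     sets \<mu> = sets (borel_metric m) \<and> prob_space \<mu> \<and>
     (\<forall>U. openin (mtopology_of m) U \<longrightarrow> U \<noteq> {} \<longrightarrow> measure \<mu> U > 0))"

definition isometric_embedding :: "'a metric \<Rightarrow> 'b metric \<Rightarrow> ('a \<Rightarrow> 'b) \<Rightarrow> bool" where
  "isometric_embedding m m' f \<longleftrightarrow> f \<in> mspace m \<rightarrow> mspace m' \<and>
     (\<forall>x\<in>mspace m. \<forall>y\<in>mspace m. mdist m' (f x) (f y) = mdist m x y)"

definition mm_iso :: "'a metric_measure \<Rightarrow> 'b metric_measure \<Rightarrow> bool" where
  "mm_iso X Y \<longleftrightarrow> (case X of (m, \<mu>) \<Rightarrow> case Y of (m', \<mu>') \<Rightarrow>
     \<exists>f. isometric_embedding m m' f \<and> f ` mspace m = mspace m' \<and>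
         distr \<mu> (borel_metric m') f = \<mu>')"


subsection \<open>Equivalence is an equivalence relation\<close>

lemma openin_mtopology_of_Pow: "{U. openin (mtopology_of m) U} \<subseteq> Pow (mspace m)"
  by (metis CollectD PowI openin_subset subsetI topspace_mtopology_of)

lemma space_borel_metric [simp]: "space (borel_metric m) = mspace m"
  unfolding borel_metric_def by (rule space_measure_of[OF openin_mtopology_of_Pow])

lemma sets_borel_metric:
  "sets (borel_metric m) = sigma_sets (mspace m) {U. openin (mtopology_of m) U}"
  unfolding borel_metric_def by (rule sets_measure_of[OF openin_mtopology_of_Pow])

lemma openin_borel_metric: "openin (mtopology_of m) U \<Longrightarrow> U \<in> sets (borel_metric m)"
  by (simp add: sets_borel_metric sigma_sets.Basic)

lemma openin_mtopology_of:
  "openin (mtopology_of m) U \<longleftrightarrow> U \<subseteq> mspace m \<and> (\<forall>x\<in>U. \<exists>r>0. mball_of m x r \<subseteq> U)"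
  unfolding mtopology_of_def mball_of_def
  by (simp add: Metric_space.openin_mtopology[OF Metric_space_mspace_mdist] Ball_def)

lemma openin_mball_of: "openin (mtopology_of m) (mball_of m x r)"
  unfolding mtopology_of_def mball_of_def
  by (rule Metric_space.openin_mball[OF Metric_space_mspace_mdist])

lemma measurable_borel_metric:
  assumes "f \<in> space M \<rightarrow> mspace m"
    and "\<And>U. openin (mtopology_of m) U \<Longrightarrow> f -` U \<inter> space M \<in> sets M"
  shows "f \<in> measurable M (borel_metric m)"
  unfolding borel_metric_def
  by (rule measurable_measure_of[OF openin_mtopology_of_Pow assms(1)])
    (simp add: assms(2))

lemma isometric_embedding_open_vimage:
  assumes f: "isometric_embedding m m' f" and U: "openin (mtopology_of m') U"
  shows "openin (mtopology_of m) (f -` U \<inter> mspace m)"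
  unfolding openin_mtopology_of
proof (intro conjI ballI)
  fix x assume x: "x \<in> f -` U \<inter> mspace m"
  then obtain r where "r > 0" "mball_of m' (f x) r \<subseteq> U"
    using U by (auto simp: openin_mtopology_of)
  then have "mball_of m x r \<subseteq> f -` U \<inter> mspace m"
    using f x unfolding isometric_embedding_def by (auto simp: subset_iff Pi_iff)
  with \<open>r > 0\<close> show "\<exists>r>0. mball_of m x r \<subseteq> f -` U \<inter> mspace m" by blast
qed auto

lemma isometric_embedding_measurable:
  assumes "isometric_embedding m m' f"
  shows "f \<in> measurable (borel_metric m) (borel_metric m')"
  by (rule measurable_borel_metric)
    (use assms in \<open>auto simp: isometric_embedding_def
       intro!: openin_borel_metric isometric_embedding_open_vimage[OF assms]\<close>)

lemma isometric_embedding_inj: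
  assumes "isometric_embedding m m' f"
  shows "inj_on f (mspace m)"
  using assms unfolding isometric_embedding_def inj_on_def
  by (metis PiE mdist_zero)

lemma isometric_embedding_comp:
  assumes "isometric_embedding m m' f" "isometric_embedding m' m'' g"
  shows "isometric_embedding m m'' (g \<circ> f)"
  using assms unfolding isometric_embedding_def by (auto simp: Pi_iff)

lemma isometric_embedding_inv:
  assumes f: "isometric_embedding m m' f" and surj: "f ` mspace m = mspace m'"
  shows "isometric_embedding m' m (inv_into (mspace m) f)"
    and "inv_into (mspace m) f ` mspace m' = mspace m"
proof -
  note inj = isometric_embedding_inj[OF f]
  show "inv_into (mspace m) f ` mspace m' = mspace m"
    unfolding surj[symmetric] by (rule inv_into_image_cancel[OF inj order_refl])
  show "isometric_embedding m' m (inv_into (mspace m) f)"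
    unfolding isometric_embedding_def
  proof (intro conjI ballI Pi_I)
    fix x y assume xy: "x \<in> mspace m'" "y \<in> mspace m'"
    then have "inv_into (mspace m) f x \<in> mspace m" "inv_into (mspace m) f y \<in> mspace m"
      "f (inv_into (mspace m) f x) = x" "f (inv_into (mspace m) f y) = y"
      using surj by (simp_all add: inv_into_into f_inv_into_f)
    then show "mdist m (inv_into (mspace m) f x) (inv_into (mspace m) f y) = mdist m' x y"
      using f unfolding isometric_embedding_def by metis
  qed (use surj in \<open>simp add: inv_into_into\<close>)
qed

lemma measurable_mm:
  "sets \<mu> = sets (borel_metric m) \<Longrightarrow> isometric_embedding m m' f \<Longrightarrow>
    f \<in> measurable \<mu> (borel_metric m')"
  using isometric_embedding_measurable measurable_cong_sets by blast

lemma space_mm: "sets \<mu> = sets (borel_metric m) \<Longrightarrow> space \<mu> = mspace m"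
  by (drule sets_eq_imp_space_eq) simp

lemma mm_iso_refl:
  assumes "mm_space X"
  shows "mm_iso X X"
proof -
  obtain m \<mu> where X: "X = (m, \<mu>)" by (metis surj_pair)
  have "distr \<mu> (borel_metric m) (\<lambda>x. x) = \<mu>"
    using assms by (intro distr_id2) (simp add: X mm_space_def)
  moreover have "isometric_embedding m m (\<lambda>x. x)"
    by (simp add: isometric_embedding_def)
  ultimately show ?thesis
    unfolding X mm_iso_def prod.case by (intro exI[of _ "\<lambda>x. x"]) simp
qed

lemma mm_iso_trans:
  assumes "mm_space X" "mm_iso X Y" "mm_iso Y Z"
  shows "mm_iso X Z"
proof -
  obtain mx x my y mz z where [simp]: "X = (mx, x)" "Y = (my, y)" "Z = (mz, z)"
    by (metis surj_pair)
  obtain f g where f: "isometric_embedding mx my f" "f ` mspace mx = mspace my"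
      "distr x (borel_metric my) f = y"
    and g: "isometric_embedding my mz g" "g ` mspace my = mspace mz"
      "distr y (borel_metric mz) g = z"
    using assms by (auto simp: mm_iso_def)
  have x: "sets x = sets (borel_metric mx)" using assms by (simp add: mm_space_def)
  have "distr x (borel_metric mz) (g \<circ> f) = z"
    using distr_distr[OF isometric_embedding_measurable[OF g(1)] measurable_mm[OF x f(1)]] f(3) g(3)
    by simp
  then show ?thesis
    using isometric_embedding_comp[OF f(1) g(1)] image_comp[of g f "mspace mx"] f(2) g(2)
    unfolding mm_iso_def by fastforce
qed

lemma mm_iso_sym:
  assumes "mm_space X" "mm_iso X Y"
  shows "mm_iso Y X"
proof -
  obtain mx x my y where [simp]: "X = (mx, x)" "Y = (my, y)"
    by (metis surj_pair)
  obtain f where f: "isometric_embedding mx my f" "f ` mspace mx = mspace my"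
      "distr x (borel_metric my) f = y"
    using assms by (auto simp: mm_iso_def)
  have x: "sets x = sets (borel_metric mx)" using assms by (simp add: mm_space_def)
  let ?g = "inv_into (mspace mx) f"
  note g = isometric_embedding_inv[OF f(1,2)]
  have "distr y (borel_metric mx) ?g = distr x (borel_metric mx) (?g \<circ> f)"
    using distr_distr[OF isometric_embedding_measurable[OF g(1)] measurable_mm[OF x f(1)]] f(3)
    by simp
  also have "\<dots> = distr x x (\<lambda>x. x)"
    by (rule distr_cong) (use x isometric_embedding_inj[OF f(1)] in \<open>auto simp: space_mm\<close>)
  finally show ?thesis
    using g by (auto simp: mm_iso_def)
qed


subsection \<open>Invariance under equivalence\<close>

lemma mcomplete_of_iff:
  "mcomplete_of m \<longleftrightarrow> (\<forall>\<sigma> :: nat \<Rightarrow> _. range \<sigma> \<subseteq> mspace m \<longrightarrow>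
     (\<forall>\<epsilon>>0. \<exists>N. \<forall>n n'. N \<le> n \<longrightarrow> N \<le> n' \<longrightarrow> mdist m (\<sigma> n) (\<sigma> n') < \<epsilon>) \<longrightarrow>
     (\<exists>x\<in>mspace m. \<forall>\<epsilon>>0. \<exists>N. \<forall>n\<ge>N. mdist m (\<sigma> n) x < \<epsilon>))" (is "?L \<longleftrightarrow> ?R")
proof -
  interpret M: Metric_space "mspace m" "mdist m" by (rule Metric_space_mspace_mdist)
  have "limitin M.mtopology \<sigma> x sequentially \<longleftrightarrow>
      x \<in> mspace m \<and> (\<forall>\<epsilon>>0. \<exists>N. \<forall>n\<ge>N. mdist m (\<sigma> n) x < \<epsilon>)"
    if "range \<sigma> \<subseteq> mspace m" for \<sigma> :: "nat \<Rightarrow> _" and x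
    using that unfolding M.limitin_metric eventually_sequentially by (simp add: image_subset_iff)
  then have "(\<exists>x. limitin M.mtopology \<sigma> x sequentially) \<longleftrightarrow>
      (\<exists>x\<in>mspace m. \<forall>\<epsilon>>0. \<exists>N. \<forall>n\<ge>N. mdist m (\<sigma> n) x < \<epsilon>)"
    if "range \<sigma> \<subseteq> mspace m" for \<sigma> :: "nat \<Rightarrow> _"
    using that unfolding Bex_def by simp
  then show ?thesis
    unfolding mcomplete_of_def M.mcomplete_def M.MCauchy_def by (simp add: imp_conjL)
qed

lemma mcomplete_of_image:
  assumes f: "isometric_embedding m m' f" and surj: "f ` mspace m = mspace m'" and m: "mcomplete_of m"
  shows "mcomplete_of m'"
proof (rule mcomplete_of_iff[THEN iffD2], intro allI impI)
  fix \<sigma> :: "nat \<Rightarrow> _" assume \<sigma>: "range \<sigma> \<subseteq> mspace m'"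
    and C: "\<forall>\<epsilon>>0. \<exists>N. \<forall>n n'. N \<le> n \<longrightarrow> N \<le> n' \<longrightarrow> mdist m' (\<sigma> n) (\<sigma> n') < \<epsilon>"
  define \<tau> where "\<tau> n = inv_into (mspace m) f (\<sigma> n)" for n
  have \<tau>: "\<tau> n \<in> mspace m" "f (\<tau> n) = \<sigma> n" for n
    using \<sigma> surj unfolding \<tau>_def by (auto simp: inv_into_into f_inv_into_f image_subset_iff)
  have d: "mdist m x y = mdist m' (f x) (f y)" if "x \<in> mspace m" "y \<in> mspace m" for x y
    using f that by (simp add: isometric_embedding_def)
  have "\<forall>\<epsilon>>0. \<exists>N. \<forall>n n'. N \<le> n \<longrightarrow> N \<le> n' \<longrightarrow> mdist m (\<tau> n) (\<tau> n') < \<epsilon>"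
    using C by (simp add: d \<tau>)
  moreover have "range \<tau> \<subseteq> mspace m" using \<tau> by blast
  ultimately obtain x where x: "x \<in> mspace m" "\<forall>\<epsilon>>0. \<exists>N. \<forall>n\<ge>N. mdist m (\<tau> n) x < \<epsilon>"
    using mcomplete_of_iff[THEN iffD1, OF m, THEN spec, of \<tau>] by blast
  then have "\<forall>\<epsilon>>0. \<exists>N. \<forall>n\<ge>N. mdist m' (\<sigma> n) (f x) < \<epsilon>"
    by (simp add: d \<tau>)
  moreover have "f x \<in> mspace m'" using x surj by blast
  ultimately show "\<exists>x\<in>mspace m'. \<forall>\<epsilon>>0. \<exists>N. \<forall>n\<ge>N. mdist m' (\<sigma> n) x < \<epsilon>"
    by blast
qed

lemma closure_of_mtopology_of_eq_mspace:
  assumes "C \<subseteq> mspace m"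
  shows "mtopology_of m closure_of C = mspace m \<longleftrightarrow> (\<forall>x\<in>mspace m. \<forall>r>0. \<exists>y\<in>C. mdist m x y < r)"
proof -
  interpret M: Metric_space "mspace m" "mdist m" by (rule Metric_space_mspace_mdist)
  have "mtopology_of m closure_of C = {x \<in> mspace m. \<forall>r>0. \<exists>y\<in>C. mdist m x y < r}"
    unfolding mtopology_of_def M.metric_closure_of using assms by (auto simp: subset_iff Bex_def)
  then show ?thesis by blast
qed

lemma separable_space_mtopology_of_iff:
  "separable_space (mtopology_of m) \<longleftrightarrow>
     (\<exists>C. countable C \<and> C \<subseteq> mspace m \<and> (\<forall>x\<in>mspace m. \<forall>r>0. \<exists>y\<in>C. mdist m x y < r))"
  unfolding separable_space_def topspace_mtopology_of
  by (rule ex_cong1) (metis closure_of_mtopology_of_eq_mspace)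

lemma separable_space_image:
  assumes f: "isometric_embedding m m' f" and surj: "f ` mspace m = mspace m'"
    and m: "separable_space (mtopology_of m)"
  shows "separable_space (mtopology_of m')"
proof -
  obtain C where C: "countable C" "C \<subseteq> mspace m" "\<forall>x\<in>mspace m. \<forall>r>0. \<exists>y\<in>C. mdist m x y < r"
    using m unfolding separable_space_mtopology_of_iff by blast
  have "\<exists>y\<in>f ` C. mdist m' x y < r" if "x \<in> mspace m'" "r > 0" for x r
  proof -
    obtain z where z: "z \<in> mspace m" "x = f z" using surj \<open>x \<in> mspace m'\<close> by blast
    then obtain y where y: "y \<in> C" "mdist m z y < r" using C(3) \<open>r > 0\<close> by blast
    then have "mdist m' x (f y) = mdist m z y"
      using z C(2) f unfolding isometric_embedding_def by blast
    then show ?thesis using y by (intro bexI[of _ "f y"]) simp_all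
  qed
  moreover have "countable (f ` C)" "f ` C \<subseteq> mspace m'"
    using C(1,2) surj by auto
  ultimately show ?thesis
    unfolding separable_space_mtopology_of_iff by (intro exI[of _ "f ` C"]) simp
qed

lemma mm_space_image:
  assumes X: "mm_space (m, \<mu>)" and f: "isometric_embedding m m' f" "f ` mspace m = mspace m'"
  shows "mm_space (m', distr \<mu> (borel_metric m') f)"
proof -
  from X have \<mu>: "sets \<mu> = sets (borel_metric m)" and p: "prob_space \<mu>"
    and full: "\<And>U. openin (mtopology_of m) U \<Longrightarrow> U \<noteq> {} \<Longrightarrow> measure \<mu> U > 0"
    by (auto simp: mm_space_def)
  note meas = measurable_mm[OF \<mu> f(1)]
  have "measure (distr \<mu> (borel_metric m') f) U > 0"
    if U: "openin (mtopology_of m') U" "U \<noteq> {}" for U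
  proof -
    have "U \<subseteq> f ` mspace m" using U(1) f(2) by (simp add: openin_mtopology_of)
    then have "f -` U \<inter> mspace m \<noteq> {}" using U(2) by blast
    then show ?thesis
      using full[OF isometric_embedding_open_vimage[OF f(1) U(1)]]
      by (simp add: measure_distr[OF meas openin_borel_metric[OF U(1)]] space_mm[OF \<mu>])
  qed
  moreover have "prob_space (distr \<mu> (borel_metric m') f)"
    by (rule prob_space.prob_space_distr[OF p meas])
  ultimately show ?thesis
    using X mcomplete_of_image[OF f] separable_space_image[OF f] by (simp add: mm_space_def)
qed

lemma mm_space_iso: "mm_space X \<Longrightarrow> mm_iso X Y \<Longrightarrow> mm_space Y"
  unfolding mm_iso_def using mm_space_image by (auto split: prod.splits)

lemma separable_inj_real:
  fixes m :: "'a metric"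
  assumes "separable_space (mtopology_of m)"
  shows "\<exists>h :: 'a \<Rightarrow> real. inj_on h (mspace m)"
proof -
  obtain C where C: "countable C" "C \<subseteq> mspace m" "\<forall>x\<in>mspace m. \<forall>r>0. \<exists>y\<in>C. mdist m x y < r"
    using assms unfolding separable_space_mtopology_of_iff by blast
  define F where "F x = {(c, q). c \<in> C \<and> q \<in> \<rat> \<and> mdist m x c < q}" for x
  have sub: "F x \<subseteq> C \<times> \<rat>" for x by (auto simp: F_def)
  have "inj_on F (mspace m)"
  proof (rule inj_onI, rule ccontr)
    fix x y assume xy: "x \<in> mspace m" "y \<in> mspace m" "F x = F y" "x \<noteq> y"
    then have pos: "mdist m x y > 0"
      using mdist_nonneg[of m x y] mdist_zero[of x m y] by linarith
    then obtain c where c: "c \<in> C" "mdist m x c < mdist m x y / 2"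
      using C(3) xy(1) half_gt_zero by blast
    obtain q where q: "q \<in> \<rat>" "mdist m x c < q" "q < mdist m x y / 2"
      using Rats_dense_in_real[OF c(2)] by blast
    have "(c, q) \<in> F y" using c q xy(3) by (auto simp: F_def)
    then have "mdist m y c < q" by (simp add: F_def)
    moreover have "mdist m x y \<le> mdist m x c + mdist m c y"
      using xy c(1) C(2) by (intro mdist_triangle) auto
    ultimately show False
      using q mdist_commute[of m c y] by linarith
  qed
  moreover obtain e :: "'a \<times> real \<Rightarrow> nat" where "inj_on e (C \<times> \<rat>)"
    using C(1) countable_rat by (metis countable_SIGMA countableE)
  ultimately have "inj_on (\<lambda>x. e ` F x) (mspace m)"
    using sub unfolding inj_on_def[of _ "mspace m"] by (simp add: inj_on_image_eq_iff)
  moreover obtain b :: "nat set \<Rightarrow> real" where "inj b"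
    using nat_sets_eqpoll_reals unfolding eqpoll_def by (meson bij_betw_imp_inj_on)
  ultimately show ?thesis
    by (meson comp_inj_on inj_on_subset subset_UNIV)
qed

lemma metric_transport:
  fixes m :: "'a metric"
  assumes "inj_on h (mspace m)"
  obtains m' where "mspace m' = h ` mspace m" "isometric_embedding m m' h"
proof -
  let ?g = "inv_into (mspace m) h"
  interpret M: Metric_space "h ` mspace m" "\<lambda>x y. mdist m (?g x) (?g y)"
  proof
    show "mdist m (?g x) (?g y) = mdist m (?g y) (?g x)" for x y
      by (rule mdist_commute)
    fix x y z assume "x \<in> h ` mspace m" "y \<in> h ` mspace m" "z \<in> h ` mspace m"
    then show "mdist m (?g x) (?g z) \<le> mdist m (?g x) (?g y) + mdist m (?g y) (?g z)"
      by (intro mdist_triangle) (simp_all add: inv_into_into)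
  qed (use assms in auto)
  show ?thesis
    by (rule that[of "metric (h ` mspace m, \<lambda>x y. mdist m (?g x) (?g y))"])
      (use assms in \<open>auto simp: isometric_embedding_def\<close>)
qed

lemma mm_space_real:
  fixes X :: "'a metric_measure"
  assumes "mm_space X"
  shows "\<exists>Y :: real metric_measure. mm_space Y \<and> mm_iso X Y"
proof -
  obtain m \<mu> where X: "X = (m, \<mu>)" by (metis surj_pair)
  have "separable_space (mtopology_of m)"
    using assms by (simp add: X mm_space_def)
  then obtain h :: "'a \<Rightarrow> real" where "inj_on h (mspace m)"
    using separable_inj_real by blast
  then obtain m' where h: "mspace m' = h ` mspace m" "isometric_embedding m m' h"
    by (rule metric_transport)
  show ?thesis
  proof (intro exI conjI)
    show "mm_space (m', distr \<mu> (borel_metric m') h)"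
      using mm_space_image[OF _ h(2) h(1)[symmetric]] assms X by simp
    show "mm_iso X (m', distr \<mu> (borel_metric m') h)"
      using h X by (auto simp: mm_iso_def)
  qed
qed

section \<open>The set of equivalence classes\<close>

definition one_point_metric :: "'a \<Rightarrow> 'a metric" where
  "one_point_metric x = metric ({x}, \<lambda>_ _. 0)"

definition one_point_space :: "'a \<Rightarrow> 'a metric_measure" where
  "one_point_space x = (one_point_metric x, return (borel_metric (one_point_metric x)) x)"

lemma Metric_space_one_point: "Metric_space {x} (\<lambda>_ _. 0)"
  by unfold_locales auto

lemma one_point_metric [simp]:
  "mspace (one_point_metric x) = {x}" "mdist (one_point_metric x) y z = 0"
  unfolding one_point_metric_def
  by (simp_all add: Metric_space.mspace_metric[OF Metric_space_one_point]
        Metric_space.mdist_metric[OF Metric_space_one_point])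

lemma mm_space_one_point: "mm_space (one_point_space x)"
  unfolding mm_space_def one_point_space_def prod.case
proof (intro conjI allI impI)
  show "mcomplete_of (one_point_metric x)"
    by (rule mcomplete_of_iff[THEN iffD2]) simp
  show "separable_space (mtopology_of (one_point_metric x))"
    by (rule separable_space_mtopology_of_iff[THEN iffD2], rule exI[of _ "{x}"]) simp
  show "prob_space (return (borel_metric (one_point_metric x)) x)"
    by (rule prob_space_return) simp
  fix U assume U: "openin (mtopology_of (one_point_metric x)) U" "U \<noteq> {}"
  have "U \<subseteq> {x}"
    using openin_subset[OF U(1)] by simp
  with U(2) have "x \<in> U" by blast
  then show "measure (return (borel_metric (one_point_metric x)) x) U > 0"
    using openin_borel_metric[OF U(1)] by (simp add: measure_return)
qed simp

quotient_type mm = "real metric_measure" / partial: "\<lambda>X Y. mm_space X \<and> mm_space Y \<and> mm_iso X Y"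
proof (rule part_equivpI)
  show "\<exists>X :: real metric_measure. mm_space X \<and> mm_space X \<and> mm_iso X X"
    using mm_space_one_point[of 0] mm_iso_refl[OF mm_space_one_point[of 0]] by blast
  show "symp (\<lambda>X Y :: real metric_measure. mm_space X \<and> mm_space Y \<and> mm_iso X Y)"
    by (rule sympI) (simp add: mm_iso_sym)
  show "transp (\<lambda>X Y :: real metric_measure. mm_space X \<and> mm_space Y \<and> mm_iso X Y)"
  proof (rule transpI)
    fix X Y Z :: "real metric_measure"
    assume "mm_space X \<and> mm_space Y \<and> mm_iso X Y" "mm_space Y \<and> mm_space Z \<and> mm_iso Y Z"
    then show "mm_space X \<and> mm_space Z \<and> mm_iso X Z"
      using mm_iso_trans[of X Y Z] by simp
  qed
qed

text \<open>A complete separable metric space has at most the cardinality of the continuum, so nothing is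
  lost by taking representatives carried by subsets of \<^typ>\<open>real\<close>: every metric measure space over
  any type has a class, which \<open>mm_class\<close> picks out (lemmas \<open>mm_iso_rep_mm_class\<close>
  and \<open>mm_class_eq_iff\<close>).\<close>

definition mm_class :: "'a metric_measure \<Rightarrow> mm" where
  "mm_class X = (THE \<X>. mm_iso X (rep_mm \<X>))"

lemma mm_space_rep: "mm_space (rep_mm \<X>)"
  using Quotient_rep_reflp[OF Quotient_mm, of \<X>] by simp

lemma mm_iso_rep_iff: "mm_iso (rep_mm \<X>) (rep_mm \<Y>) \<longleftrightarrow> \<X> = \<Y>"
  using Quotient_rel_rep[OF Quotient_mm, of \<X> \<Y>] by (simp add: mm_space_rep)

lemma mm_class_eqI:
  assumes X: "mm_space X" "mm_iso X (rep_mm \<X>)"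
  shows "mm_class X = \<X>"
  unfolding mm_class_def
proof (rule the_equality)
  fix \<Y> assume Y: "mm_iso X (rep_mm \<Y>)"
  have "mm_iso (rep_mm \<Y>) (rep_mm \<X>)"
    by (rule mm_iso_trans[OF mm_space_rep mm_iso_sym[OF X(1) Y] X(2)])
  then show "\<Y> = \<X>" by (simp add: mm_iso_rep_iff)
qed (fact X(2))

lemma mm_class_rep [simp]: "mm_class (rep_mm \<X>) = \<X>"
  by (simp add: mm_class_eqI mm_space_rep mm_iso_refl)

lemma mm_iso_rep_mm_class:
  assumes X: "mm_space X"
  shows "mm_iso X (rep_mm (mm_class X))"
proof -
  obtain Y :: "real metric_measure" where Y: "mm_space Y" "mm_iso X Y"
    using mm_space_real[OF X] by blast
  have "mm_iso (rep_mm (abs_mm Y)) Y"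
    using Quotient_rep_abs[OF Quotient_mm, of Y] Y(1) mm_iso_refl[OF Y(1)] by simp
  then have *: "mm_iso X (rep_mm (abs_mm Y))"
    by (rule mm_iso_trans[OF X Y(2) mm_iso_sym[OF mm_space_rep]])
  show ?thesis
    unfolding mm_class_eqI[OF X *] by (fact *)
qed

lemma mm_class_eq_iff:
  assumes X: "mm_space X" and Y: "mm_space Y"
  shows "mm_class X = mm_class Y \<longleftrightarrow> mm_iso X Y"
proof
  assume "mm_class X = mm_class Y"
  then have "mm_iso X (rep_mm (mm_class Y))"
    using mm_iso_rep_mm_class[OF X] by simp
  then show "mm_iso X Y"
    by (rule mm_iso_trans[OF X _ mm_iso_sym[OF Y mm_iso_rep_mm_class[OF Y]]])
next
  assume "mm_iso X Y"
  then have "mm_iso X (rep_mm (mm_class Y))"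
    by (rule mm_iso_trans[OF X _ mm_iso_rep_mm_class[OF Y]])
  then show "mm_class X = mm_class Y"
    by (rule mm_class_eqI[OF X])
qed

section \<open>Sums of metric measure spaces\<close>

definition sum_metric :: "'a metric \<Rightarrow> 'b metric \<Rightarrow> ('a \<times> 'b) metric" where
  "sum_metric m m' = metric (mspace m \<times> mspace m',
     \<lambda>(y, z) (y', z'). mdist m y y' + mdist m' z z')"

text \<open>By separability the product \<open>\<sigma>\<close>-algebra is the Borel one, see \<open>sets_sum_metric\<close>.\<close>

definition mm_sum :: "'a metric_measure \<Rightarrow> 'b metric_measure \<Rightarrow> ('a \<times> 'b) metric_measure" where
  "mm_sum Y Z = (sum_metric (fst Y) (fst Z), snd Y \<Otimes>\<^sub>M snd Z)"

lemma Metric_space_sum_metric: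
  "Metric_space (mspace m \<times> mspace m') (\<lambda>(y, z) (y', z'). mdist m y y' + mdist m' z z')"
proof
  fix u v w :: "'a \<times> 'b"
  show "0 \<le> (case u of (y, z) \<Rightarrow> \<lambda>(y', z'). mdist m y y' + mdist m' z z') v"
    by (simp add: case_prod_beta)
  show "(case u of (y, z) \<Rightarrow> \<lambda>(y', z'). mdist m y y' + mdist m' z z') v =
      (case v of (y, z) \<Rightarrow> \<lambda>(y', z'). mdist m y y' + mdist m' z z') u"
    by (simp add: case_prod_beta mdist_commute[of m "fst u"] mdist_commute[of m' "snd u"])
  assume uv: "u \<in> mspace m \<times> mspace m'" "v \<in> mspace m \<times> mspace m'"
  have "mdist m (fst u) (fst v) + mdist m' (snd u) (snd v) = 0 \<longleftrightarrow>
      mdist m (fst u) (fst v) = 0 \<and> mdist m' (snd u) (snd v) = 0"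
    by (simp add: add_nonneg_eq_0_iff)
  then show "((case u of (y, z) \<Rightarrow> \<lambda>(y', z'). mdist m y y' + mdist m' z z') v = 0) = (u = v)"
    using uv by (simp add: case_prod_beta prod_eq_iff mem_Times_iff)
  assume w: "w \<in> mspace m \<times> mspace m'"
  have "mdist m (fst u) (fst w) \<le> mdist m (fst u) (fst v) + mdist m (fst v) (fst w)"
    "mdist m' (snd u) (snd w) \<le> mdist m' (snd u) (snd v) + mdist m' (snd v) (snd w)"
    using uv w by (auto simp: mem_Times_iff intro!: mdist_triangle)
  then show "(case u of (y, z) \<Rightarrow> \<lambda>(y', z'). mdist m y y' + mdist m' z z') w \<le>
      (case u of (y, z) \<Rightarrow> \<lambda>(y', z'). mdist m y y' + mdist m' z z') v +
      (case v of (y, z) \<Rightarrow> \<lambda>(y', z'). mdist m y y' + mdist m' z z') w"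
    by (simp add: case_prod_beta)
qed

lemma mspace_sum_metric [simp]: "mspace (sum_metric m m') = mspace m \<times> mspace m'"
  unfolding sum_metric_def by (rule Metric_space.mspace_metric[OF Metric_space_sum_metric])

lemma mdist_sum_metric [simp]:
  "mdist (sum_metric m m') u v = mdist m (fst u) (fst v) + mdist m' (snd u) (snd v)"
  unfolding sum_metric_def Metric_space.mdist_metric[OF Metric_space_sum_metric]
  by (simp add: case_prod_beta)

lemma mball_of_sum_metric_subset:
  "mball_of m (fst u) (r / 2) \<times> mball_of m' (snd u) (r / 2) \<subseteq> mball_of (sum_metric m m') u r"
  by (auto simp: mem_Times_iff)

lemma mcomplete_sum_metric:
  assumes "mcomplete_of m" "mcomplete_of m'"
  shows "mcomplete_of (sum_metric m m')"
proof (rule mcomplete_of_iff[THEN iffD2], intro allI impI)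
  fix \<sigma> :: "nat \<Rightarrow> 'a \<times> 'b"
  assume \<sigma>: "range \<sigma> \<subseteq> mspace (sum_metric m m')"
    and C: "\<forall>\<epsilon>>0. \<exists>N. \<forall>n n'. N \<le> n \<longrightarrow> N \<le> n' \<longrightarrow> mdist (sum_metric m m') (\<sigma> n) (\<sigma> n') < \<epsilon>"
  have le: "mdist m (fst u) (fst v) \<le> mdist (sum_metric m m') u v"
    "mdist m' (snd u) (snd v) \<le> mdist (sum_metric m m') u v" for u v
    by simp_all
  have \<sigma>': "fst (\<sigma> n) \<in> mspace m" "snd (\<sigma> n) \<in> mspace m'" for n
    using \<sigma> by (auto simp: image_subset_iff mem_Times_iff)
  have "\<forall>\<epsilon>>0. \<exists>N. \<forall>n n'. N \<le> n \<longrightarrow> N \<le> n' \<longrightarrow> mdist m (fst (\<sigma> n)) (fst (\<sigma> n')) < \<epsilon>"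
    using C le(1) by (meson le_less_trans)
  then obtain y where y: "y \<in> mspace m" "\<forall>\<epsilon>>0. \<exists>N. \<forall>n\<ge>N. mdist m (fst (\<sigma> n)) y < \<epsilon>"
    using mcomplete_of_iff[THEN iffD1, OF assms(1), THEN spec, of "\<lambda>n. fst (\<sigma> n)"] \<sigma>' by blast
  have "\<forall>\<epsilon>>0. \<exists>N. \<forall>n n'. N \<le> n \<longrightarrow> N \<le> n' \<longrightarrow> mdist m' (snd (\<sigma> n)) (snd (\<sigma> n')) < \<epsilon>"
    using C le(2) by (meson le_less_trans)
  then obtain z where z: "z \<in> mspace m'" "\<forall>\<epsilon>>0. \<exists>N. \<forall>n\<ge>N. mdist m' (snd (\<sigma> n)) z < \<epsilon>"
    using mcomplete_of_iff[THEN iffD1, OF assms(2), THEN spec, of "\<lambda>n. snd (\<sigma> n)"] \<sigma>' by blast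
  have "\<exists>N. \<forall>n\<ge>N. mdist (sum_metric m m') (\<sigma> n) (y, z) < \<epsilon>" if eps: "\<epsilon> > 0" for \<epsilon> :: real
  proof -
    obtain N1 where N1: "\<And>n. n \<ge> N1 \<Longrightarrow> mdist m (fst (\<sigma> n)) y < \<epsilon> / 2"
      using y(2) half_gt_zero[OF eps] by blast
    obtain N2 where N2: "\<And>n. n \<ge> N2 \<Longrightarrow> mdist m' (snd (\<sigma> n)) z < \<epsilon> / 2"
      using z(2) half_gt_zero[OF eps] by blast
    have "mdist (sum_metric m m') (\<sigma> n) (y, z) < \<epsilon>" if "n \<ge> max N1 N2" for n
      using N1[of n] N2[of n] that by simp
    then show ?thesis by blast
  qed
  then show "\<exists>x\<in>mspace (sum_metric m m').
      \<forall>\<epsilon>>0. \<exists>N. \<forall>n\<ge>N. mdist (sum_metric m m') (\<sigma> n) x < \<epsilon>"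
    using y(1) z(1) by (intro bexI[of _ "(y, z)"]) auto
qed

lemma separable_sum_metric:
  assumes "separable_space (mtopology_of m)" "separable_space (mtopology_of m')"
  shows "separable_space (mtopology_of (sum_metric m m'))"
proof -
  obtain C where C: "countable C" "C \<subseteq> mspace m" "\<forall>x\<in>mspace m. \<forall>r>0. \<exists>y\<in>C. mdist m x y < r"
    using assms(1) unfolding separable_space_mtopology_of_iff by blast
  obtain D where D: "countable D" "D \<subseteq> mspace m'" "\<forall>x\<in>mspace m'. \<forall>r>0. \<exists>y\<in>D. mdist m' x y < r"
    using assms(2) unfolding separable_space_mtopology_of_iff by blast
  have "\<exists>v\<in>C \<times> D. mdist (sum_metric m m') u v < r" if u: "u \<in> mspace (sum_metric m m')" and "r > 0" for u r
  proof -
    have "r / 2 > 0" using \<open>r > 0\<close> by simp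
    then obtain c d where "c \<in> C" "mdist m (fst u) c < r / 2" "d \<in> D" "mdist m' (snd u) d < r / 2"
      using C(3) D(3) u by (metis mem_Times_iff mspace_sum_metric)
    then show ?thesis by (intro bexI[of _ "(c, d)"]) auto
  qed
  moreover have "countable (C \<times> D)" "C \<times> D \<subseteq> mspace (sum_metric m m')"
    using C(1,2) D(1,2) by auto
  ultimately show ?thesis
    unfolding separable_space_mtopology_of_iff by (intro exI[of _ "C \<times> D"]) simp
qed

lemma sets_sum_metric:
  assumes "separable_space (mtopology_of m)" "separable_space (mtopology_of m')"
  shows "sets (borel_metric m \<Otimes>\<^sub>M borel_metric m') = sets (borel_metric (sum_metric m m'))"
proof
  have "fst \<in> measurable (borel_metric (sum_metric m m')) (borel_metric m)"
  proof (rule measurable_borel_metric)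
    fix U assume U: "openin (mtopology_of m) U"
    have "openin (mtopology_of (sum_metric m m')) (fst -` U \<inter> mspace (sum_metric m m'))"
      unfolding openin_mtopology_of
    proof (intro conjI ballI)
      fix u assume u: "u \<in> fst -` U \<inter> mspace (sum_metric m m')"
      then obtain r where r: "r > 0" "mball_of m (fst u) r \<subseteq> U"
        using U by (auto simp: openin_mtopology_of)
      have "fst v \<in> mball_of m (fst u) r" if "v \<in> mball_of (sum_metric m m') u r" for v
        using that mdist_nonneg[of m' "snd u" "snd v"] by (auto simp: mem_Times_iff simp del: mdist_nonneg)
      then have "fst v \<in> U" if "v \<in> mball_of (sum_metric m m') u r" for v
        using r(2) that by blast
      then have "mball_of (sum_metric m m') u r \<subseteq> fst -` U \<inter> mspace (sum_metric m m')"
        unfolding in_mball_of subset_iff by simp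
      then show "\<exists>r>0. mball_of (sum_metric m m') u r \<subseteq> fst -` U \<inter> mspace (sum_metric m m')"
        using r(1) by blast
    qed auto
    then show "fst -` U \<inter> space (borel_metric (sum_metric m m')) \<in> sets (borel_metric (sum_metric m m'))"
      by (simp add: openin_borel_metric del: mspace_sum_metric)
  qed auto
  moreover have "snd \<in> measurable (borel_metric (sum_metric m m')) (borel_metric m')"
  proof (rule measurable_borel_metric)
    fix U assume U: "openin (mtopology_of m') U"
    have "openin (mtopology_of (sum_metric m m')) (snd -` U \<inter> mspace (sum_metric m m'))"
      unfolding openin_mtopology_of
    proof (intro conjI ballI)
      fix u assume u: "u \<in> snd -` U \<inter> mspace (sum_metric m m')"
      then obtain r where r: "r > 0" "mball_of m' (snd u) r \<subseteq> U"
        using U by (auto simp: openin_mtopology_of)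
      have "snd v \<in> mball_of m' (snd u) r" if "v \<in> mball_of (sum_metric m m') u r" for v
        using that mdist_nonneg[of m "fst u" "fst v"] by (auto simp: mem_Times_iff simp del: mdist_nonneg)
      then have "snd v \<in> U" if "v \<in> mball_of (sum_metric m m') u r" for v
        using r(2) that by blast
      then have "mball_of (sum_metric m m') u r \<subseteq> snd -` U \<inter> mspace (sum_metric m m')"
        unfolding in_mball_of subset_iff by simp
      then show "\<exists>r>0. mball_of (sum_metric m m') u r \<subseteq> snd -` U \<inter> mspace (sum_metric m m')"
        using r(1) by blast
    qed auto
    then show "snd -` U \<inter> space (borel_metric (sum_metric m m')) \<in> sets (borel_metric (sum_metric m m'))"
      by (simp add: openin_borel_metric del: mspace_sum_metric)
  qed auto
  ultimately have id: "(\<lambda>u. (fst u, snd u)) \<in>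
      measurable (borel_metric (sum_metric m m')) (borel_metric m \<Otimes>\<^sub>M borel_metric m')"
    by (rule measurable_Pair)
  show "sets (borel_metric m \<Otimes>\<^sub>M borel_metric m') \<subseteq> sets (borel_metric (sum_metric m m'))"
  proof
    fix A assume A: "A \<in> sets (borel_metric m \<Otimes>\<^sub>M borel_metric m')"
    then have "A \<subseteq> mspace m \<times> mspace m'"
      using sets.sets_into_space by (fastforce simp: space_pair_measure)
    then have "(\<lambda>u. (fst u, snd u)) -` A \<inter> space (borel_metric (sum_metric m m')) = A"
      by auto
    then show "A \<in> sets (borel_metric (sum_metric m m'))"
      using measurable_sets[OF id A] by simp
  qed
  obtain C where C: "countable C" "C \<subseteq> mspace m" "\<forall>x\<in>mspace m. \<forall>r>0. \<exists>y\<in>C. mdist m x y < r"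
    using assms(1) unfolding separable_space_mtopology_of_iff by blast
  obtain D where D: "countable D" "D \<subseteq> mspace m'" "\<forall>x\<in>mspace m'. \<forall>r>0. \<exists>y\<in>D. mdist m' x y < r"
    using assms(2) unfolding separable_space_mtopology_of_iff by blast
  have op: "U \<in> sets (borel_metric m \<Otimes>\<^sub>M borel_metric m')"
    if U: "openin (mtopology_of (sum_metric m m')) U" for U
  proof -
    let ?B = "\<lambda>(c, d, q). mball_of m c q \<times> mball_of m' d q"
    let ?I = "{i \<in> C \<times> D \<times> \<rat>. ?B i \<subseteq> U}"
    have "\<exists>i\<in>?I. u \<in> ?B i" if u: "u \<in> U" for u
    proof -
      obtain r where r: "r > 0" "mball_of (sum_metric m m') u r \<subseteq> U"
        using U u by (auto simp: openin_mtopology_of)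
      have um: "fst u \<in> mspace m" "snd u \<in> mspace m'"
        using U u openin_subset[OF U] by auto
      obtain q where q: "q \<in> \<rat>" "r / 8 < q" "q < r / 4"
        using Rats_dense_in_real[of "r / 8" "r / 4"] r(1) by auto
      obtain c where c: "c \<in> C" "mdist m (fst u) c < q" using C(3) um q r(1)
        by (meson less_trans zero_less_divide_iff zero_less_numeral)
      obtain d where d: "d \<in> D" "mdist m' (snd u) d < q" using D(3) um q r(1)
        by (meson less_trans zero_less_divide_iff zero_less_numeral)
      have cd: "c \<in> mspace m" "d \<in> mspace m'" using c d C D by auto
      have "?B (c, d, q) \<subseteq> mball_of (sum_metric m m') u r"
      proof
        fix v assume "v \<in> ?B (c, d, q)"
        then have v: "fst v \<in> mspace m" "mdist m c (fst v) < q" "snd v \<in> mspace m'" "mdist m' d (snd v) < q"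
          by auto
        have "mdist m (fst u) (fst v) \<le> mdist m (fst u) c + mdist m c (fst v)"
          "mdist m' (snd u) (snd v) \<le> mdist m' (snd u) d + mdist m' d (snd v)"
          using um cd v by (simp_all add: mdist_triangle)
        then show "v \<in> mball_of (sum_metric m m') u r"
          using um v c(2) d(2) q(3) by (simp add: mem_Times_iff)
      qed
      moreover have "u \<in> ?B (c, d, q)"
        using um cd c(2) d(2) by (simp add: mem_Times_iff mdist_commute[of m c] mdist_commute[of m' d])
      ultimately show ?thesis
        using c(1) d(1) q(1) r(2) by (intro bexI[of _ "(c, d, q)"]) auto
    qed
    then have U_eq: "U = (\<Union>i\<in>?I. ?B i)" by blast
    have "countable ?I"
      using C(1) D(1) countable_rat by (intro countable_Collect countable_SIGMA)
    moreover have "?B i \<in> sets (borel_metric m \<Otimes>\<^sub>M borel_metric m')" for i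
      by (cases i) (simp add: openin_borel_metric openin_mball_of)
    ultimately have "(\<Union>i\<in>?I. ?B i) \<in> sets (borel_metric m \<Otimes>\<^sub>M borel_metric m')"
      by (intro sets.countable_UN') auto
    then show ?thesis
      using U_eq by argo
  qed
  have "sigma_sets (space (borel_metric m \<Otimes>\<^sub>M borel_metric m'))
      {U. openin (mtopology_of (sum_metric m m')) U} \<subseteq> sets (borel_metric m \<Otimes>\<^sub>M borel_metric m')"
    by (rule sets.sigma_sets_subset) (use op in blast)
  then show "sets (borel_metric (sum_metric m m')) \<subseteq> sets (borel_metric m \<Otimes>\<^sub>M borel_metric m')"
    by (simp add: sets_borel_metric space_pair_measure)
qed

lemma mm_space_sum:
  assumes "mm_space Y" "mm_space Z"
  shows "mm_space (mm_sum Y Z)"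
proof -
  obtain m \<mu> m' \<nu> where YZ: "Y = (m, \<mu>)" "Z = (m', \<nu>)" by (metis surj_pair)
  have Y: "mcomplete_of m" "separable_space (mtopology_of m)" "sets \<mu> = sets (borel_metric m)"
      "prob_space \<mu>" "\<And>U. openin (mtopology_of m) U \<Longrightarrow> U \<noteq> {} \<Longrightarrow> measure \<mu> U > 0"
    and Z: "mcomplete_of m'" "separable_space (mtopology_of m')" "sets \<nu> = sets (borel_metric m')"
      "prob_space \<nu>" "\<And>U. openin (mtopology_of m') U \<Longrightarrow> U \<noteq> {} \<Longrightarrow> measure \<nu> U > 0"
    using assms by (simp_all add: YZ mm_space_def)
  interpret Y: prob_space \<mu> by fact
  interpret Z: prob_space \<nu> by fact
  have P: "prob_space (\<mu> \<Otimes>\<^sub>M \<nu>)"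
    by (rule prob_space_pair[OF Y(4) Z(4)])
  interpret P: prob_space "\<mu> \<Otimes>\<^sub>M \<nu>" by (fact P)
  have sets: "sets (\<mu> \<Otimes>\<^sub>M \<nu>) = sets (borel_metric (sum_metric m m'))"
    using sets_pair_measure_cong[OF Y(3) Z(3)] sets_sum_metric[OF Y(2) Z(2)] by simp
  have "measure (\<mu> \<Otimes>\<^sub>M \<nu>) U > 0" if U: "openin (mtopology_of (sum_metric m m')) U" "U \<noteq> {}" for U
  proof -
    obtain u where "u \<in> U" using U(2) by blast
    then obtain r where u: "u \<in> U" "r > 0" "mball_of (sum_metric m m') u r \<subseteq> U"
      using U(1) unfolding openin_mtopology_of by blast
    have um: "fst u \<in> mspace m" "snd u \<in> mspace m'"
      using u openin_subset[OF U(1)] by auto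
    let ?A = "mball_of m (fst u) (r / 2)" and ?B = "mball_of m' (snd u) (r / 2)"
    have "fst u \<in> ?A" "snd u \<in> ?B"
      unfolding in_mball_of mdist_zero[THEN iffD2, OF um(1) um(1) refl]
        mdist_zero[THEN iffD2, OF um(2) um(2) refl]
      using um u(2) by simp_all
    then have "?A \<noteq> {}" "?B \<noteq> {}" by blast+
    then have pos: "measure \<mu> ?A > 0" "measure \<nu> ?B > 0"
      using Y(5)[OF openin_mball_of] Z(5)[OF openin_mball_of] by simp_all
    have AB: "?A \<in> sets \<mu>" "?B \<in> sets \<nu>"
      unfolding Y(3) Z(3) by (intro openin_borel_metric openin_mball_of)+
    have Us: "U \<in> sets (\<mu> \<Otimes>\<^sub>M \<nu>)"
      unfolding sets by (rule openin_borel_metric[OF U(1)])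
    have "measure \<mu> ?A * measure \<nu> ?B = measure (\<mu> \<Otimes>\<^sub>M \<nu>) (?A \<times> ?B)"
      unfolding measure_def Z.emeasure_pair_measure_Times[OF AB] enn2real_mult ..
    also have "\<dots> \<le> measure (\<mu> \<Otimes>\<^sub>M \<nu>) U"
      by (rule P.finite_measure_mono[OF _ Us])
        (rule order_trans[OF mball_of_sum_metric_subset u(3)])
    finally show ?thesis
      using mult_pos_pos[OF pos] by linarith
  qed
  then show ?thesis
    using mcomplete_sum_metric[OF Y(1) Z(1)] separable_sum_metric[OF Y(2) Z(2)] sets P
    by (simp add: mm_space_def mm_sum_def YZ)
qed

lemma mm_iso_sum:
  assumes "mm_space Y" "mm_space Z" "mm_iso Y Y'" "mm_iso Z Z'"
  shows "mm_iso (mm_sum Y Z) (mm_sum Y' Z')"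
proof -
  obtain m \<mu> n \<nu> m' \<mu>' n' \<nu>' where YZ: "Y = (m, \<mu>)" "Z = (n, \<nu>)" "Y' = (m', \<mu>')" "Z' = (n', \<nu>')"
    by (metis surj_pair)
  obtain f g where f: "isometric_embedding m m' f" "f ` mspace m = mspace m'"
      "distr \<mu> (borel_metric m') f = \<mu>'"
    and g: "isometric_embedding n n' g" "g ` mspace n = mspace n'"
      "distr \<nu> (borel_metric n') g = \<nu>'"
    using assms(3,4) unfolding YZ mm_iso_def by auto
  have Y: "sets \<mu> = sets (borel_metric m)" and Z: "sets \<nu> = sets (borel_metric n)"
    using assms(1,2) unfolding YZ by (simp_all add: mm_space_def)
  have "mm_space Y'" "mm_space Z'" using assms mm_space_iso by blast+
  then have sep: "separable_space (mtopology_of m')" "separable_space (mtopology_of n')"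
    and "prob_space \<nu>'"
    unfolding YZ by (simp_all add: mm_space_def)
  then have "sigma_finite_measure (distr \<nu> (borel_metric n') g)"
    unfolding g(3) by (simp add: prob_space_imp_sigma_finite)
  from pair_measure_distr[OF measurable_mm[OF Y f(1)] measurable_mm[OF Z g(1)] this]
  have "\<mu>' \<Otimes>\<^sub>M \<nu>' = distr (\<mu> \<Otimes>\<^sub>M \<nu>) (borel_metric m' \<Otimes>\<^sub>M borel_metric n') (map_prod f g)"
    unfolding f(3) g(3) map_prod_def .
  also have "\<dots> = distr (\<mu> \<Otimes>\<^sub>M \<nu>) (borel_metric (sum_metric m' n')) (map_prod f g)"
    by (rule distr_cong) (simp_all add: sets_sum_metric[OF sep])
  finally have "distr (\<mu> \<Otimes>\<^sub>M \<nu>) (borel_metric (sum_metric m' n')) (map_prod f g) = \<mu>' \<Otimes>\<^sub>M \<nu>'" ..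
  moreover have "isometric_embedding (sum_metric m n) (sum_metric m' n') (map_prod f g)"
    using f(1) g(1) by (auto simp: isometric_embedding_def)
  moreover have "map_prod f g ` mspace (sum_metric m n) = mspace (sum_metric m' n')"
    using f(2) g(2) by (simp add: map_prod_surj_on)
  ultimately show ?thesis
    unfolding YZ mm_iso_def mm_sum_def fst_conv snd_conv prod.case by blast
qed


subsection \<open>Sums, the order and irreducible classes\<close>

definition mm_plus :: "mm \<Rightarrow> mm \<Rightarrow> mm" (infixl \<open>\<boxplus>\<close> 65) where
  "\<Y> \<boxplus> \<Z> = mm_class (mm_sum (rep_mm \<Y>) (rep_mm \<Z>))"

definition mm_unit :: mm where
  "mm_unit = mm_class (one_point_space ())"

definition mm_le :: "mm \<Rightarrow> mm \<Rightarrow> bool" where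
  "mm_le \<Y> \<Z> \<longleftrightarrow> (\<exists>\<X>. \<Z> = \<Y> \<boxplus> \<X>)"

definition mm_irreducible :: "mm \<Rightarrow> bool" where
  "mm_irreducible \<X> \<longleftrightarrow> \<X> \<noteq> mm_unit \<and> (\<forall>\<Y>. mm_le \<Y> \<X> \<longrightarrow> \<Y> = mm_unit \<or> \<Y> = \<X>)"

lemma mm_class_sum:
  assumes "mm_space Y" "mm_space Z"
  shows "mm_class (mm_sum Y Z) = mm_class Y \<boxplus> mm_class Z"
proof -
  have "mm_iso (mm_sum Y Z) (mm_sum (rep_mm (mm_class Y)) (rep_mm (mm_class Z)))"
    by (rule mm_iso_sum[OF assms mm_iso_rep_mm_class[OF assms(1)] mm_iso_rep_mm_class[OF assms(2)]])
  then show ?thesis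
    unfolding mm_plus_def
    by (simp add: mm_class_eq_iff mm_space_sum assms mm_space_rep)
qed

lemma mm_class_eq_unit:
  assumes X: "mm_space X" and x: "mspace (fst X) = {x}"
  shows "mm_class X = mm_unit"
proof -
  obtain m \<mu> where Xeq: "X = (m, \<mu>)" by (metis surj_pair)
  let ?m' = "one_point_metric ()" and ?\<nu> = "return (borel_metric (one_point_metric ())) ()"
  have m: "mspace m = {x}" using x by (simp add: Xeq)
  have \<mu>: "sets \<mu> = sets (borel_metric m)" and p: "prob_space \<mu>"
    using X by (simp_all add: Xeq mm_space_def)
  have f: "isometric_embedding m ?m' (\<lambda>_. ())" "(\<lambda>_. ()) ` mspace m = mspace ?m'"
    by (simp_all add: isometric_embedding_def m)
  note meas = measurable_mm[OF \<mu> f(1)]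
  interpret D: prob_space "distr \<mu> (borel_metric ?m') (\<lambda>_. ())"
    by (rule prob_space.prob_space_distr[OF p meas])
  interpret R: prob_space ?\<nu>
    by (rule prob_space_return) simp
  have "distr \<mu> (borel_metric ?m') (\<lambda>_. ()) = ?\<nu>"
  proof (rule measure_eqI)
    fix A assume "A \<in> sets (distr \<mu> (borel_metric ?m') (\<lambda>_. ()))"
    have "A = {} \<or> A = {()}" by auto
    moreover have "space (distr \<mu> (borel_metric ?m') (\<lambda>_. ())) = {()}" "space ?\<nu> = {()}"
      by simp_all
    ultimately show "emeasure (distr \<mu> (borel_metric ?m') (\<lambda>_. ())) A = emeasure ?\<nu> A"
      using D.emeasure_space_1 R.emeasure_space_1 by auto
  qed simp
  then have "mm_iso X (one_point_space ())"
    using f unfolding Xeq mm_iso_def one_point_space_def prod.case by blast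
  then show ?thesis
    unfolding mm_unit_def by (simp add: mm_class_eq_iff X mm_space_one_point)
qed


section \<open>The Gromov--Prohorov metric\<close>

definition enlargement :: "'a metric \<Rightarrow> 'a set \<Rightarrow> real \<Rightarrow> 'a set" where
  "enlargement m A \<epsilon> = {z \<in> mspace m. \<exists>a\<in>A. mdist m a z < \<epsilon>}"

definition prohorov_dist :: "'a metric \<Rightarrow> 'a measure \<Rightarrow> 'a measure \<Rightarrow> real" where
  "prohorov_dist m \<mu> \<nu> = Inf {\<epsilon>. \<epsilon> > 0 \<and> (\<forall>A\<in>sets (borel_metric m).
     measure \<mu> A \<le> measure \<nu> (enlargement m A \<epsilon>) + \<epsilon> \<and>
     measure \<nu> A \<le> measure \<mu> (enlargement m A \<epsilon>) + \<epsilon>)}"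

text \<open>The infimum is over all metric spaces \<open>Z\<close>, for which there is no type. Replacing \<open>Z\<close> by its
  subspace \<open>\<phi> X \<union> \<psi> Y\<close>, which embeds into the disjoint union of the carriers, does not
  change the Prohorov distance, so the type \<^typ>\<open>'a + 'b\<close> is large enough: the lemmas
  \<open>gpr_le\<close> and \<open>gpr_greatest\<close> below characterise \<open>gpr\<close> as the infimum with \<open>Z\<close> of arbitrary type.\<close>

definition gpr :: "'a metric_measure \<Rightarrow> 'b metric_measure \<Rightarrow> real" where
  "gpr X Y = Inf {prohorov_dist Z (distr (snd X) (borel_metric Z) \<phi>) (distr (snd Y) (borel_metric Z) \<psi>)
     | (Z :: ('a + 'b) metric) \<phi> \<psi>. isometric_embedding (fst X) Z \<phi> \<and> isometric_embedding (fst Y) Z \<psi>}"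

definition gpr_dist :: "mm \<Rightarrow> mm \<Rightarrow> real" where
  "gpr_dist \<X> \<Y> = gpr (rep_mm \<X>) (rep_mm \<Y>)"

instantiation mm :: topological_space
begin

definition open_mm :: "mm set \<Rightarrow> bool" where
  "open_mm U \<longleftrightarrow> (\<forall>\<X>\<in>U. \<exists>r>0. \<forall>\<Y>. gpr_dist \<X> \<Y> < r \<longrightarrow> \<Y> \<in> U)"

instance
proof
  show "open (UNIV :: mm set)"
    unfolding open_mm_def by (auto intro: exI[of _ 1])
next
  fix U V :: "mm set" assume UV: "open U" "open V"
  show "open (U \<inter> V)"
    unfolding open_mm_def
  proof
    fix \<X> assume "\<X> \<in> U \<inter> V"
    then obtain r s where "r > 0" "\<forall>\<Y>. gpr_dist \<X> \<Y> < r \<longrightarrow> \<Y> \<in> U"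
      and "s > 0" "\<forall>\<Y>. gpr_dist \<X> \<Y> < s \<longrightarrow> \<Y> \<in> V"
      using UV unfolding open_mm_def by blast
    then show "\<exists>r>0. \<forall>\<Y>. gpr_dist \<X> \<Y> < r \<longrightarrow> \<Y> \<in> U \<inter> V"
      by (intro exI[of _ "min r s"]) simp
  qed
next
  fix K :: "mm set set" assume "\<forall>U\<in>K. open U"
  then show "open (\<Union>K)"
    unfolding open_mm_def by (meson Union_iff)
qed

end

subsection \<open>The distance as an infimum over spaces of arbitrary type\<close>

lemma openin_enlargement:
  assumes "A \<subseteq> mspace m"
  shows "openin (mtopology_of m) (enlargement m A \<epsilon>)"
proof -
  have "enlargement m A \<epsilon> = (\<Union>a\<in>A. mball_of m a \<epsilon>)"
    using assms by (auto simp: enlargement_def subset_iff)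
  moreover have "openin (mtopology_of m) (\<Union>a\<in>A. mball_of m a \<epsilon>)"
    by (rule openin_Union) (auto intro: openin_mball_of)
  ultimately show ?thesis by simp
qed

lemma image_isometric_embedding_borel:
  assumes k: "isometric_embedding m' m k" and S: "k ` mspace m' \<in> sets (borel_metric m)"
    and A: "A \<in> sets (borel_metric m')"
  shows "k ` A \<in> sets (borel_metric m)"
proof -
  let ?S = "k ` mspace m'" and ?g = "inv_into (mspace m') k"
  note inj = isometric_embedding_inj[OF k]
  have km: "k u \<in> mspace m" if "u \<in> mspace m'" for u
    using k that unfolding isometric_embedding_def by blast
  have kd: "mdist m (k u) (k v) = mdist m' u v" if "u \<in> mspace m'" "v \<in> mspace m'" for u v
    using k that unfolding isometric_embedding_def by blast
  have sp: "space (restrict_space (borel_metric m) ?S) = ?S"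
    using km by (auto simp: space_restrict_space)
  have inv_im: "?g -` B \<inter> ?S = k ` B" if "B \<subseteq> mspace m'" for B
    using that inj by (auto simp: inv_into_f_f subset_iff)
  have "?g \<in> measurable (restrict_space (borel_metric m) ?S) (borel_metric m')"
  proof (rule measurable_borel_metric)
    show "?g \<in> space (restrict_space (borel_metric m) ?S) \<rightarrow> mspace m'"
      unfolding sp by (simp add: inv_into_into)
    fix U assume U: "openin (mtopology_of m') U"
    then have Um: "U \<subseteq> mspace m'" using openin_subset[OF U] by simp
    let ?W = "\<Union>(u, r)\<in>{(u, r). u \<in> U \<and> mball_of m' u r \<subseteq> U}. mball_of m (k u) r"
    have "openin (mtopology_of m) ?W"
      by (rule openin_Union) (auto intro: openin_mball_of)
    then have W: "?W \<in> sets (borel_metric m)" by (rule openin_borel_metric)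
    have "k ` U = ?S \<inter> ?W"
    proof (intro equalityI subsetI)
      fix z assume "z \<in> k ` U"
      then obtain u where u: "u \<in> U" "z = k u" by blast
      obtain r where r: "r > 0" "mball_of m' u r \<subseteq> U"
        using U u(1) by (auto simp: openin_mtopology_of)
      have um: "u \<in> mspace m'" using u(1) Um by blast
      have "z \<in> mball_of m (k u) r"
        unfolding in_mball_of u(2) mdist_zero[THEN iffD2, OF km[OF um] km[OF um] refl]
        using r(1) km[OF um] by simp
      then show "z \<in> ?S \<inter> ?W"
        using u um r(2) by blast
    next
      fix z assume z: "z \<in> ?S \<inter> ?W"
      then obtain v where v: "v \<in> mspace m'" "z = k v" by blast
      from z obtain u r where u: "u \<in> U" "mball_of m' u r \<subseteq> U" "z \<in> mball_of m (k u) r"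
        by blast
      have um: "u \<in> mspace m'" using u(1) Um by blast
      have "v \<in> mball_of m' u r"
        using u(3) v um kd[OF um v(1)] by simp
      then show "z \<in> k ` U" using u(2) v(2) by blast
    qed
    then have "k ` U \<in> sets (restrict_space (borel_metric m) ?S)"
      using W unfolding sets_restrict_space by simp
    then show "?g -` U \<inter> space (restrict_space (borel_metric m) ?S) \<in> sets (restrict_space (borel_metric m) ?S)"
      unfolding sp inv_im[OF Um] .
  qed
  from measurable_sets[OF this A]
  have "k ` A \<in> sets (restrict_space (borel_metric m) ?S)"
    unfolding sp using inv_im sets.sets_into_space[OF A] by simp
  then obtain B where "B \<in> sets (borel_metric m)" "k ` A = ?S \<inter> B"
    unfolding sets_restrict_space by blast
  then show ?thesis
    using S by simp
qed

lemma prohorov_dist_embedding: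
  assumes k: "isometric_embedding m' m k" and S: "k ` mspace m' \<in> sets (borel_metric m)"
    and \<mu>: "prob_space \<mu>" "sets \<mu> = sets (borel_metric m')"
    and \<nu>: "prob_space \<nu>" "sets \<nu> = sets (borel_metric m')"
  shows "prohorov_dist m' \<mu> \<nu> \<le> prohorov_dist m (distr \<mu> (borel_metric m) k) (distr \<nu> (borel_metric m) k)"
  unfolding prohorov_dist_def
proof (rule cInf_superset_mono)
  interpret M: prob_space \<mu> by fact
  interpret N: prob_space \<nu> by fact
  interpret M': prob_space "distr \<mu> (borel_metric m) k"
    by (rule M.prob_space_distr[OF measurable_mm[OF \<mu>(2) k]])
  interpret N': prob_space "distr \<nu> (borel_metric m) k"
    by (rule N.prob_space_distr[OF measurable_mm[OF \<nu>(2) k]])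
  let ?P = "\<lambda>m \<mu> \<nu> \<epsilon>. \<epsilon> > 0 \<and> (\<forall>A\<in>sets (borel_metric m).
     measure \<mu> A \<le> measure \<nu> (enlargement m A \<epsilon>) + \<epsilon> \<and>
     measure \<nu> A \<le> measure \<mu> (enlargement m A \<epsilon>) + \<epsilon>)"
  have "?P m (distr \<mu> (borel_metric m) k) (distr \<nu> (borel_metric m) k) 1"
    using M'.prob_le_1 N'.prob_le_1 by (auto intro: add_increasing)
  then show "{\<epsilon>. ?P m (distr \<mu> (borel_metric m) k) (distr \<nu> (borel_metric m) k) \<epsilon>} \<noteq> {}"
    by blast
  show "bdd_below {\<epsilon>. ?P m' \<mu> \<nu> \<epsilon>}"
    by (rule bdd_belowI[of _ 0]) simp
  have eq: "measure (distr \<rho> (borel_metric m) k) (k ` A) = measure \<rho> A"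
    "measure (distr \<rho> (borel_metric m) k) (enlargement m (k ` A) \<epsilon>) = measure \<rho> (enlargement m' A \<epsilon>)"
    if \<rho>: "sets \<rho> = sets (borel_metric m')" and A: "A \<in> sets (borel_metric m')" for \<rho> A \<epsilon>
  proof -
    have Am: "A \<subseteq> mspace m'" using sets.sets_into_space[OF A] by simp
    have kA: "k ` A \<subseteq> mspace m" using Am k unfolding isometric_embedding_def by blast
    have "k -` k ` A \<inter> mspace m' = A"
      using Am isometric_embedding_inj[OF k] by (auto simp: inj_on_def)
    then show "measure (distr \<rho> (borel_metric m) k) (k ` A) = measure \<rho> A"
      using measure_distr[OF measurable_mm[OF \<rho> k] image_isometric_embedding_borel[OF k S A]]
      by (simp add: space_mm[OF \<rho>])
    have "k -` enlargement m (k ` A) \<epsilon> \<inter> mspace m' = enlargement m' A \<epsilon>"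
    proof (rule set_eqI)
      fix z
      have "mdist m (k a) (k z) = mdist m' a z" "k z \<in> mspace m" if "a \<in> A" "z \<in> mspace m'" for a
        using that Am k unfolding isometric_embedding_def by blast+
      then show "z \<in> k -` enlargement m (k ` A) \<epsilon> \<inter> mspace m' \<longleftrightarrow> z \<in> enlargement m' A \<epsilon>"
        by (auto simp: enlargement_def)
    qed
    then show "measure (distr \<rho> (borel_metric m) k) (enlargement m (k ` A) \<epsilon>) = measure \<rho> (enlargement m' A \<epsilon>)"
      using measure_distr[OF measurable_mm[OF \<rho> k] openin_borel_metric[OF openin_enlargement[OF kA]]]
      by (simp add: space_mm[OF \<rho>])
  qed
  show "{\<epsilon>. ?P m (distr \<mu> (borel_metric m) k) (distr \<nu> (borel_metric m) k) \<epsilon>} \<subseteq> {\<epsilon>. ?P m' \<mu> \<nu> \<epsilon>}"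
  proof (rule subsetI, rule CollectI)
    fix \<epsilon> assume "\<epsilon> \<in> {\<epsilon>. ?P m (distr \<mu> (borel_metric m) k) (distr \<nu> (borel_metric m) k) \<epsilon>}"
    then have \<epsilon>: "?P m (distr \<mu> (borel_metric m) k) (distr \<nu> (borel_metric m) k) \<epsilon>" by blast
    have "measure \<mu> A \<le> measure \<nu> (enlargement m' A \<epsilon>) + \<epsilon> \<and>
        measure \<nu> A \<le> measure \<mu> (enlargement m' A \<epsilon>) + \<epsilon>" if A: "A \<in> sets (borel_metric m')" for A
      using \<epsilon>[THEN conjunct2, THEN bspec, OF image_isometric_embedding_borel[OF k S A]]
      unfolding eq[OF \<mu>(2) A] eq[OF \<nu>(2) A] .
    then show "?P m' \<mu> \<nu> \<epsilon>" using \<epsilon> by blast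
  qed
qed

lemma closedin_isometric_image:
  assumes f: "isometric_embedding m Z f" and m: "mcomplete_of m"
  shows "closedin (mtopology_of Z) (f ` mspace m)"
proof -
  have sub: "f ` mspace m \<subseteq> mspace Z" using f unfolding isometric_embedding_def by blast
  interpret Z: Submetric "mspace Z" "mdist Z" "f ` mspace m"
    by (intro Submetric.intro Submetric_axioms.intro sub Metric_space_mspace_mdist)
  have "mspace (submetric Z (f ` mspace m)) = f ` mspace m" using sub by auto
  moreover have "isometric_embedding m (submetric Z (f ` mspace m)) f"
    using f by (simp add: isometric_embedding_def Pi_iff)
  ultimately have "mcomplete_of (submetric Z (f ` mspace m))"
    using mcomplete_of_image[OF _ _ m] by metis
  then have "Z.sub.mcomplete"
    unfolding mcomplete_of_def mdist_submetric mspace_submetric using sub by (simp add: Int_absorb2)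
  then show ?thesis
    unfolding mtopology_of_def by (rule Z.mcomplete_imp_closedin)
qed

lemma prohorov_dist_reduce:
  fixes X :: "'a metric_measure" and Y :: "'b metric_measure" and Z :: "'c metric"
  assumes X: "mm_space X" and Y: "mm_space Y"
    and \<phi>: "isometric_embedding (fst X) Z \<phi>" and \<psi>: "isometric_embedding (fst Y) Z \<psi>"
  shows "\<exists>(Z' :: ('a + 'b) metric) \<phi>' \<psi>'.
    isometric_embedding (fst X) Z' \<phi>' \<and> isometric_embedding (fst Y) Z' \<psi>' \<and>
    prohorov_dist Z' (distr (snd X) (borel_metric Z') \<phi>') (distr (snd Y) (borel_metric Z') \<psi>') \<le>
    prohorov_dist Z (distr (snd X) (borel_metric Z) \<phi>) (distr (snd Y) (borel_metric Z) \<psi>)"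
proof -
  obtain m \<mu> n \<nu> where XY: "X = (m, \<mu>)" "Y = (n, \<nu>)" by (metis surj_pair)
  have \<mu>: "sets \<mu> = sets (borel_metric m)" "prob_space \<mu>" "mcomplete_of m"
    and \<nu>: "sets \<nu> = sets (borel_metric n)" "prob_space \<nu>" "mcomplete_of n"
    using X Y by (simp_all add: XY mm_space_def)
  have \<phi>: "isometric_embedding m Z \<phi>" and \<psi>: "isometric_embedding n Z \<psi>"
    using \<phi> \<psi> by (simp_all add: XY)
  let ?S = "\<phi> ` mspace m \<union> \<psi> ` mspace n"
  have Ssub: "?S \<subseteq> mspace Z" using \<phi> \<psi> unfolding isometric_embedding_def by blast
  have "closedin (mtopology_of Z) ?S"
    by (intro closedin_Un closedin_isometric_image[OF \<phi> \<mu>(3)] closedin_isometric_image[OF \<psi> \<nu>(3)])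
  then have "mspace Z - ?S \<in> sets (borel_metric Z)"
    by (intro openin_borel_metric) (simp add: closedin_def)
  then have "mspace Z - (mspace Z - ?S) \<in> sets (borel_metric Z)"
    using sets.compl_sets[of "mspace Z - ?S" "borel_metric Z"] by simp
  then have S: "?S \<in> sets (borel_metric Z)"
    using Ssub by (simp add: double_diff)
  define h :: "'c \<Rightarrow> 'a + 'b" where "h s =
    (if s \<in> \<phi> ` mspace m then Inl (inv_into (mspace m) \<phi> s) else Inr (inv_into (mspace n) \<psi> s))" for s
  have inj: "inj_on h ?S"
  proof (rule inj_onI)
    fix s t assume st: "s \<in> ?S" "t \<in> ?S" "h s = h t"
    show "s = t"
    proof (cases "s \<in> \<phi> ` mspace m")
      case True
      then have t: "t \<in> \<phi> ` mspace m" "inv_into (mspace m) \<phi> s = inv_into (mspace m) \<phi> t"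
        using st(3) by (auto simp: h_def split: if_splits)
      then show ?thesis using inv_into_injective[OF t(2) True t(1)] by simp
    next
      case False
      then have t: "t \<notin> \<phi> ` mspace m" "inv_into (mspace n) \<psi> s = inv_into (mspace n) \<psi> t"
        using st(3) by (auto simp: h_def split: if_splits)
      have "s \<in> \<psi> ` mspace n" "t \<in> \<psi> ` mspace n" using st(1,2) False t(1) by blast+
      then show ?thesis using inv_into_injective[OF t(2)] by simp
    qed
  qed
  let ?Z = "submetric Z ?S"
  have mZ: "mspace ?Z = ?S" using Ssub by auto
  obtain Z' where Z': "mspace Z' = h ` mspace ?Z" "isometric_embedding ?Z Z' h"
    using metric_transport[of h ?Z] inj unfolding mZ by blast
  define k where "k = inv_into (mspace ?Z) h"
  have k0: "isometric_embedding Z' ?Z k" "k ` mspace Z' = mspace ?Z"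
    unfolding k_def by (rule isometric_embedding_inv[OF Z'(2) Z'(1)[symmetric]])+
  have k: "isometric_embedding Z' Z k"
    using k0(1) by (simp add: isometric_embedding_def Pi_iff)
  have kS: "k ` mspace Z' \<in> sets (borel_metric Z)"
    unfolding k0(2) mZ by (rule S)
  have kh: "k (h s) = s" if "s \<in> ?S" for s
    unfolding k_def mZ by (rule inv_into_f_f[OF inj that])
  have \<phi>': "isometric_embedding m Z' (h \<circ> \<phi>)"
    by (rule isometric_embedding_comp[OF _ Z'(2)])
      (use \<phi> in \<open>auto simp: isometric_embedding_def Pi_iff\<close>)
  have \<psi>': "isometric_embedding n Z' (h \<circ> \<psi>)"
    by (rule isometric_embedding_comp[OF _ Z'(2)])
      (use \<psi> in \<open>auto simp: isometric_embedding_def Pi_iff\<close>)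
  have "distr (distr \<mu> (borel_metric Z') (h \<circ> \<phi>)) (borel_metric Z) k = distr \<mu> (borel_metric Z) (k \<circ> (h \<circ> \<phi>))"
    by (rule distr_distr[OF isometric_embedding_measurable[OF k] measurable_mm[OF \<mu>(1) \<phi>']])
  also have "\<dots> = distr \<mu> (borel_metric Z) \<phi>"
    by (rule distr_cong) (simp_all add: kh space_mm[OF \<mu>(1)])
  finally have d1: "distr (distr \<mu> (borel_metric Z') (h \<circ> \<phi>)) (borel_metric Z) k = distr \<mu> (borel_metric Z) \<phi>" .
  have "distr (distr \<nu> (borel_metric Z') (h \<circ> \<psi>)) (borel_metric Z) k = distr \<nu> (borel_metric Z) (k \<circ> (h \<circ> \<psi>))"
    by (rule distr_distr[OF isometric_embedding_measurable[OF k] measurable_mm[OF \<nu>(1) \<psi>']])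
  also have "\<dots> = distr \<nu> (borel_metric Z) \<psi>"
    by (rule distr_cong) (simp_all add: kh space_mm[OF \<nu>(1)])
  finally have d2: "distr (distr \<nu> (borel_metric Z') (h \<circ> \<psi>)) (borel_metric Z) k = distr \<nu> (borel_metric Z) \<psi>" .
  have "prohorov_dist Z' (distr \<mu> (borel_metric Z') (h \<circ> \<phi>)) (distr \<nu> (borel_metric Z') (h \<circ> \<psi>)) \<le>
      prohorov_dist Z (distr \<mu> (borel_metric Z) \<phi>) (distr \<nu> (borel_metric Z) \<psi>)"
    using prohorov_dist_embedding[OF k kS
        prob_space.prob_space_distr[OF \<mu>(2) measurable_mm[OF \<mu>(1) \<phi>']] _
        prob_space.prob_space_distr[OF \<nu>(2) measurable_mm[OF \<nu>(1) \<psi>']] _]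
    unfolding d1 d2 by simp
  then show ?thesis
    unfolding XY fst_conv snd_conv using \<phi>' \<psi>' by blast
qed

lemma prohorov_dist_nonneg:
  assumes "prob_space \<mu>" "prob_space \<nu>"
  shows "prohorov_dist m \<mu> \<nu> \<ge> 0"
  unfolding prohorov_dist_def
proof (rule cInf_greatest)
  interpret M: prob_space \<mu> by fact
  interpret N: prob_space \<nu> by fact
  have "(1 :: real) > 0 \<and> (\<forall>A\<in>sets (borel_metric m).
     measure \<mu> A \<le> measure \<nu> (enlargement m A 1) + 1 \<and>
     measure \<nu> A \<le> measure \<mu> (enlargement m A 1) + 1)"
    using M.prob_le_1 N.prob_le_1 by (auto intro: add_increasing)
  then show "{\<epsilon>. \<epsilon> > 0 \<and> (\<forall>A\<in>sets (borel_metric m).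
     measure \<mu> A \<le> measure \<nu> (enlargement m A \<epsilon>) + \<epsilon> \<and>
     measure \<nu> A \<le> measure \<mu> (enlargement m A \<epsilon>) + \<epsilon>)} \<noteq> {}"
    by blast
qed simp

lemma gpr_le:
  fixes X :: "'a metric_measure" and Y :: "'b metric_measure" and Z :: "'c metric"
  assumes X: "mm_space X" and Y: "mm_space Y"
    and \<phi>: "isometric_embedding (fst X) Z \<phi>" and \<psi>: "isometric_embedding (fst Y) Z \<psi>"
  shows "gpr X Y \<le> prohorov_dist Z (distr (snd X) (borel_metric Z) \<phi>) (distr (snd Y) (borel_metric Z) \<psi>)"
proof -
  obtain Z' :: "('a + 'b) metric" and \<phi>' \<psi>' where Z': "isometric_embedding (fst X) Z' \<phi>'" "isometric_embedding (fst Y) Z' \<psi>'"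
    "prohorov_dist Z' (distr (snd X) (borel_metric Z') \<phi>') (distr (snd Y) (borel_metric Z') \<psi>') \<le>
     prohorov_dist Z (distr (snd X) (borel_metric Z) \<phi>) (distr (snd Y) (borel_metric Z) \<psi>)"
    using prohorov_dist_reduce[OF assms] by blast
  have "gpr X Y \<le> prohorov_dist Z' (distr (snd X) (borel_metric Z') \<phi>') (distr (snd Y) (borel_metric Z') \<psi>')"
    unfolding gpr_def
  proof (rule cInf_lower)
    have ps: "prob_space (snd X)" "sets (snd X) = sets (borel_metric (fst X))"
      "prob_space (snd Y)" "sets (snd Y) = sets (borel_metric (fst Y))"
      using X Y unfolding mm_space_def by (auto split: prod.splits)
    show "bdd_below {prohorov_dist Z (distr (snd X) (borel_metric Z) \<phi>) (distr (snd Y) (borel_metric Z) \<psi>)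
     | Z \<phi> \<psi>. isometric_embedding (fst X) Z \<phi> \<and> isometric_embedding (fst Y) Z \<psi>}"
      by (rule bdd_belowI[of _ 0])
        (auto intro!: prohorov_dist_nonneg prob_space.prob_space_distr
          measurable_mm[OF ps(2)] measurable_mm[OF ps(4)] ps(1,3))
  qed (use Z'(1,2) in blast)
  with Z'(3) show ?thesis by linarith
qed

lemma gpr_greatest:
  fixes X :: "'a metric_measure" and Y :: "'b metric_measure"
  assumes X: "mm_space X" and Y: "mm_space Y"
    and c: "\<And>(Z :: ('a + 'b) metric) \<phi> \<psi>. isometric_embedding (fst X) Z \<phi> \<Longrightarrow> isometric_embedding (fst Y) Z \<psi> \<Longrightarrow>
      c \<le> prohorov_dist Z (distr (snd X) (borel_metric Z) \<phi>) (distr (snd Y) (borel_metric Z) \<psi>)"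
  shows "c \<le> gpr X Y"
  unfolding gpr_def
proof (rule cInf_greatest)
  obtain m \<mu> n \<nu> where XY: "X = (m, \<mu>)" "Y = (n, \<nu>)" by (metis surj_pair)
  have "prob_space \<mu>" "sets \<mu> = sets (borel_metric m)" "prob_space \<nu>" "sets \<nu> = sets (borel_metric n)"
    using X Y by (simp_all add: XY mm_space_def)
  then obtain x y where "x \<in> mspace m" "y \<in> mspace n"
    using prob_space.not_empty space_mm by (metis all_not_in_conv)
  then have "isometric_embedding m (sum_metric m n) (\<lambda>u. (u, y))"
    "isometric_embedding n (sum_metric m n) (\<lambda>u. (x, u))"
    by (simp_all add: isometric_embedding_def)
  then show "{prohorov_dist Z (distr (snd X) (borel_metric Z) \<phi>) (distr (snd Y) (borel_metric Z) \<psi>)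
     | (Z :: ('a + 'b) metric) \<phi> \<psi>. isometric_embedding (fst X) Z \<phi> \<and> isometric_embedding (fst Y) Z \<psi>} \<noteq> {}"
    using prohorov_dist_reduce[OF X Y, of "sum_metric m n"] unfolding XY fst_conv by blast
qed (use c in blast)

lemma gpr_iso:
  assumes X: "mm_space X" and Y: "mm_space Y" and iso: "mm_iso X X'" "mm_iso Y Y'"
  shows "gpr X Y \<le> gpr X' Y'"
proof -
  have X': "mm_space X'" and Y': "mm_space Y'"
    using mm_space_iso[OF X iso(1)] mm_space_iso[OF Y iso(2)] .
  show ?thesis
  proof (rule gpr_greatest[OF X' Y'])
    fix Z \<phi> \<psi>
    assume \<phi>: "isometric_embedding (fst X') Z \<phi>" and \<psi>: "isometric_embedding (fst Y') Z \<psi>"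
    obtain f where f: "isometric_embedding (fst X) (fst X') f"
      "distr (snd X) (borel_metric (fst X')) f = snd X'"
      using iso(1) unfolding mm_iso_def by (auto split: prod.splits)
    obtain g where g: "isometric_embedding (fst Y) (fst Y') g"
      "distr (snd Y) (borel_metric (fst Y')) g = snd Y'"
      using iso(2) unfolding mm_iso_def by (auto split: prod.splits)
    have s: "sets (snd X) = sets (borel_metric (fst X))" "sets (snd Y) = sets (borel_metric (fst Y))"
      using X Y unfolding mm_space_def by (auto split: prod.splits)
    have "distr (snd X') (borel_metric Z) \<phi> = distr (snd X) (borel_metric Z) (\<phi> \<circ> f)"
      unfolding f(2)[symmetric]
      by (rule distr_distr[OF isometric_embedding_measurable[OF \<phi>] measurable_mm[OF s(1) f(1)]])
    moreover have "distr (snd Y') (borel_metric Z) \<psi> = distr (snd Y) (borel_metric Z) (\<psi> \<circ> g)"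
      unfolding g(2)[symmetric]
      by (rule distr_distr[OF isometric_embedding_measurable[OF \<psi>] measurable_mm[OF s(2) g(1)]])
    ultimately show "gpr X Y \<le> prohorov_dist Z (distr (snd X') (borel_metric Z) \<phi>) (distr (snd Y') (borel_metric Z) \<psi>)"
      using gpr_le[OF X Y isometric_embedding_comp[OF f(1) \<phi>] isometric_embedding_comp[OF g(1) \<psi>]]
      by simp
  qed
qed

lemma gpr_dist_mm_class:
  assumes X: "mm_space X" and Y: "mm_space Y"
  shows "gpr_dist (mm_class X) (mm_class Y) = gpr X Y"
  unfolding gpr_dist_def
proof (rule antisym)
  note iso = mm_iso_rep_mm_class[OF X] mm_iso_rep_mm_class[OF Y]
  show "gpr X Y \<le> gpr (rep_mm (mm_class X)) (rep_mm (mm_class Y))"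
    by (rule gpr_iso[OF X Y iso])
  show "gpr (rep_mm (mm_class X)) (rep_mm (mm_class Y)) \<le> gpr X Y"
    by (rule gpr_iso[OF mm_space_rep mm_space_rep mm_iso_sym[OF X iso(1)] mm_iso_sym[OF Y iso(2)]])
qed

end

theory Submission
  imports Defs "HOL-Complex_Analysis.Great_Picard"
begin

text \<open>The class of \<open>X\<close> is reducible, meaning not irreducible, exactly when it is the unit or a sum of two
non-unit classes (\<open>not_mm_irreducible_iff\<close>). One direction needs \<open>\<Y> \<boxplus> \<Z> \<noteq> \<Y>\<close> for a non-unit
\<open>\<Z>\<close> (\<open>mm_plus_neq_summand\<close>), which the supremum of \<open>\<integral> exp (- d y y') d\<mu>(y')\<close> over \<open>y\<close> detects: it
is positive, and adding \<open>\<Z>\<close> multiplies it by at most some number below one.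

Density is elementary. Adding a two-point space of small diameter moves a non-unit class only
slightly and makes it reducible, and the unit is reducible itself. Conversely, glue one point of small
mass to \<open>X\<close> in such a way that it hangs, at positive distance, from a single point \<open>x\<^sub>0\<close>. In an \<open>\<ell>\<^sub>1\<close> product of two
spaces with at least two points every point \<open>(p, q)\<close> lies metrically between some \<open>(p', q)\<close> and
\<open>(p, q')\<close>; a pendant point lies between no two others, so the glued space is irreducible
(\<open>pendant_irreducible\<close>).

For the \<open>G\<^sub>\<delta>\<close> property the reducible classes are covered by countably many closed sets of reducible
classes. The pieces are the closures of the sets of sums \<open>\<Y> \<boxplus> \<Z>\<close> both of whose summands are spread out
by at least \<open>1 / (n + 1)\<close>, together with the unit. What has to be shown is that a limit \<open>X\<close> of sums
\<open>Y\<^sub>k = A\<^sub>k \<boxplus> B\<^sub>k\<close> of spread out spaces is again a sum of two non-trivial spaces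
(\<open>closure_spread_sums_reducible\<close>). To this end the two
summands are regarded as pseudometrics on the product. Gromov--Prohorov convergence
provides maps \<open>T\<^sub>k : X \<rightarrow> Y\<^sub>k\<close> that are asymptotically isometric and along which integrals of
equi-Lipschitz functions converge (\<open>approximating_maps\<close>). The metric of \<open>Y\<^sub>k\<close> is \<open>a\<^sub>k + b\<^sub>k\<close>, where the
pseudometric \<open>a\<^sub>k\<close> sees only the first and \<open>b\<^sub>k\<close> only the second coordinate. By separability and the
Lipschitz property a subsequence of the pulled back \<open>a\<^sub>k\<close> and \<open>b\<^sub>k\<close> converges pointwise on \<open>X\<close>, and the
limits \<open>a\<close> and \<open>b\<close> are pseudometrics that add up to the metric of \<open>X\<close>. That the two coordinates are
independent can be expressed by integrals of test functions built from \<open>a\<^sub>k\<close> and \<open>b\<^sub>k\<close>, so it passes to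
the limit (\<open>splitting_limit\<close>), and being spread out prevents \<open>a\<close> and \<open>b\<close> from vanishing.

A splitting \<open>(a, b)\<close> of the metric turns \<open>X\<close> back into a sum (\<open>splitting_imp_mm_plus\<close>): independence
and completeness give, for all \<open>x\<close> and \<open>y\<close>, a point \<open>z\<close> with \<open>a x z = 0\<close> and \<open>b y z = 0\<close>. Hence \<open>X\<close> is
the \<open>\<ell>\<^sub>1\<close> product of the fibres \<open>{z. b x\<^sub>0 z = 0}\<close> and \<open>{z. a x\<^sub>0 z = 0}\<close>, and independence identifies the
measure as a product measure.\<close>


section \<open>Metric measure spaces\<close>

locale metric_measure_space = prob_space M for m :: "'a metric" and M :: "'a measure" +
  assumes complete: "mcomplete_of m"
    and separable: "separable_space (mtopology_of m)"
    and sets_M: "sets M = sets (borel_metric m)"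
    and full_support: "openin (mtopology_of m) U \<Longrightarrow> U \<noteq> {} \<Longrightarrow> 0 < measure M U"

lemma mm_space_iff: "mm_space X \<longleftrightarrow> metric_measure_space (fst X) (snd X)"
  unfolding mm_space_def metric_measure_space_def metric_measure_space_axioms_def
  by (auto split: prod.splits)

lemma mdist_self [simp]: "x \<in> mspace m \<Longrightarrow> mdist m x x = 0"
  using mdist_zero by metis

context metric_measure_space
begin

lemma space_M [simp]: "space M = mspace m"
  by (rule space_mm[OF sets_M])

lemma mspace_nonempty: "mspace m \<noteq> {}"
  using not_empty by simp

lemma sets_open: "openin (mtopology_of m) U \<Longrightarrow> U \<in> sets M"
  unfolding sets_M by (rule openin_borel_metric)

lemma measure_ball_pos:
  assumes "x \<in> mspace m" "0 < r"
  shows "0 < measure M (mball_of m x r)"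
proof (rule full_support[OF openin_mball_of])
  have "x \<in> mball_of m x r" using assms by simp
  then show "mball_of m x r \<noteq> {}" by blast
qed

lemma lipschitz_measurable:
  fixes f :: "'a \<Rightarrow> real"
  assumes lip: "\<And>x y. x \<in> mspace m \<Longrightarrow> y \<in> mspace m \<Longrightarrow> \<bar>f x - f y\<bar> \<le> L * mdist m x y"
  shows "f \<in> borel_measurable M"
proof (rule borel_measurableI)
  fix S :: "real set" assume S: "open S"
  have "openin (mtopology_of m) (f -` S \<inter> mspace m)"
    unfolding openin_mtopology_of
  proof (intro conjI ballI)
    fix x assume x: "x \<in> f -` S \<inter> mspace m"
    then obtain e where e: "e > 0" "\<And>y. \<bar>y - f x\<bar> < e \<Longrightarrow> y \<in> S"
      using S unfolding open_dist dist_real_def by auto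
    have "mball_of m x (e / (\<bar>L\<bar> + 1)) \<subseteq> f -` S \<inter> mspace m"
    proof
      fix y assume "y \<in> mball_of m x (e / (\<bar>L\<bar> + 1))"
      then have y: "y \<in> mspace m" "mdist m x y * (\<bar>L\<bar> + 1) < e"
        by (auto simp: pos_less_divide_eq)
      have "\<bar>f y - f x\<bar> \<le> L * mdist m x y"
        using lip[of y x] x y mdist_commute[of m x y] by simp
      also have "\<dots> \<le> mdist m x y * (\<bar>L\<bar> + 1)"
        by (subst mult.commute) (rule mult_left_mono, auto)
      finally show "y \<in> f -` S \<inter> mspace m"
        using y e(2) by auto
    qed
    then show "\<exists>r>0. mball_of m x r \<subseteq> f -` S \<inter> mspace m"
      using e(1) by (intro exI[of _ "e / (\<bar>L\<bar> + 1)"]) auto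
  qed auto
  then show "f -` S \<inter> space M \<in> sets M"
    by (simp add: sets_open)
qed

lemma integrable_unit:
  fixes f :: "'a \<Rightarrow> real"
  assumes "f \<in> borel_measurable M" "\<And>x. x \<in> mspace m \<Longrightarrow> 0 \<le> f x \<and> f x \<le> 1"
  shows "integrable M f"
  by (rule integrable_const_bound[where B = 1]) (use assms in auto)

end

section \<open>Bridges between metric measure spaces\<close>

text \<open>A common metric extension of \<open>X\<close> and \<open>Y\<close> only matters through the distances \<open>D x y\<close> between points of
the two spaces. The first two groups of conditions say that \<open>D\<close> completes the two metrics to a
pseudometric on the disjoint union, the last one that the Prohorov distance there is at most \<open>\<epsilon>\<close>.
Working with \<open>D\<close> avoids carrying embeddings and push-forward measures around.\<close>

definition bridge :: "'a metric_measure \<Rightarrow> 'b metric_measure \<Rightarrow> real \<Rightarrow> ('a \<Rightarrow> 'b \<Rightarrow> real) \<Rightarrow> bool" where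
  "bridge X Y \<epsilon> D \<longleftrightarrow> 0 < \<epsilon> \<and>
     (\<forall>x\<in>mspace (fst X). \<forall>x'\<in>mspace (fst X). \<forall>y\<in>mspace (fst Y).
        D x y \<le> mdist (fst X) x x' + D x' y \<and> mdist (fst X) x x' \<le> D x y + D x' y) \<and>
     (\<forall>x\<in>mspace (fst X). \<forall>y\<in>mspace (fst Y). \<forall>y'\<in>mspace (fst Y).
        D x y \<le> D x y' + mdist (fst Y) y' y \<and> mdist (fst Y) y y' \<le> D x y + D x y') \<and>
     (\<forall>A\<in>sets (borel_metric (fst X)).
        measure (snd X) A \<le> measure (snd Y) {y \<in> mspace (fst Y). \<exists>x\<in>A. D x y < \<epsilon>} + \<epsilon>) \<and>
     (\<forall>B\<in>sets (borel_metric (fst Y)).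
        measure (snd Y) B \<le> measure (snd X) {x \<in> mspace (fst X). \<exists>y\<in>B. D x y < \<epsilon>} + \<epsilon>)"

lemma bridgeD:
  assumes "bridge X Y \<epsilon> D"
  shows "0 < \<epsilon>"
    and "\<And>x x' y. x \<in> mspace (fst X) \<Longrightarrow> x' \<in> mspace (fst X) \<Longrightarrow> y \<in> mspace (fst Y) \<Longrightarrow>
        D x y \<le> mdist (fst X) x x' + D x' y"
    and "\<And>x x' y. x \<in> mspace (fst X) \<Longrightarrow> x' \<in> mspace (fst X) \<Longrightarrow> y \<in> mspace (fst Y) \<Longrightarrow>
        mdist (fst X) x x' \<le> D x y + D x' y"
    and "\<And>x y y'. x \<in> mspace (fst X) \<Longrightarrow> y \<in> mspace (fst Y) \<Longrightarrow> y' \<in> mspace (fst Y) \<Longrightarrow>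
        D x y \<le> D x y' + mdist (fst Y) y' y"
    and "\<And>x y y'. x \<in> mspace (fst X) \<Longrightarrow> y \<in> mspace (fst Y) \<Longrightarrow> y' \<in> mspace (fst Y) \<Longrightarrow>
        mdist (fst Y) y y' \<le> D x y + D x y'"
    and "\<And>A. A \<in> sets (borel_metric (fst X)) \<Longrightarrow>
        measure (snd X) A \<le> measure (snd Y) {y \<in> mspace (fst Y). \<exists>x\<in>A. D x y < \<epsilon>} + \<epsilon>"
    and "\<And>B. B \<in> sets (borel_metric (fst Y)) \<Longrightarrow>
        measure (snd Y) B \<le> measure (snd X) {x \<in> mspace (fst X). \<exists>y\<in>B. D x y < \<epsilon>} + \<epsilon>"
  using assms unfolding bridge_def by blast+

lemma bridge_nonneg:
  assumes "bridge X Y \<epsilon> D" "x \<in> mspace (fst X)" "y \<in> mspace (fst Y)"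
  shows "0 \<le> D x y"
  using bridgeD(3)[OF assms(1), of x x y] assms(2,3) by simp

lemma bridge_swap:
  assumes "bridge X Y \<epsilon> D"
  shows "bridge Y X \<epsilon> (\<lambda>y x. D x y)"
proof -
  have "D x y \<le> mdist (fst Y) y y' + D x y'"
    if "x \<in> mspace (fst X)" "y \<in> mspace (fst Y)" "y' \<in> mspace (fst Y)" for x y y'
    using bridgeD(4)[OF assms that] mdist_commute[of "fst Y" y y'] by simp
  moreover have "D x y \<le> D x' y + mdist (fst X) x' x"
    if "x \<in> mspace (fst X)" "x' \<in> mspace (fst X)" "y \<in> mspace (fst Y)" for x x' y
    using bridgeD(2)[OF assms that] mdist_commute[of "fst X" x x'] by simp
  ultimately show ?thesis
    unfolding bridge_def using bridgeD(1,3,5,6,7)[OF assms]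
    by (intro conjI ballI) assumption+
qed

text \<open>Enlargements of arbitrary sets are open, hence measurable, which is what makes monotonicity of the
measures applicable to them.\<close>

lemma openin_bridge_enlargement:
  assumes D: "\<And>x y y'. x \<in> A \<Longrightarrow> y \<in> mspace n \<Longrightarrow> y' \<in> mspace n \<Longrightarrow>
        D x y \<le> D x y' + mdist n y' y"
  shows "openin (mtopology_of n) {y \<in> mspace n. \<exists>x\<in>A. D x y < \<epsilon>}"
  unfolding openin_mtopology_of
proof (intro conjI ballI)
  fix y assume "y \<in> {y \<in> mspace n. \<exists>x\<in>A. D x y < \<epsilon>}"
  then obtain x where x: "x \<in> A" "D x y < \<epsilon>" "y \<in> mspace n" by blast
  have "mball_of n y (\<epsilon> - D x y) \<subseteq> {y \<in> mspace n. \<exists>x\<in>A. D x y < \<epsilon>}"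
  proof
    fix z assume "z \<in> mball_of n y (\<epsilon> - D x y)"
    then have z: "z \<in> mspace n" "mdist n y z < \<epsilon> - D x y" by auto
    then have "D x z < \<epsilon>" using D[of x z y] x by linarith
    then show "z \<in> {y \<in> mspace n. \<exists>x\<in>A. D x y < \<epsilon>}"
      using z(1) x(1) by blast
  qed
  then show "\<exists>r>0. mball_of n y r \<subseteq> {y \<in> mspace n. \<exists>x\<in>A. D x y < \<epsilon>}"
    using x(2) by (intro exI[of _ "\<epsilon> - D x y"]) simp
qed auto

text \<open>The images of \<open>X\<close> and \<open>Y\<close> in the common space are closed because \<open>X\<close> and \<open>Y\<close> are complete, so
images of Borel sets are Borel and the Prohorov condition can be applied to them.\<close>

lemma gpr_less_imp_bridge:
  assumes X: "mm_space X" and Y: "mm_space Y" and less: "gpr X Y < \<epsilon>"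
  shows "\<exists>D. bridge X Y \<epsilon> D"
proof -
  interpret X: metric_measure_space "fst X" "snd X" using X by (simp add: mm_space_iff)
  interpret Y: metric_measure_space "fst Y" "snd Y" using Y by (simp add: mm_space_iff)
  obtain Z :: "('a + 'b) metric" and \<phi> \<psi> where \<phi>: "isometric_embedding (fst X) Z \<phi>"
    and \<psi>: "isometric_embedding (fst Y) Z \<psi>"
    and P: "prohorov_dist Z (distr (snd X) (borel_metric Z) \<phi>) (distr (snd Y) (borel_metric Z) \<psi>) < \<epsilon>"
    using gpr_greatest[OF X Y, of \<epsilon>] less by (meson not_le)
  let ?\<mu> = "distr (snd X) (borel_metric Z) \<phi>" and ?\<nu> = "distr (snd Y) (borel_metric Z) \<psi>"
  let ?S = "{\<epsilon>. \<epsilon> > 0 \<and> (\<forall>A\<in>sets (borel_metric Z).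
     measure ?\<mu> A \<le> measure ?\<nu> (enlargement Z A \<epsilon>) + \<epsilon> \<and>
     measure ?\<nu> A \<le> measure ?\<mu> (enlargement Z A \<epsilon>) + \<epsilon>)}"
  note m\<phi> = measurable_mm[OF X.sets_M \<phi>] and m\<psi> = measurable_mm[OF Y.sets_M \<psi>]
  interpret P: prob_space ?\<mu> by (rule X.prob_space_distr[OF m\<phi>])
  interpret Q: prob_space ?\<nu> by (rule Y.prob_space_distr[OF m\<psi>])
  have "(1::real) \<in> ?S"
    using P.prob_le_1 Q.prob_le_1 by (auto intro: add_increasing)
  then have "?S \<noteq> {}" by blast
  moreover have "bdd_below ?S" by (rule bdd_belowI[of _ 0]) simp
  ultimately obtain e where e: "e \<in> ?S" "e < \<epsilon>"
    using P unfolding prohorov_dist_def by (subst (asm) cInf_less_iff) auto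
  have \<phi>m: "\<phi> x \<in> mspace Z" if "x \<in> mspace (fst X)" for x
    using \<phi> that unfolding isometric_embedding_def by blast
  have \<psi>m: "\<psi> y \<in> mspace Z" if "y \<in> mspace (fst Y)" for y
    using \<psi> that unfolding isometric_embedding_def by blast
  have \<phi>d: "mdist (fst X) x x' = mdist Z (\<phi> x) (\<phi> x')"
    if "x \<in> mspace (fst X)" "x' \<in> mspace (fst X)" for x x'
    using \<phi> that unfolding isometric_embedding_def by simp
  have \<psi>d: "mdist (fst Y) y y' = mdist Z (\<psi> y) (\<psi> y')"
    if "y \<in> mspace (fst Y)" "y' \<in> mspace (fst Y)" for y y'
    using \<psi> that unfolding isometric_embedding_def by simp
  have img: "f ` mspace k \<in> sets (borel_metric Z)"
    if "isometric_embedding k Z f" "mcomplete_of k" for k :: "'c metric" and f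
  proof -
    have c: "closedin (mtopology_of Z) (f ` mspace k)"
      by (rule closedin_isometric_image[OF that])
    then have "mspace Z - f ` mspace k \<in> sets (borel_metric Z)"
      by (intro openin_borel_metric) (simp add: closedin_def)
    then have "space (borel_metric Z) - (mspace Z - f ` mspace k) \<in> sets (borel_metric Z)"
      using sets.compl_sets by blast
    moreover have "f ` mspace k \<subseteq> mspace Z" using closedin_subset[OF c] by simp
    ultimately show ?thesis by (simp add: double_diff)
  qed
  have half: "measure (snd V) A \<le> measure (snd W) {w \<in> mspace (fst W). \<exists>v\<in>A. mdist Z (f v) (g w) < \<epsilon>} + \<epsilon>"
    if V: "metric_measure_space (fst V) (snd V)" and W: "metric_measure_space (fst W) (snd W)"
      and f: "isometric_embedding (fst V) Z f" and g: "isometric_embedding (fst W) Z g"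
      and A: "A \<in> sets (borel_metric (fst V))"
      and le: "\<And>B. B \<in> sets (borel_metric Z) \<Longrightarrow> measure (distr (snd V) (borel_metric Z) f) B
          \<le> measure (distr (snd W) (borel_metric Z) g) (enlargement Z B e) + e"
    for V :: "'c metric_measure" and W :: "'d metric_measure" and f g A
  proof -
    interpret V: metric_measure_space "fst V" "snd V" by fact
    interpret W: metric_measure_space "fst W" "snd W" by fact
    have Am: "A \<subseteq> mspace (fst V)" using sets.sets_into_space[OF A] by simp
    have fA: "f ` A \<in> sets (borel_metric Z)"
      by (rule image_isometric_embedding_borel[OF f img[OF f V.complete] A])
    have fAm: "f ` A \<subseteq> mspace Z" using sets.sets_into_space[OF fA] by simp
    have "f -` f ` A \<inter> mspace (fst V) = A"
      using Am isometric_embedding_inj[OF f] by (auto simp: inj_on_def)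
    then have "measure (snd V) A = measure (distr (snd V) (borel_metric Z) f) (f ` A)"
      by (simp add: measure_distr[OF measurable_mm[OF V.sets_M f] fA])
    also have "\<dots> \<le> measure (distr (snd W) (borel_metric Z) g) (enlargement Z (f ` A) e) + e"
      by (rule le[OF fA])
    also have "measure (distr (snd W) (borel_metric Z) g) (enlargement Z (f ` A) e)
        = measure (snd W) (g -` enlargement Z (f ` A) e \<inter> mspace (fst W))"
      by (simp add: measure_distr[OF measurable_mm[OF W.sets_M g] openin_borel_metric[OF openin_enlargement[OF fAm]]])
    also have "\<dots> \<le> measure (snd W) {w \<in> mspace (fst W). \<exists>v\<in>A. mdist Z (f v) (g w) < \<epsilon>}"
    proof (rule W.finite_measure_mono)
      show "g -` enlargement Z (f ` A) e \<inter> mspace (fst W) \<subseteq> {w \<in> mspace (fst W). \<exists>v\<in>A. mdist Z (f v) (g w) < \<epsilon>}"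
        using e(2) less_trans unfolding enlargement_def by blast
      have "openin (mtopology_of (fst W)) {w \<in> mspace (fst W). \<exists>v\<in>A. mdist Z (f v) (g w) < \<epsilon>}"
      proof (rule openin_bridge_enlargement)
        fix x y y' assume "x \<in> A" "y \<in> mspace (fst W)" "y' \<in> mspace (fst W)"
        then show "mdist Z (f x) (g y) \<le> mdist Z (f x) (g y') + mdist (fst W) y' y"
          using f g Am mdist_triangle[of "f x" Z "g y'" "g y"] unfolding isometric_embedding_def
          by (auto simp: Pi_iff subset_iff)
      qed
      then show "{w \<in> mspace (fst W). \<exists>v\<in>A. mdist Z (f v) (g w) < \<epsilon>} \<in> sets (snd W)"
        by (rule W.sets_open)
    qed
    finally show ?thesis using e(2) by linarith
  qed
  have "bridge X Y \<epsilon> (\<lambda>x y. mdist Z (\<phi> x) (\<psi> y))"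
    unfolding bridge_def
  proof (intro conjI ballI)
    fix x x' y assume xy: "x \<in> mspace (fst X)" "x' \<in> mspace (fst X)" "y \<in> mspace (fst Y)"
    show "mdist Z (\<phi> x) (\<psi> y) \<le> mdist (fst X) x x' + mdist Z (\<phi> x') (\<psi> y)"
      using xy mdist_triangle[OF \<phi>m \<phi>m \<psi>m] by (simp add: \<phi>d)
    show "mdist (fst X) x x' \<le> mdist Z (\<phi> x) (\<psi> y) + mdist Z (\<phi> x') (\<psi> y)"
      using xy mdist_triangle[OF \<phi>m \<psi>m \<phi>m, of x y x'] by (simp add: \<phi>d mdist_commute[of Z "\<psi> y"])
  next
    fix x y y' assume xy: "x \<in> mspace (fst X)" "y \<in> mspace (fst Y)" "y' \<in> mspace (fst Y)"
    show "mdist Z (\<phi> x) (\<psi> y) \<le> mdist Z (\<phi> x) (\<psi> y') + mdist (fst Y) y' y"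
      using xy mdist_triangle[OF \<phi>m \<psi>m \<psi>m] by (simp add: \<psi>d)
    show "mdist (fst Y) y y' \<le> mdist Z (\<phi> x) (\<psi> y) + mdist Z (\<phi> x) (\<psi> y')"
      using xy mdist_triangle[OF \<psi>m \<phi>m \<psi>m, of y x y'] by (simp add: \<psi>d mdist_commute[of Z "\<psi> y"])
  next
    fix A assume A: "A \<in> sets (borel_metric (fst X))"
    show "measure (snd X) A \<le> measure (snd Y) {y \<in> mspace (fst Y). \<exists>x\<in>A. mdist Z (\<phi> x) (\<psi> y) < \<epsilon>} + \<epsilon>"
      by (rule half[OF _ _ \<phi> \<psi> A]) (use e(1) in \<open>auto intro: X.metric_measure_space_axioms Y.metric_measure_space_axioms\<close>)
  next
    fix B assume B: "B \<in> sets (borel_metric (fst Y))"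
    have "measure (snd Y) B \<le> measure (snd X) {x \<in> mspace (fst X). \<exists>y\<in>B. mdist Z (\<psi> y) (\<phi> x) < \<epsilon>} + \<epsilon>"
      by (rule half[OF _ _ \<psi> \<phi> B]) (use e(1) in \<open>auto intro: X.metric_measure_space_axioms Y.metric_measure_space_axioms\<close>)
    then show "measure (snd Y) B \<le> measure (snd X) {x \<in> mspace (fst X). \<exists>y\<in>B. mdist Z (\<phi> x) (\<psi> y) < \<epsilon>} + \<epsilon>"
      by (simp add: mdist_commute[of Z "\<phi> _"])
  qed (use e in auto)
  then show ?thesis by blast
qed


section \<open>The triangle inequality and closures of sets of classes\<close>

text \<open>Adding \<open>e > 0\<close> to \<open>D\<close> makes the pseudometric on the disjoint union a metric, so that no quotient has to
be formed.\<close>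

lemma bridge_imp_gpr_le:
  assumes X: "mm_space X" and Y: "mm_space Y" and D: "bridge X Y \<epsilon> D"
  shows "gpr X Y \<le> \<epsilon>"
proof (rule field_le_epsilon)
  fix e :: real assume e: "0 < e"
  interpret X: metric_measure_space "fst X" "snd X" using X by (simp add: mm_space_iff)
  interpret Y: metric_measure_space "fst Y" "snd Y" using Y by (simp add: mm_space_iff)
  note D0 = bridge_nonneg[OF D] and D1 = bridgeD(2)[OF D] and D2 = bridgeD(3)[OF D]
    and D3 = bridgeD(4)[OF D] and D4 = bridgeD(5)[OF D]
  define S where "S = Inl ` mspace (fst X) \<union> Inr ` mspace (fst Y)"
  define d where "d u v = (case (u, v) of
      (Inl x, Inl x') \<Rightarrow> mdist (fst X) x x' | (Inr y, Inr y') \<Rightarrow> mdist (fst Y) y y'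
    | (Inl x, Inr y) \<Rightarrow> D x y + e | (Inr y, Inl x) \<Rightarrow> D x y + e)" for u v
  have d[simp]: "d (Inl x) (Inl x') = mdist (fst X) x x'" "d (Inr y) (Inr y') = mdist (fst Y) y y'"
    "d (Inl x) (Inr y) = D x y + e" "d (Inr y) (Inl x) = D x y + e" for x x' y y'
    by (simp_all add: d_def)
  interpret Z: Metric_space S "\<lambda>u v. if u \<in> S \<and> v \<in> S then d u v else 0"
  proof
    fix u v :: "'a + 'b"
    show "0 \<le> (if u \<in> S \<and> v \<in> S then d u v else 0)"
      using D0 e by (auto simp: S_def add_nonneg_nonneg less_imp_le)
    show "(if u \<in> S \<and> v \<in> S then d u v else 0) = (if v \<in> S \<and> u \<in> S then d v u else 0)"
      by (cases u; cases v) (simp_all add: mdist_commute)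
  next
    fix u v assume "u \<in> S" "v \<in> S"
    then show "((if u \<in> S \<and> v \<in> S then d u v else 0) = 0) = (u = v)"
      using D0 e by (auto simp: S_def add_nonneg_eq_0_iff)
  next
    fix u v w assume uvw: "u \<in> S" "v \<in> S" "w \<in> S"
    have *: "D x y + e \<le> mdist (fst X) x x' + (D x' y + e)"
      "mdist (fst X) x x' \<le> D x y + e + (D x' y + e)"
      "D x' y + e \<le> D x y + e + mdist (fst X) x x'"
      if "x \<in> mspace (fst X)" "x' \<in> mspace (fst X)" "y \<in> mspace (fst Y)" for x x' y
      using D1[OF that] D1[OF that(2,1,3)] D2[OF that] e mdist_commute[of "fst X" x x'] by linarith+
    have **: "D x y + e \<le> D x y' + e + mdist (fst Y) y' y"
      "mdist (fst Y) y y' \<le> D x y + e + (D x y' + e)"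
      "D x y + e \<le> mdist (fst Y) y y' + (D x y' + e)"
      if "x \<in> mspace (fst X)" "y \<in> mspace (fst Y)" "y' \<in> mspace (fst Y)" for x y y'
      using D3[OF that] D3[OF that(1,3,2)] D4[OF that] e mdist_commute[of "fst Y" y y'] by linarith+
    have "d u w \<le> d u v + d v w"
    proof (cases u; cases v; cases w)
      fix x x' x'' assume h: "u = Inl x" "v = Inl x'" "w = Inl x''"
      then show ?thesis using uvw unfolding h d S_def by (auto intro!: mdist_triangle)
    next
      fix x x' y assume h: "u = Inl x" "v = Inl x'" "w = Inr y"
      then show ?thesis using uvw *(1)[of x x' y] unfolding h d S_def by auto
    next
      fix x y x' assume h: "u = Inl x" "v = Inr y" "w = Inl x'"
      then show ?thesis using uvw *(2)[of x x' y] unfolding h d S_def by auto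
    next
      fix x y y' assume h: "u = Inl x" "v = Inr y'" "w = Inr y"
      then show ?thesis using uvw **(1)[of x y y'] unfolding h d S_def by auto
    next
      fix x x' y assume h: "u = Inr y" "v = Inl x" "w = Inl x'"
      then show ?thesis using uvw *(3)[of x x' y] unfolding h d S_def by auto
    next
      fix x y y' assume h: "u = Inr y" "v = Inl x" "w = Inr y'"
      then show ?thesis using uvw **(2)[of x y y'] unfolding h d S_def by auto
    next
      fix x y y' assume h: "u = Inr y" "v = Inr y'" "w = Inl x"
      then show ?thesis using uvw **(3)[of x y y'] unfolding h d S_def by auto
    next
      fix y y' y'' assume h: "u = Inr y" "v = Inr y'" "w = Inr y''"
      then show ?thesis using uvw unfolding h d S_def by (auto intro!: mdist_triangle)
    qed
    then show "(if u \<in> S \<and> w \<in> S then d u w else 0) \<le>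
        (if u \<in> S \<and> v \<in> S then d u v else 0) + (if v \<in> S \<and> w \<in> S then d v w else 0)"
      using uvw by simp
  qed
  define Z where "Z = metric (S, \<lambda>u v. if u \<in> S \<and> v \<in> S then d u v else 0)"
  have mZ: "mspace Z = S" and dZ: "u \<in> S \<Longrightarrow> v \<in> S \<Longrightarrow> mdist Z u v = d u v" for u v
    by (simp_all add: Z_def)
  have \<phi>: "isometric_embedding (fst X) Z Inl" and \<psi>: "isometric_embedding (fst Y) Z Inr"
    unfolding isometric_embedding_def mZ by (auto simp: dZ S_def)
  note m\<phi> = measurable_mm[OF X.sets_M \<phi>] and m\<psi> = measurable_mm[OF Y.sets_M \<psi>]
  let ?\<mu> = "distr (snd X) (borel_metric Z) Inl" and ?\<nu> = "distr (snd Y) (borel_metric Z) Inr"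
  have "\<epsilon> > 0" by (rule bridgeD(1)[OF D])
  have "prohorov_dist Z ?\<mu> ?\<nu> \<le> \<epsilon> + e"
    unfolding prohorov_dist_def
  proof (rule cInf_lower, rule CollectI, intro conjI ballI)
    show "0 < \<epsilon> + e" using \<open>\<epsilon> > 0\<close> e by simp
  next
    fix A assume A: "A \<in> sets (borel_metric Z)"
    then have "A \<subseteq> S" using sets.sets_into_space by (fastforce simp: mZ)
    have En: "enlargement Z A (\<epsilon> + e) \<in> sets (borel_metric Z)"
      by (rule openin_borel_metric[OF openin_enlargement]) (simp add: mZ \<open>A \<subseteq> S\<close>)
    let ?A = "Inl -` A \<inter> mspace (fst X)" and ?B = "Inr -` A \<inter> mspace (fst Y)"
    have sA: "?A \<in> sets (borel_metric (fst X))" "?B \<in> sets (borel_metric (fst Y))"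
      using measurable_sets[OF m\<phi> A] measurable_sets[OF m\<psi> A] by (simp_all add: X.sets_M Y.sets_M)
    have sE: "Inl -` enlargement Z A (\<epsilon> + e) \<inter> mspace (fst X) \<in> sets (snd X)"
      "Inr -` enlargement Z A (\<epsilon> + e) \<inter> mspace (fst Y) \<in> sets (snd Y)"
      using measurable_sets[OF m\<phi> En] measurable_sets[OF m\<psi> En] by simp_all
    have "measure ?\<mu> A = measure (snd X) ?A"
      by (simp add: measure_distr[OF m\<phi> A])
    also have "\<dots> \<le> measure (snd Y) {y \<in> mspace (fst Y). \<exists>x\<in>?A. D x y < \<epsilon>} + \<epsilon>"
      by (rule bridgeD(6)[OF D sA(1)])
    also have "measure (snd Y) {y \<in> mspace (fst Y). \<exists>x\<in>?A. D x y < \<epsilon>}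
        \<le> measure (snd Y) (Inr -` enlargement Z A (\<epsilon> + e) \<inter> mspace (fst Y))"
    proof (rule Y.finite_measure_mono[OF _ sE(2)], rule subsetI)
      fix y assume "y \<in> {y \<in> mspace (fst Y). \<exists>x\<in>?A. D x y < \<epsilon>}"
      then obtain x where xy: "y \<in> mspace (fst Y)" "x \<in> mspace (fst X)" "Inl x \<in> A" "D x y < \<epsilon>" by blast
      have "mdist Z (Inl x) (Inr y) < \<epsilon> + e" using xy by (subst dZ) (auto simp: S_def)
      then show "y \<in> Inr -` enlargement Z A (\<epsilon> + e) \<inter> mspace (fst Y)"
        using xy by (auto simp: enlargement_def mZ S_def)
    qed
    also have "\<dots> = measure ?\<nu> (enlargement Z A (\<epsilon> + e))"
      by (simp add: measure_distr[OF m\<psi> En])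
    finally show "measure ?\<mu> A \<le> measure ?\<nu> (enlargement Z A (\<epsilon> + e)) + (\<epsilon> + e)"
      using e by simp
    have "measure ?\<nu> A = measure (snd Y) ?B"
      by (simp add: measure_distr[OF m\<psi> A])
    also have "\<dots> \<le> measure (snd X) {x \<in> mspace (fst X). \<exists>y\<in>?B. D x y < \<epsilon>} + \<epsilon>"
      by (rule bridgeD(7)[OF D sA(2)])
    also have "measure (snd X) {x \<in> mspace (fst X). \<exists>y\<in>?B. D x y < \<epsilon>}
        \<le> measure (snd X) (Inl -` enlargement Z A (\<epsilon> + e) \<inter> mspace (fst X))"
    proof (rule X.finite_measure_mono[OF _ sE(1)], rule subsetI)
      fix x assume "x \<in> {x \<in> mspace (fst X). \<exists>y\<in>?B. D x y < \<epsilon>}"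
      then obtain y where xy: "x \<in> mspace (fst X)" "y \<in> mspace (fst Y)" "Inr y \<in> A" "D x y < \<epsilon>" by blast
      have "mdist Z (Inr y) (Inl x) < \<epsilon> + e" using xy by (subst dZ) (auto simp: S_def)
      then show "x \<in> Inl -` enlargement Z A (\<epsilon> + e) \<inter> mspace (fst X)"
        using xy by (auto simp: enlargement_def mZ S_def)
    qed
    also have "\<dots> = measure ?\<mu> (enlargement Z A (\<epsilon> + e))"
      by (simp add: measure_distr[OF m\<phi> En])
    finally show "measure ?\<nu> A \<le> measure ?\<mu> (enlargement Z A (\<epsilon> + e)) + (\<epsilon> + e)"
      using e by simp
  qed (rule bdd_belowI[of _ 0], simp)
  then show "gpr X Y \<le> \<epsilon> + e"
    using gpr_le[OF X Y \<phi> \<psi>] by linarith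
qed

text \<open>The glued distance is the length of the shortest path through \<open>Y\<close>. An \<open>\<alpha>\<close>-enlargement followed by a
\<open>\<beta>\<close>-enlargement is contained in the \<open>(\<alpha> + \<beta>)\<close>-enlargement for it.\<close>

lemma bridge_trans:
  assumes X: "mm_space X" and Y: "mm_space Y" and W: "mm_space W"
    and D: "bridge X Y \<alpha> D" and E: "bridge Y W \<beta> E"
  shows "bridge X W (\<alpha> + \<beta>) (\<lambda>x w. INF y\<in>mspace (fst Y). D x y + E y w)"
proof -
  interpret X: metric_measure_space "fst X" "snd X" using X by (simp add: mm_space_iff)
  interpret Y: metric_measure_space "fst Y" "snd Y" using Y by (simp add: mm_space_iff)
  interpret W: metric_measure_space "fst W" "snd W" using W by (simp add: mm_space_iff)
  define G where "G x w = (INF y\<in>mspace (fst Y). D x y + E y w)" for x w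
  have G_le: "G x w \<le> D x y + E y w"
    if "x \<in> mspace (fst X)" "w \<in> mspace (fst W)" "y \<in> mspace (fst Y)" for x y w
    unfolding G_def
  proof (rule cINF_lower[OF _ that(3)])
    show "bdd_below ((\<lambda>y. D x y + E y w) ` mspace (fst Y))"
      by (rule bdd_belowI[of _ 0])
        (use that bridge_nonneg[OF D] bridge_nonneg[OF E] in \<open>auto intro!: add_nonneg_nonneg\<close>)
  qed
  have G_ge: "c \<le> G x w" if "\<And>y. y \<in> mspace (fst Y) \<Longrightarrow> c \<le> D x y + E y w" for c x w
    unfolding G_def by (rule cINF_greatest[OF Y.mspace_nonempty that])
  note D1 = bridgeD(2)[OF D] and D2 = bridgeD(3)[OF D] and D3 = bridgeD(4)[OF D] and D4 = bridgeD(5)[OF D]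
  note E1 = bridgeD(2)[OF E] and E2 = bridgeD(3)[OF E] and E3 = bridgeD(4)[OF E] and E4 = bridgeD(5)[OF E]
  have pos: "0 < \<alpha>" "0 < \<beta>" using bridgeD(1)[OF D] bridgeD(1)[OF E] .
  have GX: "G x w \<le> mdist (fst X) x x' + G x' w"
    if h: "x \<in> mspace (fst X)" "x' \<in> mspace (fst X)" "w \<in> mspace (fst W)" for x x' w
  proof -
    have "G x w - mdist (fst X) x x' \<le> D x' y + E y w" if y: "y \<in> mspace (fst Y)" for y
      using G_le[OF h(1,3) y] D1[OF h(1,2) y] by linarith
    then show ?thesis using G_ge[of "G x w - mdist (fst X) x x'" x' w] by simp
  qed
  have GW: "G x w \<le> G x w' + mdist (fst W) w' w"
    if h: "x \<in> mspace (fst X)" "w \<in> mspace (fst W)" "w' \<in> mspace (fst W)" for x w w'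
  proof -
    have "G x w - mdist (fst W) w' w \<le> D x y + E y w'" if y: "y \<in> mspace (fst Y)" for y
      using G_le[OF h(1,2) y] E3[OF y h(2,3)] by linarith
    then show ?thesis using G_ge[of "G x w - mdist (fst W) w' w" x w'] by simp
  qed
  have "bridge X W (\<alpha> + \<beta>) G"
    unfolding bridge_def
  proof (intro conjI ballI)
    fix x x' w assume h: "x \<in> mspace (fst X)" "x' \<in> mspace (fst X)" "w \<in> mspace (fst W)"
    show "G x w \<le> mdist (fst X) x x' + G x' w" by (rule GX[OF h])
    have "mdist (fst X) x x' - (D x y + E y w) \<le> D x' y' + E y' w"
      if y: "y \<in> mspace (fst Y)" "y' \<in> mspace (fst Y)" for y y'
      using D2[OF h(1,2) y(1)] D3[OF h(2) y(1,2)] E2[OF y(2,1) h(3)] by linarith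
    then have *: "mdist (fst X) x x' - (D x y + E y w) \<le> G x' w" if "y \<in> mspace (fst Y)" for y
      by (intro G_ge) (simp_all add: that)
    have "mdist (fst X) x x' - G x' w \<le> D x y + E y w" if "y \<in> mspace (fst Y)" for y
      using *[OF that] by linarith
    from G_ge[OF this] show "mdist (fst X) x x' \<le> G x w + G x' w" by simp
  next
    fix x w w' assume h: "x \<in> mspace (fst X)" "w \<in> mspace (fst W)" "w' \<in> mspace (fst W)"
    show "G x w \<le> G x w' + mdist (fst W) w' w" by (rule GW[OF h])
    have "mdist (fst W) w w' - (D x y + E y w) \<le> D x y' + E y' w'"
      if y: "y \<in> mspace (fst Y)" "y' \<in> mspace (fst Y)" for y y'
      using E4[OF y(1) h(2,3)] E1[OF y h(3)] D4[OF h(1) y] by linarith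
    then have *: "mdist (fst W) w w' - (D x y + E y w) \<le> G x w'" if "y \<in> mspace (fst Y)" for y
      by (intro G_ge) (simp_all add: that)
    have "mdist (fst W) w w' - G x w' \<le> D x y + E y w" if "y \<in> mspace (fst Y)" for y
      using *[OF that] by linarith
    from G_ge[OF this] show "mdist (fst W) w w' \<le> G x w + G x w'" by simp
  next
    fix A assume A: "A \<in> sets (borel_metric (fst X))"
    then have Am: "A \<subseteq> mspace (fst X)" using sets.sets_into_space by fastforce
    let ?B = "{y \<in> mspace (fst Y). \<exists>x\<in>A. D x y < \<alpha>}"
    have "?B \<in> sets (borel_metric (fst Y))"
      by (rule openin_borel_metric[OF openin_bridge_enlargement]) (use D3 Am in blast)
    from bridgeD(6)[OF D A] bridgeD(6)[OF E this]
    have "measure (snd X) A \<le> measure (snd W) {w \<in> mspace (fst W). \<exists>y\<in>?B. E y w < \<beta>} + (\<alpha> + \<beta>)"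
      by linarith
    also have "measure (snd W) {w \<in> mspace (fst W). \<exists>y\<in>?B. E y w < \<beta>}
        \<le> measure (snd W) {w \<in> mspace (fst W). \<exists>x\<in>A. G x w < \<alpha> + \<beta>}"
    proof (rule W.finite_measure_mono)
      show "{w \<in> mspace (fst W). \<exists>y\<in>?B. E y w < \<beta>} \<subseteq> {w \<in> mspace (fst W). \<exists>x\<in>A. G x w < \<alpha> + \<beta>}"
      proof
        fix w assume "w \<in> {w \<in> mspace (fst W). \<exists>y\<in>?B. E y w < \<beta>}"
        then obtain x y where h: "w \<in> mspace (fst W)" "y \<in> mspace (fst Y)" "x \<in> A" "D x y < \<alpha>" "E y w < \<beta>"
          by blast
        have "G x w < \<alpha> + \<beta>" using G_le[of x w y] h Am by fastforce
        then show "w \<in> {w \<in> mspace (fst W). \<exists>x\<in>A. G x w < \<alpha> + \<beta>}" using h by blast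
      qed
      show "{w \<in> mspace (fst W). \<exists>x\<in>A. G x w < \<alpha> + \<beta>} \<in> sets (snd W)"
        by (rule W.sets_open[OF openin_bridge_enlargement]) (use GW Am in blast)
    qed
    finally show "measure (snd X) A \<le> measure (snd W) {w \<in> mspace (fst W). \<exists>x\<in>A. G x w < \<alpha> + \<beta>} + (\<alpha> + \<beta>)"
      by simp
  next
    fix A assume A: "A \<in> sets (borel_metric (fst W))"
    then have Am: "A \<subseteq> mspace (fst W)" using sets.sets_into_space by fastforce
    let ?B = "{y \<in> mspace (fst Y). \<exists>w\<in>A. E y w < \<beta>}"
    have "?B \<in> sets (borel_metric (fst Y))"
    proof (rule openin_borel_metric[OF openin_bridge_enlargement])
      fix w y y' assume "w \<in> A" "y \<in> mspace (fst Y)" "y' \<in> mspace (fst Y)"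
      then show "E y w \<le> E y' w + mdist (fst Y) y' y"
        using E1[of y y' w] Am mdist_commute[of "fst Y" y y'] by auto
    qed
    from bridgeD(7)[OF E A] bridgeD(7)[OF D this]
    have "measure (snd W) A \<le> measure (snd X) {x \<in> mspace (fst X). \<exists>y\<in>?B. D x y < \<alpha>} + (\<alpha> + \<beta>)"
      by linarith
    also have "measure (snd X) {x \<in> mspace (fst X). \<exists>y\<in>?B. D x y < \<alpha>}
        \<le> measure (snd X) {x \<in> mspace (fst X). \<exists>w\<in>A. G x w < \<alpha> + \<beta>}"
    proof (rule X.finite_measure_mono)
      show "{x \<in> mspace (fst X). \<exists>y\<in>?B. D x y < \<alpha>} \<subseteq> {x \<in> mspace (fst X). \<exists>w\<in>A. G x w < \<alpha> + \<beta>}"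
      proof
        fix x assume "x \<in> {x \<in> mspace (fst X). \<exists>y\<in>?B. D x y < \<alpha>}"
        then obtain w y where h: "x \<in> mspace (fst X)" "y \<in> mspace (fst Y)" "w \<in> A" "D x y < \<alpha>" "E y w < \<beta>"
          by blast
        have "G x w < \<alpha> + \<beta>" using G_le[of x w y] h Am by fastforce
        then show "x \<in> {x \<in> mspace (fst X). \<exists>w\<in>A. G x w < \<alpha> + \<beta>}" using h by blast
      qed
      show "{x \<in> mspace (fst X). \<exists>w\<in>A. G x w < \<alpha> + \<beta>} \<in> sets (snd X)"
      proof (rule X.sets_open[OF openin_bridge_enlargement])
        fix w x x' assume "w \<in> A" "x \<in> mspace (fst X)" "x' \<in> mspace (fst X)"
        then show "G x w \<le> G x' w + mdist (fst X) x' x"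
          using GX[of x x' w] Am mdist_commute[of "fst X" x x'] by auto
      qed
    qed
    finally show "measure (snd W) A \<le> measure (snd X) {x \<in> mspace (fst X). \<exists>w\<in>A. G x w < \<alpha> + \<beta>} + (\<alpha> + \<beta>)"
      by simp
  qed (use pos in simp)
  then show ?thesis unfolding G_def .
qed

lemma gpr_triangle:
  assumes X: "mm_space X" and Y: "mm_space Y" and W: "mm_space W"
  shows "gpr X W \<le> gpr X Y + gpr Y W"
proof (rule field_le_epsilon)
  fix e :: real assume e: "0 < e"
  obtain D where D: "bridge X Y (gpr X Y + e / 2) D"
    using gpr_less_imp_bridge[OF X Y, of "gpr X Y + e / 2"] e by auto
  obtain E where E: "bridge Y W (gpr Y W + e / 2) E"
    using gpr_less_imp_bridge[OF Y W, of "gpr Y W + e / 2"] e by auto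
  show "gpr X W \<le> gpr X Y + gpr Y W + e"
    using bridge_imp_gpr_le[OF X W bridge_trans[OF X Y W D E]] by simp
qed

lemma gpr_dist_triangle: "gpr_dist \<X> \<Z> \<le> gpr_dist \<X> \<Y> + gpr_dist \<Y> \<Z>"
  unfolding gpr_dist_def by (rule gpr_triangle[OF mm_space_rep mm_space_rep mm_space_rep])

text \<open>An isometric copy of \<open>X\<close> inside \<open>Y\<close> satisfies all metric conditions of a bridge, and only the
comparison of the measures remains.\<close>

lemma bridge_embedding:
  assumes i: "isometric_embedding (fst X) (fst Y) i" and e: "0 < \<epsilon>"
    and A: "\<And>A. A \<in> sets (borel_metric (fst X)) \<Longrightarrow>
      measure (snd X) A \<le> measure (snd Y) {y \<in> mspace (fst Y). \<exists>x\<in>A. mdist (fst Y) (i x) y < \<epsilon>} + \<epsilon>"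
    and B: "\<And>B. B \<in> sets (borel_metric (fst Y)) \<Longrightarrow>
      measure (snd Y) B \<le> measure (snd X) {x \<in> mspace (fst X). \<exists>y\<in>B. mdist (fst Y) (i x) y < \<epsilon>} + \<epsilon>"
  shows "bridge X Y \<epsilon> (\<lambda>x y. mdist (fst Y) (i x) y)"
proof -
  have im: "i x \<in> mspace (fst Y)" and id: "mdist (fst X) x x' = mdist (fst Y) (i x) (i x')"
    if "x \<in> mspace (fst X)" "x' \<in> mspace (fst X)" for x x'
    using i that unfolding isometric_embedding_def by auto
  show ?thesis
    unfolding bridge_def
  proof (intro conjI ballI)
    fix x x' y assume h: "x \<in> mspace (fst X)" "x' \<in> mspace (fst X)" "y \<in> mspace (fst Y)"
    show "mdist (fst Y) (i x) y \<le> mdist (fst X) x x' + mdist (fst Y) (i x') y"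
      unfolding id[OF h(1,2)] by (rule mdist_triangle) (use h im in auto)
    show "mdist (fst X) x x' \<le> mdist (fst Y) (i x) y + mdist (fst Y) (i x') y"
      unfolding id[OF h(1,2)] using mdist_triangle[of "i x" "fst Y" y "i x'"] h im
      by (simp add: mdist_commute[of "fst Y" y])
  next
    fix x y y' assume h: "x \<in> mspace (fst X)" "y \<in> mspace (fst Y)" "y' \<in> mspace (fst Y)"
    show "mdist (fst Y) (i x) y \<le> mdist (fst Y) (i x) y' + mdist (fst Y) y' y"
      by (rule mdist_triangle) (use h im in auto)
    show "mdist (fst Y) y y' \<le> mdist (fst Y) (i x) y + mdist (fst Y) (i x) y'"
      using mdist_triangle[of y "fst Y" "i x" y'] h im by (simp add: mdist_commute[of "fst Y" y "i x"])
  qed (use A B e in auto)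
qed

lemma bridge_refl:
  assumes X: "mm_space X" and e: "0 < e"
  shows "bridge X X e (mdist (fst X))"
proof (rule bridge_embedding)
  interpret X: metric_measure_space "fst X" "snd X" using X by (simp add: mm_space_iff)
  show le: "measure (snd X) A \<le> measure (snd X) {y \<in> mspace (fst X). \<exists>x\<in>A. mdist (fst X) x y < e} + e"
    if A: "A \<in> sets (borel_metric (fst X))" for A
  proof -
    have Am: "A \<subseteq> mspace (fst X)" using sets.sets_into_space[OF A] by simp
    have o: "openin (mtopology_of (fst X)) {y \<in> mspace (fst X). \<exists>x\<in>A. mdist (fst X) x y < e}"
      by (rule openin_bridge_enlargement) (use Am in \<open>auto intro: mdist_triangle\<close>)
    have "A \<subseteq> {y \<in> mspace (fst X). \<exists>x\<in>A. mdist (fst X) x y < e}"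
    proof
      fix x assume "x \<in> A"
      then have "x \<in> mspace (fst X)" "mdist (fst X) x x < e" using Am e by auto
      with \<open>x \<in> A\<close> show "x \<in> {y \<in> mspace (fst X). \<exists>x\<in>A. mdist (fst X) x y < e}" by blast
    qed
    from X.finite_measure_mono[OF this X.sets_open[OF o]] e show ?thesis by linarith
  qed
  show "measure (snd X) A \<le> measure (snd X) {y \<in> mspace (fst X). \<exists>x\<in>A. mdist (fst X) y x < e} + e"
    if "A \<in> sets (borel_metric (fst X))" for A
    using le[OF that] by (simp add: mdist_commute)
qed (use e in \<open>auto simp: isometric_embedding_def\<close>)

lemma gpr_dist_self: "0 < e \<Longrightarrow> gpr_dist \<X> \<X> < e"
  using bridge_imp_gpr_le[OF mm_space_rep mm_space_rep bridge_refl[OF mm_space_rep, of "e / 2" \<X>]]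
  by (simp add: gpr_dist_def)

text \<open>The topology is defined through balls, but that a ball is a neighbourhood of its centre is exactly
what the triangle inequality provides.\<close>

lemma in_closure_mm_iff:
  "\<X> \<in> closure S \<longleftrightarrow> (\<forall>e>0. \<exists>\<Y>\<in>S. gpr_dist \<X> \<Y> < e)" for S :: "mm set"
proof
  assume cl: "\<X> \<in> closure S"
  let ?U = "{\<Y>. \<exists>e>0. \<forall>\<Z>. gpr_dist \<Y> \<Z> < e \<longrightarrow> \<Z> \<notin> S}"
  have "open ?U"
    unfolding open_mm_def
  proof
    fix \<Y> assume "\<Y> \<in> ?U"
    then obtain e where e: "e > 0" "\<And>\<Z>. gpr_dist \<Y> \<Z> < e \<Longrightarrow> \<Z> \<notin> S" by blast
    have "\<W> \<in> ?U" if "gpr_dist \<Y> \<W> < e / 2" for \<W>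
    proof -
      have "\<Z> \<notin> S" if "gpr_dist \<W> \<Z> < e / 2" for \<Z>
        using e(2)[of \<Z>] gpr_dist_triangle[of \<Y> \<Z> \<W>] that \<open>gpr_dist \<Y> \<W> < e / 2\<close> by linarith
      then show ?thesis using half_gt_zero[OF e(1)] by blast
    qed
    then show "\<exists>r>0. \<forall>\<W>. gpr_dist \<Y> \<W> < r \<longrightarrow> \<W> \<in> ?U"
      using half_gt_zero[OF e(1)] by blast
  qed
  moreover have "?U \<inter> S = {}"
    using gpr_dist_self by force
  ultimately have "\<X> \<notin> ?U"
    using cl open_Int_closure_eq_empty by blast
  then show "\<forall>e>0. \<exists>\<Y>\<in>S. gpr_dist \<X> \<Y> < e" by blast
next
  assume *: "\<forall>e>0. \<exists>\<Y>\<in>S. gpr_dist \<X> \<Y> < e"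
  show "\<X> \<in> closure S"
    unfolding closure_iff_nhds_not_empty
  proof (intro allI impI)
    fix A V assume "V \<subseteq> A" "open V" "\<X> \<in> V"
    then show "S \<inter> A \<noteq> {}"
      using * unfolding open_mm_def by blast
  qed
qed


section \<open>Gromov--Prohorov convergence realised by maps\<close>

text \<open>The sum counts the natural numbers below \<open>t\<close>. Rescaled, it is a staircase that approximates a function
by finitely many indicators of superlevel sets, a discrete form of the layer cake formula.\<close>

lemma card_below_real:
  fixes t :: real
  assumes "0 \<le> t"
  shows "(\<Sum>j<N. if real j < t then 1 else 0) \<le> t + 1"
    and "t \<le> real N \<Longrightarrow> t \<le> (\<Sum>j<N. if real j < t then 1 else 0)"
proof -
  have sum: "(\<Sum>j<N. if real j < t then 1 else 0) = real (card {j\<in>{..<N}. real j < t})"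
    by (simp add: sum.If_cases Int_def)
  have eq: "real j < t \<longleftrightarrow> j < nat \<lceil>t\<rceil>" for j
    using assms by linarith
  have "card {j\<in>{..<N}. real j < t} \<le> nat \<lceil>t\<rceil>"
    using card_mono[of "{..<nat \<lceil>t\<rceil>}" "{j\<in>{..<N}. real j < t}"] by (auto simp: eq)
  then show "(\<Sum>j<N. if real j < t then 1 else 0) \<le> t + 1"
    unfolding sum using assms by linarith
  assume "t \<le> real N"
  then have "nat \<lceil>t\<rceil> \<le> N" by linarith
  then have "x < N" if "x < nat \<lceil>t\<rceil>" for x using that by (rule less_le_trans[rotated])
  then have "{j\<in>{..<N}. real j < t} = {..<nat \<lceil>t\<rceil>}"
    unfolding eq lessThan_iff by blast
  then show "t \<le> (\<Sum>j<N. if real j < t then 1 else 0)"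
    unfolding sum using assms by simp
qed

lemma (in prob_space) integral_staircase:
  fixes g :: "'a \<Rightarrow> real"
  assumes N: "0 < N" and g: "integrable M g" "\<And>x. x \<in> space M \<Longrightarrow> 0 \<le> g x"
  shows "(\<Sum>j<N. prob {x \<in> space M. real j < real N * g x}) \<le> real N * expectation g + 1"
    and "(\<And>x. x \<in> space M \<Longrightarrow> g x \<le> 1) \<Longrightarrow>
      real N * expectation g \<le> (\<Sum>j<N. prob {x \<in> space M. real j < real N * g x})"
proof -
  have [measurable]: "g \<in> borel_measurable M" using g(1) by simp
  let ?S = "\<lambda>x. \<Sum>j<N. indicator {x \<in> space M. real j < real N * g x} x :: real"
  have S: "?S x = (\<Sum>j<N. if real j < real N * g x then 1 else 0)" if "x \<in> space M" for x
    using that by (intro sum.cong) (auto simp: indicator_def)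
  have int: "integrable M ?S"
    by (intro Bochner_Integration.integrable_sum) (simp add: integrable_indicator_iff less_top[symmetric])
  have eq: "(\<Sum>j<N. prob {x \<in> space M. real j < real N * g x}) = expectation ?S"
  proof -
    have "{x \<in> space M. real j < real N * g x} \<inter> space M = {x \<in> space M. real j < real N * g x}" for j
      by auto
    then show ?thesis
      by (subst Bochner_Integration.integral_sum)
        (simp_all add: integrable_indicator_iff less_top[symmetric])
  qed
  have "expectation ?S \<le> expectation (\<lambda>x. real N * g x + 1)"
    using int g by (intro integral_mono) (auto simp: S intro: card_below_real(1))
  then show "(\<Sum>j<N. prob {x \<in> space M. real j < real N * g x}) \<le> real N * expectation g + 1"
    using g(1) by (simp add: eq prob_space)
  assume "\<And>x. x \<in> space M \<Longrightarrow> g x \<le> 1"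
  then have "expectation (\<lambda>x. real N * g x) \<le> expectation ?S"
    using int g N by (intro integral_mono) (auto simp: S intro!: card_below_real(2))
  then show "real N * expectation g \<le> (\<Sum>j<N. prob {x \<in> space M. real j < real N * g x})"
    by (simp add: eq)
qed

text \<open>The Prohorov condition compares the superlevel sets of \<open>f\<close> with those of \<open>h + L \<epsilon>\<close>, at the cost of
\<open>\<epsilon>\<close> for each of them; averaging over \<open>N\<close> levels costs \<open>\<epsilon>\<close> and a discretisation error \<open>1 / N\<close>.\<close>

lemma bridge_integral_le:
  fixes f :: "'b \<Rightarrow> real" and h :: "'a \<Rightarrow> real"
  assumes X: "mm_space X" and Y: "mm_space Y" and D: "bridge X Y \<epsilon> D"
    and f: "f \<in> borel_measurable (snd Y)" "\<And>y. y \<in> mspace (fst Y) \<Longrightarrow> 0 \<le> f y \<and> f y \<le> 1"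
    and h: "h \<in> borel_measurable (snd X)" "\<And>x. x \<in> mspace (fst X) \<Longrightarrow> 0 \<le> h x \<and> h x \<le> 1"
    and L: "0 \<le> L"
    and le: "\<And>x y. x \<in> mspace (fst X) \<Longrightarrow> y \<in> mspace (fst Y) \<Longrightarrow> f y \<le> h x + L * D x y"
  shows "integral\<^sup>L (snd Y) f \<le> integral\<^sup>L (snd X) h + (L + 1) * \<epsilon>"
proof -
  interpret X: metric_measure_space "fst X" "snd X" using X by (simp add: mm_space_iff)
  interpret Y: metric_measure_space "fst Y" "snd Y" using Y by (simp add: mm_space_iff)
  have eps: "0 < \<epsilon>" by (rule bridgeD(1)[OF D])
  note [measurable] = f(1) h(1)
  have fi: "integrable (snd Y) f" and hi: "integrable (snd X) h"
    using X.integrable_unit[OF h] Y.integrable_unit[OF f] by simp_all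
  have approx: "Y.expectation f \<le> X.expectation h + (L + 1) * \<epsilon> + inverse (real N)" if N: "0 < N" for N
  proof -
    \<comment> \<open>The function on \<open>X\<close> whose superlevel sets absorb the \<open>\<epsilon>\<close>-enlargements of those of \<open>f\<close>.\<close>
    let ?g = "\<lambda>x. h x + L * \<epsilon>"
    have "measure (snd Y) {y \<in> space (snd Y). real j < real N * f y}
        \<le> measure (snd X) {x \<in> space (snd X). real j < real N * ?g x} + \<epsilon>" for j
    proof -
      let ?B = "{y \<in> space (snd Y). real j < real N * f y}"
      have "?B \<in> sets (borel_metric (fst Y))"
        unfolding Y.sets_M[symmetric] by measurable
      then have "measure (snd Y) ?B \<le> measure (snd X) {x \<in> mspace (fst X). \<exists>y\<in>?B. D x y < \<epsilon>} + \<epsilon>"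
        by (rule bridgeD(7)[OF D])
      also have "measure (snd X) {x \<in> mspace (fst X). \<exists>y\<in>?B. D x y < \<epsilon>}
          \<le> measure (snd X) {x \<in> space (snd X). real j < real N * ?g x}"
      proof (rule X.finite_measure_mono)
        show "{x \<in> mspace (fst X). \<exists>y\<in>?B. D x y < \<epsilon>} \<subseteq> {x \<in> space (snd X). real j < real N * ?g x}"
        proof
          fix x assume "x \<in> {x \<in> mspace (fst X). \<exists>y\<in>?B. D x y < \<epsilon>}"
          then obtain y where xy: "x \<in> mspace (fst X)" "y \<in> mspace (fst Y)" "real j < real N * f y" "D x y < \<epsilon>"
            by auto
          have "f y \<le> ?g x"
            using le[OF xy(1,2)] mult_left_mono[OF less_imp_le[OF xy(4)] L] by linarith
          then have "real N * f y \<le> real N * ?g x" by (rule mult_left_mono) simp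
          then show "x \<in> {x \<in> space (snd X). real j < real N * ?g x}"
            using xy by auto
        qed
      qed measurable
      finally show ?thesis by simp
    qed
    then have "(\<Sum>j<N. measure (snd Y) {y \<in> space (snd Y). real j < real N * f y})
        \<le> (\<Sum>j<N. measure (snd X) {x \<in> space (snd X). real j < real N * ?g x} + \<epsilon>)"
      by (intro sum_mono) auto
    also have "\<dots> \<le> real N * X.expectation ?g + 1 + real N * \<epsilon>"
      using X.integral_staircase(1)[OF N, of ?g] hi h(2) L eps
      by (auto simp: sum.distrib intro!: add_nonneg_nonneg mult_nonneg_nonneg)
    finally have "real N * Y.expectation f \<le> real N * X.expectation ?g + 1 + real N * \<epsilon>"
      using Y.integral_staircase(2)[OF N fi] f(2) by fastforce
    also have "\<dots> = real N * (X.expectation h + (L + 1) * \<epsilon> + inverse (real N))"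
      using N hi by (simp add: X.prob_space[unfolded X.space_M] algebra_simps)
    finally show ?thesis using N by simp
  qed
  show ?thesis
  proof (rule field_le_epsilon)
    fix e :: real assume "0 < e"
    then obtain N where N: "0 < N" "inverse (real N) < e" using ex_inverse_of_nat_less by blast
    show "Y.expectation f \<le> X.expectation h + (L + 1) * \<epsilon> + e"
      using approx[OF N(1)] N(2) by linarith
  qed
qed

text \<open>The maps need not be measurable. The bridges are part of the definition in order that the
convergence of integrals survives passing to a subsequence of spaces, where the test functions
are given along the subsequence only.\<close>

definition approximating_maps ::
  "'a metric_measure \<Rightarrow> (nat \<Rightarrow> 'b metric_measure) \<Rightarrow> (nat \<Rightarrow> 'a \<Rightarrow> 'b) \<Rightarrow> bool" where
  "approximating_maps X Y T \<longleftrightarrow> mm_space X \<and> (\<forall>k. mm_space (Y k)) \<and>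
     (\<forall>k. \<forall>x\<in>mspace (fst X). T k x \<in> mspace (fst (Y k))) \<and>
     (\<exists>\<epsilon> D. (\<forall>k. bridge X (Y k) (\<epsilon> k) (D k)) \<and> \<epsilon> \<longlonglongrightarrow> 0 \<and>
       (\<forall>x\<in>mspace (fst X). (\<lambda>k. D k x (T k x)) \<longlonglongrightarrow> 0))"

lemma approximating_maps_subseq:
  assumes "approximating_maps X Y T" "strict_mono s"
  shows "approximating_maps X (\<lambda>k. Y (s k)) (\<lambda>k. T (s k))"
proof -
  obtain \<epsilon> D where D: "\<And>k. bridge X (Y k) (\<epsilon> k) (D k)" "\<epsilon> \<longlonglongrightarrow> 0"
      "\<And>x. x \<in> mspace (fst X) \<Longrightarrow> (\<lambda>k. D k x (T k x)) \<longlonglongrightarrow> 0"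
    using assms(1) unfolding approximating_maps_def by blast
  have "(\<lambda>k. \<epsilon> (s k)) \<longlonglongrightarrow> 0"
    using LIMSEQ_subseq_LIMSEQ[OF D(2) assms(2)] by (simp add: o_def)
  moreover have "(\<lambda>k. D (s k) x (T (s k) x)) \<longlonglongrightarrow> 0" if "x \<in> mspace (fst X)" for x
    using LIMSEQ_subseq_LIMSEQ[OF D(3)[OF that] assms(2)] by (simp add: o_def)
  moreover have "\<forall>k. bridge X (Y (s k)) (\<epsilon> (s k)) (D (s k))" using D(1) by blast
  ultimately have "\<exists>\<epsilon> D. (\<forall>k. bridge X (Y (s k)) (\<epsilon> k) (D k)) \<and> \<epsilon> \<longlonglongrightarrow> 0 \<and>
       (\<forall>x\<in>mspace (fst X). (\<lambda>k. D k x (T (s k) x)) \<longlonglongrightarrow> 0)"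
    by (intro exI[of _ "\<lambda>k. \<epsilon> (s k)"] exI[of _ "\<lambda>k. D (s k)"] conjI ballI)
  moreover have "mm_space X \<and> (\<forall>k. mm_space (Y (s k))) \<and>
      (\<forall>k. \<forall>x\<in>mspace (fst X). T (s k) x \<in> mspace (fst (Y (s k))))"
    using assms(1) by (simp add: approximating_maps_def)
  ultimately show ?thesis
    by (simp add: approximating_maps_def)
qed

lemma approximating_maps_dist:
  assumes T: "approximating_maps X Y T" and x: "x \<in> mspace (fst X)" "x' \<in> mspace (fst X)"
  shows "(\<lambda>k. mdist (fst (Y k)) (T k x) (T k x')) \<longlonglongrightarrow> mdist (fst X) x x'"
proof -
  obtain \<epsilon> D where D: "\<And>k. bridge X (Y k) (\<epsilon> k) (D k)"
      "\<And>x. x \<in> mspace (fst X) \<Longrightarrow> (\<lambda>k. D k x (T k x)) \<longlonglongrightarrow> 0"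
    and Tm: "\<And>k x. x \<in> mspace (fst X) \<Longrightarrow> T k x \<in> mspace (fst (Y k))"
    using T unfolding approximating_maps_def by blast
  have lim: "(\<lambda>k. D k x (T k x) + D k x' (T k x')) \<longlonglongrightarrow> 0"
    using tendsto_add[OF D(2)[OF x(1)] D(2)[OF x(2)]] by simp
  have "(\<lambda>k. mdist (fst (Y k)) (T k x) (T k x') - mdist (fst X) x x') \<longlonglongrightarrow> 0"
  proof (rule Lim_null_comparison[OF always_eventually lim], rule allI)
    fix k
    note Tx = Tm[OF x(1), of k] and Tx' = Tm[OF x(2), of k]
    note bridgeD(5)[OF D(1) x(1) Tx Tx'] bridgeD(2)[OF D(1) x Tx']
      bridgeD(3)[OF D(1) x Tx'] bridgeD(4)[OF D(1) x(1) Tx' Tx]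
    then show "norm (mdist (fst (Y k)) (T k x) (T k x') - mdist (fst X) x x')
        \<le> D k x (T k x) + D k x' (T k x')"
      unfolding real_norm_def by linarith
  qed
  then show ?thesis by (simp add: LIM_zero_iff)
qed

text \<open>Each \<open>f k\<close> is carried to \<open>X\<close> by inf-convolution with the bridge. The result \<open>h k\<close> is measurable although
\<open>f k \<circ> T k\<close> may not be, it has the same pointwise limit, and the bridge compares its integral
with that of \<open>f k\<close>. Dominated convergence on the fixed space \<open>X\<close> does the rest.\<close>

lemma approximating_maps_integral:
  assumes T: "approximating_maps X Y T" and L: "0 \<le> L"
    and f: "\<And>k y. y \<in> mspace (fst (Y k)) \<Longrightarrow> 0 \<le> f k y \<and> f k y \<le> 1"
    and lip: "\<And>k y y'. y \<in> mspace (fst (Y k)) \<Longrightarrow> y' \<in> mspace (fst (Y k)) \<Longrightarrow>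
      \<bar>f k y - f k y'\<bar> \<le> L * mdist (fst (Y k)) y y'"
    and conv: "\<And>x. x \<in> mspace (fst X) \<Longrightarrow> (\<lambda>k. f k (T k x)) \<longlonglongrightarrow> g x"
  shows "(\<lambda>k. integral\<^sup>L (snd (Y k)) (f k)) \<longlonglongrightarrow> integral\<^sup>L (snd X) g"
proof -
  obtain \<epsilon> D where D: "\<And>k. bridge X (Y k) (\<epsilon> k) (D k)" and eps: "\<epsilon> \<longlonglongrightarrow> 0"
    and D0: "\<And>x. x \<in> mspace (fst X) \<Longrightarrow> (\<lambda>k. D k x (T k x)) \<longlonglongrightarrow> 0"
    and Tm: "\<And>k x. x \<in> mspace (fst X) \<Longrightarrow> T k x \<in> mspace (fst (Y k))"
    and X: "mm_space X" and Y: "\<And>k. mm_space (Y k)"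
    using T unfolding approximating_maps_def by blast
  interpret X: metric_measure_space "fst X" "snd X" using X by (simp add: mm_space_iff)
  have Yk: "metric_measure_space (fst (Y k)) (snd (Y k))" for k
    using Y by (simp add: mm_space_iff)
  define h where "h k x = min 1 (INF y\<in>mspace (fst (Y k)). f k y + L * D k x y)" for k x
  have bdd: "bdd_below ((\<lambda>y. f k y + L * D k x y) ` mspace (fst (Y k)))"
    if "x \<in> mspace (fst X)" for k x
    by (rule bdd_belowI[of _ 0])
      (use that f L bridge_nonneg[OF D] in \<open>auto intro!: add_nonneg_nonneg mult_nonneg_nonneg\<close>)
  have h_le: "h k x \<le> f k y + L * D k x y" if "x \<in> mspace (fst X)" "y \<in> mspace (fst (Y k))" for k x y
    unfolding h_def by (rule min.coboundedI2[OF cINF_lower[OF bdd[OF that(1)] that(2)]])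
  have h_ge: "c \<le> h k x" if "c \<le> 1" "\<And>y. y \<in> mspace (fst (Y k)) \<Longrightarrow> c \<le> f k y + L * D k x y" for c k x
    unfolding h_def
    by (rule min.boundedI[OF that(1) cINF_greatest[OF metric_measure_space.mspace_nonempty[OF Yk] that(2)]])
  have h1: "0 \<le> h k x \<and> h k x \<le> 1" if x: "x \<in> mspace (fst X)" for k x
  proof
    show "0 \<le> h k x"
      by (rule h_ge) (use x f L bridge_nonneg[OF D] in \<open>auto intro!: add_nonneg_nonneg mult_nonneg_nonneg\<close>)
  qed (simp add: h_def)
  have f_le: "f k y \<le> h k x + L * D k x y" if x: "x \<in> mspace (fst X)" and y: "y \<in> mspace (fst (Y k))" for k x y
  proof -
    have D': "0 \<le> L * D k x y" using bridge_nonneg[OF D x y] L by simp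
    have "f k y - L * D k x y \<le> h k x"
    proof (rule h_ge)
      show "f k y - L * D k x y \<le> 1" using f[OF y] D' by linarith
      fix y' assume y': "y' \<in> mspace (fst (Y k))"
      have "L * mdist (fst (Y k)) y y' \<le> L * (D k x y + D k x y')"
        by (rule mult_left_mono[OF bridgeD(5)[OF D x y y'] L])
      then show "f k y - L * D k x y \<le> f k y' + L * D k x y'"
        using lip[OF y y'] by (simp add: algebra_simps)
    qed
    then show ?thesis by simp
  qed
  have h_lip0: "h k x - L * mdist (fst X) x x' \<le> h k x'"
    if x: "x \<in> mspace (fst X)" "x' \<in> mspace (fst X)" for k x x'
  proof (rule h_ge)
    show "h k x - L * mdist (fst X) x x' \<le> 1"
      using h1[OF x(1), of k] mult_nonneg_nonneg[OF L mdist_nonneg[of "fst X" x x']] by linarith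
    fix y assume y: "y \<in> mspace (fst (Y k))"
    show "h k x - L * mdist (fst X) x x' \<le> f k y + L * D k x' y"
      using h_le[OF x(1) y] mult_left_mono[OF bridgeD(2)[OF D x y] L] by (simp add: algebra_simps)
  qed
  have h_lip: "\<bar>h k x - h k x'\<bar> \<le> L * mdist (fst X) x x'"
    if "x \<in> mspace (fst X)" "x' \<in> mspace (fst X)" for k x x'
    using h_lip0[OF that, of k] h_lip0[OF that(2,1), of k] mdist_commute[of "fst X" x' x]
    by (simp add: abs_le_iff)
  have hm: "h k \<in> borel_measurable (snd X)" for k
    by (rule X.lipschitz_measurable[OF h_lip])
  have fm: "f k \<in> borel_measurable (snd (Y k))" for k
    by (rule metric_measure_space.lipschitz_measurable[OF Yk lip])
  have h_conv: "(\<lambda>k. h k x) \<longlonglongrightarrow> g x" if x: "x \<in> mspace (fst X)" for x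
  proof -
    have "(\<lambda>k. h k x - f k (T k x)) \<longlonglongrightarrow> 0"
    proof (rule Lim_null_comparison[OF always_eventually], rule allI)
      show "(\<lambda>k. L * D k x (T k x)) \<longlonglongrightarrow> 0"
        using tendsto_mult_left[OF D0[OF x], of L] by simp
      show "norm (h k x - f k (T k x)) \<le> L * D k x (T k x)" for k
        using h_le[OF x Tm[OF x, of k]] f_le[OF x Tm[OF x, of k]] unfolding real_norm_def by linarith
    qed
    from tendsto_add[OF this conv[OF x]] show ?thesis by simp
  qed
  have "(\<lambda>k. integral\<^sup>L (snd X) (h k)) \<longlonglongrightarrow> integral\<^sup>L (snd X) g"
  proof (rule integral_dominated_convergence[where w = "\<lambda>_. 1"])
    show "g \<in> borel_measurable (snd X)"
      by (rule borel_measurable_LIMSEQ_real[OF _ hm]) (use h_conv in auto)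
  qed (use hm h_conv h1 in \<open>auto intro!: AE_I2\<close>)
  moreover have "(\<lambda>k. integral\<^sup>L (snd (Y k)) (f k) - integral\<^sup>L (snd X) (h k)) \<longlonglongrightarrow> 0"
  proof (rule Lim_null_comparison[OF always_eventually], rule allI)
    show "(\<lambda>k. (L + 1) * \<epsilon> k) \<longlonglongrightarrow> 0"
      using tendsto_mult_left[OF eps, of "L + 1"] by simp
    fix k
    have "integral\<^sup>L (snd (Y k)) (f k) \<le> integral\<^sup>L (snd X) (h k) + (L + 1) * \<epsilon> k"
      by (rule bridge_integral_le[OF X Y D fm f hm h1 L f_le])
    moreover have "integral\<^sup>L (snd X) (h k) \<le> integral\<^sup>L (snd (Y k)) (f k) + (L + 1) * \<epsilon> k"
      by (rule bridge_integral_le[OF Y X bridge_swap[OF D] hm h1 fm f L]) (assumption | rule h_le)+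
    ultimately show "norm (integral\<^sup>L (snd (Y k)) (f k) - integral\<^sup>L (snd X) (h k)) \<le> (L + 1) * \<epsilon> k"
      unfolding real_norm_def by linarith
  qed
  ultimately have "(\<lambda>k. (integral\<^sup>L (snd (Y k)) (f k) - integral\<^sup>L (snd X) (h k)) + integral\<^sup>L (snd X) (h k))
      \<longlonglongrightarrow> 0 + integral\<^sup>L (snd X) g"
    by (intro tendsto_add)
  then show ?thesis by simp
qed

text \<open>Let \<open>T k x\<close> be an almost nearest point of \<open>Y k\<close> to \<open>x\<close>. Since \<open>\<mu>\<close> has full support, every ball around \<open>x\<close>
has a mass that eventually exceeds \<open>\<epsilon> k\<close>, so \<open>Y k\<close> comes close to this ball.\<close>

lemma gpr_limit_approximating_maps:
  assumes X: "mm_space X" and Y: "\<And>k. mm_space (Y k)" and lim: "(\<lambda>k. gpr X (Y k)) \<longlonglongrightarrow> 0"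
  shows "\<exists>T. approximating_maps X Y T"
proof -
  interpret X: metric_measure_space "fst X" "snd X" using X by (simp add: mm_space_iff)
  have Yk: "metric_measure_space (fst (Y k)) (snd (Y k))" for k
    using Y by (simp add: mm_space_iff)
  define \<delta> where "\<delta> k = inverse (real (Suc k))" for k
  have \<delta>: "0 < \<delta> k" "\<delta> \<longlonglongrightarrow> 0" for k
    unfolding \<delta>_def using LIMSEQ_inverse_real_of_nat by auto
  define \<epsilon> where "\<epsilon> k = gpr X (Y k) + \<delta> k" for k
  have "\<exists>D. bridge X (Y k) (\<epsilon> k) D" for k
    by (rule gpr_less_imp_bridge[OF X Y]) (use \<delta> in \<open>simp add: \<epsilon>_def\<close>)
  then obtain D where D: "\<And>k. bridge X (Y k) (\<epsilon> k) (D k)" by metis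
  have eps: "\<epsilon> \<longlonglongrightarrow> 0"
    unfolding \<epsilon>_def using tendsto_add[OF lim \<delta>(2)] by simp
  \<comment> \<open>The infimum over \<open>Y k\<close> need not be attained, hence the slack \<open>\<delta> k\<close>.\<close>
  define I where "I k x = (INF y\<in>mspace (fst (Y k)). D k x y)" for k x
  have "\<exists>y\<in>mspace (fst (Y k)). D k x y < I k x + \<delta> k" for k x
    using cInf_lessD[of "D k x ` mspace (fst (Y k))" "I k x + \<delta> k"] \<delta>(1)[of k]
      metric_measure_space.mspace_nonempty[OF Yk[of k]] by (auto simp: I_def)
  then obtain T where T: "\<And>k x. T k x \<in> mspace (fst (Y k)) \<and> D k x (T k x) < I k x + \<delta> k" by metis
  have "(\<lambda>k. D k x (T k x)) \<longlonglongrightarrow> 0" if x: "x \<in> mspace (fst X)" for x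
  proof (rule LIMSEQ_I)
    fix e :: real assume e: "0 < e"
    define c where "c = measure (snd X) (mball_of (fst X) x (e / 4))"
    have c: "0 < c" unfolding c_def using x e by (intro X.measure_ball_pos) auto
    have ev: "\<forall>\<^sub>F k in sequentially. \<epsilon> k < min c (e / 4) \<and> \<delta> k < e / 4"
      by (intro eventually_conj order_tendstoD(2)[OF eps] order_tendstoD(2)[OF \<delta>(2)]) (use c e in auto)
    have "norm (D k x (T k x) - 0) < e" if k: "\<epsilon> k < min c (e / 4) \<and> \<delta> k < e / 4" for k
    proof -
      have "c \<le> measure (snd (Y k)) {y \<in> mspace (fst (Y k)). \<exists>x'\<in>mball_of (fst X) x (e / 4). D k x' y < \<epsilon> k} + \<epsilon> k"
        unfolding c_def by (rule bridgeD(6)[OF D openin_borel_metric[OF openin_mball_of]])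
      then have "measure (snd (Y k)) {y \<in> mspace (fst (Y k)). \<exists>x'\<in>mball_of (fst X) x (e / 4). D k x' y < \<epsilon> k} \<noteq> 0"
        using k by auto
      then have "{y \<in> mspace (fst (Y k)). \<exists>x'\<in>mball_of (fst X) x (e / 4). D k x' y < \<epsilon> k} \<noteq> {}"
        by (metis measure_empty)
      then obtain x' y where xy: "y \<in> mspace (fst (Y k))" "x' \<in> mspace (fst X)"
          "mdist (fst X) x x' < e / 4" "D k x' y < \<epsilon> k"
        by auto
      have "I k x \<le> D k x y"
        unfolding I_def by (rule cINF_lower[OF _ xy(1)])
          (rule bdd_belowI[of _ 0], use bridge_nonneg[OF D x] in auto)
      moreover have "D k x y \<le> mdist (fst X) x x' + D k x' y"
        by (rule bridgeD(2)[OF D x xy(2,1)])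
      moreover have "0 \<le> D k x (T k x)"
        using bridge_nonneg[OF D x] T by blast
      ultimately show ?thesis
        using xy k T[of k x] by simp
    qed
    then show "\<exists>no. \<forall>k\<ge>no. norm (D k x (T k x) - 0) < e"
      using ev unfolding eventually_sequentially by blast
  qed
  then have "approximating_maps X Y T"
    unfolding approximating_maps_def using X Y T D eps
    by (intro conjI exI[of _ \<epsilon>] exI[of _ D] allI ballI) simp_all
  then show ?thesis by blast
qed


section \<open>Cancellation and decompositions\<close>

context metric_measure_space
begin

lemma mdist_measurable:
  assumes "x \<in> mspace m"
  shows "mdist m x \<in> borel_measurable M"
proof (rule lipschitz_measurable[where L = 1])
  fix y z assume "y \<in> mspace m" "z \<in> mspace m"
  then show "\<bar>mdist m x y - mdist m x z\<bar> \<le> 1 * mdist m y z"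
    using mdist_triangle[of x m y z] mdist_triangle[of x m z y] mdist_commute[of m y z] assms
    by (simp add: abs_le_iff)
qed

lemma integral_ball_le:
  fixes f :: "'a \<Rightarrow> real"
  assumes f: "f \<in> borel_measurable M" "\<And>y. y \<in> mspace m \<Longrightarrow> 0 \<le> f y \<and> f y \<le> 1"
    and c: "\<And>y. y \<in> mball_of m w r \<Longrightarrow> c \<le> f y"
  shows "c * measure M (mball_of m w r) \<le> expectation f"
proof -
  define B where "B = mball_of m w r"
  have B: "B \<in> sets M" unfolding B_def by (rule sets_open[OF openin_mball_of])
  have cB: "c \<le> f y" if "y \<in> B" for y using c that unfolding B_def .
  have "B \<inter> space M = B" using sets.sets_into_space[OF B] by blast
  then have "c * measure M (mball_of m w r) = expectation (\<lambda>y. c * indicator B y)"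
    by (simp add: B_def)
  also have "\<dots> \<le> expectation f"
    by (rule integral_mono)
      (use B f cB in \<open>auto simp: integrable_unit integrable_indicator_iff less_top[symmetric] indicator_def\<close>)
  finally show ?thesis .
qed

end

text \<open>A quantitative way of having more than one point that is uniform in the base point. It is phrased by
integrals of Lipschitz functions and hence stable under the limits considered here; the truncation at
one makes the integrals finite.\<close>

definition spread :: "real \<Rightarrow> 'a metric_measure \<Rightarrow> bool" where
  "spread c X \<longleftrightarrow> (\<forall>x\<in>mspace (fst X). c \<le> (\<integral>y. min 1 (mdist (fst X) x y) \<partial>snd X))"

text \<open>Every point is at distance at least \<open>d u v / 2\<close> from \<open>u\<close> or from \<open>v\<close>, and thus at distance at least
\<open>d u v / 4\<close> from a whole ball around that point, which has positive mass.\<close>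

lemma spread_exists:
  assumes X: "mm_space X" and uv: "u \<in> mspace (fst X)" "v \<in> mspace (fst X)" "u \<noteq> v"
  shows "\<exists>c>0. spread c X"
proof -
  interpret X: metric_measure_space "fst X" "snd X" using X by (simp add: mm_space_iff)
  let ?m = "fst X" and ?M = "snd X"
  define d where "d = mdist ?m u v"
  have d: "0 < d"
    using uv mdist_zero[of u ?m v] mdist_nonneg[of ?m u v] unfolding d_def by linarith
  define b where "b = min (measure ?M (mball_of ?m u (d / 4))) (measure ?M (mball_of ?m v (d / 4)))"
  have b: "0 < b" using X.measure_ball_pos uv d by (simp add: b_def)
  have "min 1 (d / 4) * b \<le> (\<integral>y. min 1 (mdist ?m x y) \<partial>?M)" if x: "x \<in> mspace ?m" for x
  proof -
    have "d \<le> mdist ?m x u + mdist ?m x v"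
      using mdist_triangle[of u ?m x v] uv x by (simp add: d_def mdist_commute)
    then have "d / 2 \<le> mdist ?m x u \<or> d / 2 \<le> mdist ?m x v" by linarith
    then obtain w where w: "w \<in> {u, v}" "d / 2 \<le> mdist ?m x w" by blast
    then have "w \<in> mspace ?m" "b \<le> measure ?M (mball_of ?m w (d / 4))"
      using uv by (auto simp: b_def)
    have "min 1 (d / 4) * b \<le> min 1 (d / 4) * measure ?M (mball_of ?m w (d / 4))"
      by (rule mult_left_mono) (use d \<open>b \<le> _\<close> in auto)
    also have "\<dots> \<le> (\<integral>y. min 1 (mdist ?m x y) \<partial>?M)"
    proof (rule X.integral_ball_le)
      have [measurable]: "mdist ?m x \<in> borel_measurable ?M" by (rule X.mdist_measurable[OF x])
      show "(\<lambda>y. min 1 (mdist ?m x y)) \<in> borel_measurable ?M" by measurable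
      fix y assume "y \<in> mball_of ?m w (d / 4)"
      then have y: "y \<in> mspace ?m" "mdist ?m w y < d / 4" by auto
      have "mdist ?m x w \<le> mdist ?m x y + mdist ?m y w"
        by (rule mdist_triangle[OF x y(1) \<open>w \<in> mspace ?m\<close>])
      then have "d / 4 \<le> mdist ?m x y"
        using y(2) w(2) mdist_commute[of ?m y w] by linarith
      then show "min 1 (d / 4) \<le> min 1 (mdist ?m x y)" by auto
    qed auto
    finally show ?thesis .
  qed
  moreover have "0 < min 1 (d / 4) * b" using d b by simp
  ultimately show ?thesis unfolding spread_def by blast
qed

lemma integral_mm_sum_product:
  fixes f :: "'a \<Rightarrow> real" and g :: "'b \<Rightarrow> real"
  assumes Y: "mm_space Y" and Z: "mm_space Z"
    and f: "f \<in> borel_measurable (snd Y)" "\<And>y. y \<in> mspace (fst Y) \<Longrightarrow> 0 \<le> f y \<and> f y \<le> 1"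
    and g: "g \<in> borel_measurable (snd Z)" "\<And>z. z \<in> mspace (fst Z) \<Longrightarrow> 0 \<le> g z \<and> g z \<le> 1"
  shows "(\<integral>u. f (fst u) * g (snd u) \<partial>snd (mm_sum Y Z)) = integral\<^sup>L (snd Y) f * integral\<^sup>L (snd Z) g"
proof -
  interpret Y: metric_measure_space "fst Y" "snd Y" using Y by (simp add: mm_space_iff)
  interpret Z: metric_measure_space "fst Z" "snd Z" using Z by (simp add: mm_space_iff)
  interpret P: pair_prob_space "snd Y" "snd Z" ..
  note [measurable] = f(1) g(1)
  have "integrable (snd Y \<Otimes>\<^sub>M snd Z) (\<lambda>u. f (fst u) * g (snd u))"
    by (rule P.integrable_const_bound[where B = 1])
      (use f(2) g(2) in \<open>auto simp: space_pair_measure mult_le_one abs_mult intro!: AE_I2\<close>)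
  from P.integral_fst'[OF this] show ?thesis
    by (simp add: mm_sum_def)
qed

lemma exp_neg_le:
  fixes t :: real
  assumes "0 \<le> t"
  shows "exp (- t) \<le> 1 - min 1 t / 2"
proof -
  have "exp (- t) \<le> 1 / (1 + t)"
    using exp_ge_add_one_self[of t] assms by (simp add: exp_minus divide_simps)
  also have "\<dots> \<le> 1 - min 1 t / 2"
    using assms mult_nonneg_nonneg[of t "1 - t"] by (auto simp: min_def field_simps)
  finally show ?thesis .
qed

text \<open>The integral \<open>p y\<close> of \<open>exp (- d y \<cdot>)\<close> is invariant under isomorphism and multiplicative under sums
because the exponential turns the \<open>\<ell>\<^sub>1\<close> metric into a product. Hence an isomorphism would give
\<open>p y \<le> (1 - c / 2) * sup p\<close> for all \<open>y\<close>, although \<open>sup p\<close> is positive.\<close>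

lemma mm_sum_not_iso_summand:
  assumes Y: "mm_space Y" and Z: "mm_space Z" and c: "0 < c" "spread c Z"
  shows "\<not> mm_iso Y (mm_sum Y Z)"
proof
  interpret Y: metric_measure_space "fst Y" "snd Y" using Y by (simp add: mm_space_iff)
  interpret Z: metric_measure_space "fst Z" "snd Z" using Z by (simp add: mm_space_iff)
  interpret S: metric_measure_space "fst (mm_sum Y Z)" "snd (mm_sum Y Z)"
    using mm_space_sum[OF Y Z] by (simp add: mm_space_iff)
  assume "mm_iso Y (mm_sum Y Z)"
  then obtain f where f: "isometric_embedding (fst Y) (fst (mm_sum Y Z)) f"
      "distr (snd Y) (borel_metric (fst (mm_sum Y Z))) f = snd (mm_sum Y Z)"
    unfolding mm_iso_def by (auto split: prod.splits)
  define p where "p y = (\<integral>y'. exp (- mdist (fst Y) y y') \<partial>snd Y)" for y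
  define q where "q z = (\<integral>z'. exp (- mdist (fst Z) z z') \<partial>snd Z)" for z
  have mY [measurable]: "mdist (fst Y) y \<in> borel_measurable (snd Y)" if "y \<in> mspace (fst Y)" for y
    by (rule Y.mdist_measurable[OF that])
  have mZ [measurable]: "mdist (fst Z) z \<in> borel_measurable (snd Z)" if "z \<in> mspace (fst Z)" for z
    by (rule Z.mdist_measurable[OF that])
  have pos: "0 < p y" if y: "y \<in> mspace (fst Y)" for y
  proof -
    have "exp (- 1) * measure (snd Y) (mball_of (fst Y) y 1) \<le> p y"
      unfolding p_def
      by (rule Y.integral_ball_le) (use y in auto)
    then show ?thesis
      using mult_pos_pos[OF exp_gt_zero[of "- 1 :: real"] Y.measure_ball_pos[OF y zero_less_one]] by linarith
  qed
  have p1: "p y \<le> 1" if y: "y \<in> mspace (fst Y)" for y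
    unfolding p_def by (rule Y.integral_le_const) (use y in \<open>auto intro!: Y.integrable_unit\<close>)
  have q: "q z \<le> 1 - c / 2" if z: "z \<in> mspace (fst Z)" for z
  proof -
    have int: "integrable (snd Z) (\<lambda>z'. min 1 (mdist (fst Z) z z'))"
      by (rule Z.integrable_unit) (use z in auto)
    have "q z \<le> (\<integral>z'. 1 - min 1 (mdist (fst Z) z z') / 2 \<partial>snd Z)"
      unfolding q_def
      by (rule integral_mono) (use z int in \<open>auto intro!: Z.integrable_unit exp_neg_le\<close>)
    also have "\<dots> = 1 - (\<integral>z'. min 1 (mdist (fst Z) z z') \<partial>snd Z) / 2"
      using int by (simp add: Z.prob_space[unfolded Z.space_M])
    also have "\<dots> \<le> 1 - c / 2"
      using c(2) z by (auto simp: spread_def)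
    finally show ?thesis .
  qed
  have fm: "f y \<in> mspace (fst Y) \<times> mspace (fst Z)" if "y \<in> mspace (fst Y)" for y
    using f(1) that unfolding isometric_embedding_def mm_sum_def by auto
  have peq: "p y = p (fst (f y)) * q (snd (f y))" if y: "y \<in> mspace (fst Y)" for y
  proof -
    obtain a b where ab: "f y = (a, b)" "a \<in> mspace (fst Y)" "b \<in> mspace (fst Z)"
      using fm[OF y] by (cases "f y") auto
    have "p y = (\<integral>y'. exp (- mdist (fst (mm_sum Y Z)) (f y) (f y')) \<partial>snd Y)"
      unfolding p_def
      by (rule Bochner_Integration.integral_cong)
        (use f(1) y in \<open>auto simp: isometric_embedding_def\<close>)
    also have "\<dots> = (\<integral>u. exp (- mdist (fst (mm_sum Y Z)) (f y) u) \<partial>distr (snd Y) (borel_metric (fst (mm_sum Y Z))) f)"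
    proof (rule integral_distr[symmetric])
      show "f \<in> measurable (snd Y) (borel_metric (fst (mm_sum Y Z)))"
        by (rule measurable_mm[OF Y.sets_M f(1)])
      have "mdist (fst (mm_sum Y Z)) (f y) \<in> borel_measurable (snd (mm_sum Y Z))"
        by (rule S.mdist_measurable) (use fm[OF y] in \<open>simp add: mm_sum_def\<close>)
      then have "(\<lambda>u. exp (- mdist (fst (mm_sum Y Z)) (f y) u)) \<in> borel_measurable (snd (mm_sum Y Z))"
        by measurable
      then show "(\<lambda>u. exp (- mdist (fst (mm_sum Y Z)) (f y) u)) \<in> borel_measurable (borel_metric (fst (mm_sum Y Z)))"
        using measurable_cong_sets[OF S.sets_M refl] by blast
    qed
    also have "\<dots> = (\<integral>u. exp (- mdist (fst Y) a (fst u)) * exp (- mdist (fst Z) b (snd u)) \<partial>snd (mm_sum Y Z))"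
      unfolding f(2) by (simp add: mm_sum_def ab(1) flip: exp_add)
    also have "\<dots> = p a * q b"
      unfolding p_def q_def
      by (rule integral_mm_sum_product[OF Y Z]) (use ab in auto)
    finally show ?thesis using ab(1) by simp
  qed
  \<comment> \<open>The supremum need not be attained, but an inequality for all values suffices.\<close>
  define s where "s = (SUP y\<in>mspace (fst Y). p y)"
  have bdd: "bdd_above (p ` mspace (fst Y))"
    by (rule bdd_aboveI[of _ 1]) (use p1 in auto)
  have ps: "p y \<le> s" if "y \<in> mspace (fst Y)" for y
    unfolding s_def by (rule cSUP_upper[OF that bdd])
  obtain y0 where y0: "y0 \<in> mspace (fst Y)" using Y.mspace_nonempty by blast
  have s0: "0 < s" using pos[OF y0] ps[OF y0] by linarith
  have "s \<le> s * (1 - c / 2)"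
    unfolding s_def
  proof (rule cSUP_least[OF Y.mspace_nonempty])
    fix y assume y: "y \<in> mspace (fst Y)"
    have fs: "fst (f y) \<in> mspace (fst Y)" "snd (f y) \<in> mspace (fst Z)" using fm[OF y] by auto
    have "p y \<le> p (fst (f y)) * (1 - c / 2)"
      unfolding peq[OF y] using q[OF fs(2)] pos[OF fs(1)] by simp
    also have "\<dots> \<le> s * (1 - c / 2)"
    proof (rule mult_right_mono[OF ps[OF fs(1)]])
      have "0 < q (snd (f y))"
        using pos[OF y] pos[OF fs(1)] unfolding peq[OF y] by (simp add: zero_less_mult_iff)
      then show "0 \<le> 1 - c / 2" using q[OF fs(2)] by linarith
    qed
    finally show "p y \<le> (SUP y\<in>mspace (fst Y). p y) * (1 - c / 2)"
      unfolding s_def .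
  qed
  then have "s * c \<le> 0" by (simp add: algebra_simps)
  then show False using mult_pos_pos[OF s0 c(1)] by linarith
qed

lemma mm_class_eq_unit_iff:
  assumes X: "mm_space X"
  shows "mm_class X = mm_unit \<longleftrightarrow> (\<exists>x. mspace (fst X) = {x})"
proof
  interpret X: metric_measure_space "fst X" "snd X" using X by (simp add: mm_space_iff)
  assume "mm_class X = mm_unit"
  then have "mm_iso X (one_point_space ())"
    unfolding mm_unit_def by (simp add: mm_class_eq_iff X mm_space_one_point)
  then obtain f where f: "isometric_embedding (fst X) (one_point_metric ()) f"
    unfolding mm_iso_def one_point_space_def by (auto split: prod.splits)
  obtain x where x: "x \<in> mspace (fst X)" using X.mspace_nonempty by blast
  have "y = x" if "y \<in> mspace (fst X)" for y
    using isometric_embedding_inj[OF f] x that by (auto simp: inj_on_def)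
  then show "\<exists>x. mspace (fst X) = {x}" using x by blast
qed (use mm_class_eq_unit[OF X] in blast)

lemma mm_class_not_unit_iff:
  assumes X: "mm_space X"
  shows "mm_class X \<noteq> mm_unit \<longleftrightarrow> (\<exists>x\<in>mspace (fst X). \<exists>y\<in>mspace (fst X). x \<noteq> y)"
proof -
  obtain a where a: "a \<in> mspace (fst X)"
    using X metric_measure_space.mspace_nonempty by (auto simp: mm_space_iff)
  have "(\<exists>x. mspace (fst X) = {x}) \<longleftrightarrow> (\<forall>x\<in>mspace (fst X). \<forall>y\<in>mspace (fst X). x = y)"
  proof
    assume "\<forall>x\<in>mspace (fst X). \<forall>y\<in>mspace (fst X). x = y"
    then have "mspace (fst X) = {a}" using a by blast
    then show "\<exists>x. mspace (fst X) = {x}" ..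
  qed auto
  then show ?thesis
    unfolding mm_class_eq_unit_iff[OF X] by simp
qed

lemma mm_plus_unit_right: "\<Y> \<boxplus> mm_unit = \<Y>"
proof -
  let ?Y = "rep_mm \<Y>" and ?E = "one_point_space ()"
  have Y: "mm_space ?Y" and E: "mm_space ?E" by (rule mm_space_rep mm_space_one_point)+
  interpret Y: metric_measure_space "fst ?Y" "snd ?Y" using Y by (simp add: mm_space_iff)
  interpret E: metric_measure_space "fst ?E" "snd ?E" using E by (simp add: mm_space_iff)
  have "mm_iso (mm_sum ?Y ?E) ?Y"
    unfolding mm_iso_def mm_sum_def case_prod_unfold fst_conv snd_conv
  proof (intro exI conjI)
    show "isometric_embedding (sum_metric (fst ?Y) (fst ?E)) (fst ?Y) fst"
      by (auto simp: isometric_embedding_def one_point_space_def)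
    show "fst ` mspace (sum_metric (fst ?Y) (fst ?E)) = mspace (fst ?Y)"
      by (simp add: one_point_space_def)
    have "distr (snd ?Y \<Otimes>\<^sub>M snd ?E) (borel_metric (fst ?Y)) fst = distr (snd ?Y \<Otimes>\<^sub>M snd ?E) (snd ?Y) fst"
      by (rule distr_cong) (simp_all add: Y.sets_M)
    then show "distr (snd ?Y \<Otimes>\<^sub>M snd ?E) (borel_metric (fst ?Y)) fst = snd ?Y"
      by (simp add: E.distr_pair_fst)
  qed
  then have "mm_class (mm_sum ?Y ?E) = mm_class ?Y"
    by (rule mm_class_eq_iff[OF mm_space_sum[OF Y E] Y, THEN iffD2])
  then show ?thesis
    by (simp add: mm_class_sum[OF Y E] flip: mm_unit_def)
qed

lemma mm_plus_neq_summand: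
  assumes "\<Z> \<noteq> mm_unit"
  shows "\<Y> \<boxplus> \<Z> \<noteq> \<Y>"
proof
  assume eq: "\<Y> \<boxplus> \<Z> = \<Y>"
  let ?Y = "rep_mm \<Y>" and ?Z = "rep_mm \<Z>"
  have Y: "mm_space ?Y" and Z: "mm_space ?Z" by (rule mm_space_rep)+
  have "mm_class ?Z \<noteq> mm_unit" using assms by simp
  then obtain c where c: "0 < c" "spread c ?Z"
    using spread_exists[OF Z] unfolding mm_class_not_unit_iff[OF Z] by blast
  have "mm_class ?Y = mm_class (mm_sum ?Y ?Z)"
    using eq by (simp add: mm_plus_def)
  then have "mm_iso ?Y (mm_sum ?Y ?Z)"
    by (rule mm_class_eq_iff[OF Y mm_space_sum[OF Y Z], THEN iffD1])
  with mm_sum_not_iso_summand[OF Y Z c] show False by contradiction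
qed

lemma not_mm_irreducible_iff:
  "\<not> mm_irreducible \<X> \<longleftrightarrow>
     \<X> = mm_unit \<or> (\<exists>\<Y> \<Z>. \<Y> \<noteq> mm_unit \<and> \<Z> \<noteq> mm_unit \<and> \<X> = \<Y> \<boxplus> \<Z>)"
  unfolding mm_irreducible_def mm_le_def
  using mm_plus_unit_right mm_plus_neq_summand by metis


section \<open>Splittings of a metric and their limits\<close>

text \<open>Truncated distance functions to finitely many balls. They are Lipschitz for \<open>a\<close>, are determined by
finitely many distances (so they can be transported along maps and pass to limits), and
approximate the indicators of all \<open>a\<close>-open sets. The first argument of \<open>a\<close> has its own type to
allow the centres to be transported separately.\<close>

fun bump :: "('a \<Rightarrow> 'b \<Rightarrow> real) \<Rightarrow> real \<Rightarrow> ('a \<times> real) list \<Rightarrow> 'b \<Rightarrow> real" where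
  "bump a n [] x = 0"
| "bump a n ((p, s) # ps) x = max (max 0 (min 1 (n * (s - a p x)))) (bump a n ps x)"

lemma bump_range: "0 \<le> bump a n ps x \<and> bump a n ps x \<le> 1"
  by (induction a n ps x rule: bump.induct) auto

lemma bump_lipschitz:
  assumes "\<And>p. p \<in> fst ` set ps \<Longrightarrow> \<bar>a p x - a p y\<bar> \<le> t" and "0 \<le> n" "0 \<le> t"
  shows "\<bar>bump a n ps x - bump a n ps y\<bar> \<le> n * t"
  using assms(1)
proof (induction ps)
  case (Cons q ps)
  obtain p s where q: "q = (p, s)" by (cases q)
  have "n * \<bar>a p x - a p y\<bar> \<le> n * t"
    using Cons.prems[of p] assms(2) by (intro mult_left_mono) (auto simp: q)
  then have "\<bar>n * (s - a p x) - n * (s - a p y)\<bar> \<le> n * t"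
    using assms(2) by (simp add: abs_mult abs_minus_commute flip: right_diff_distrib)
  moreover have "\<bar>bump a n ps x - bump a n ps y\<bar> \<le> n * t"
    using Cons by auto
  ultimately show ?case
    unfolding q by (simp add: max_def min_def abs_le_iff)
qed (use assms in simp)

lemma bump_map: "bump a n (map (apfst T) ps) x = bump (\<lambda>p. a (T p)) n ps x"
  by (induction ps) auto

lemma bump_comp: "bump a n ps (f x) = bump (\<lambda>p x. a p (f x)) n ps x"
  by (induction ps) auto

lemma bump_tendsto:
  assumes "\<And>p. p \<in> fst ` set ps \<Longrightarrow> (\<lambda>k. a k p (x k)) \<longlonglongrightarrow> b p y"
  shows "(\<lambda>k. bump (a k) n ps (x k)) \<longlonglongrightarrow> bump b n ps y"
  using assms
proof (induction ps)
  case (Cons q ps)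
  obtain p s where q: "q = (p, s)" by (cases q)
  have "(\<lambda>k. a k p (x k)) \<longlonglongrightarrow> b p y"
    using Cons.prems[of p] by (simp add: q)
  moreover have "(\<lambda>k. bump (a k) n ps (x k)) \<longlonglongrightarrow> bump b n ps y"
    using Cons by auto
  ultimately show ?case
    unfolding q bump.simps by (intro tendsto_intros)
qed simp

lemma bump_ge: "(p, s) \<in> set ps \<Longrightarrow> min 1 (n * (s - a p x)) \<le> bump a n ps x"
  by (induction ps) (auto simp: le_max_iff_disj)

lemma bump_eq_0:
  assumes "0 \<le> n" "\<And>p s. (p, s) \<in> set ps \<Longrightarrow> s \<le> a p x"
  shows "bump a n ps x = 0"
  using assms(2)
proof (induction ps)
  case (Cons q ps)
  obtain p s where q: "q = (p, s)" by (cases q)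
  have "n * (s - a p x) \<le> 0"
    using Cons.prems[of p s] assms(1) by (intro mult_nonneg_nonpos) (auto simp: q)
  then show ?case using Cons by (auto simp: q)
qed simp

definition pseudometric_on :: "'a set \<Rightarrow> ('a \<Rightarrow> 'a \<Rightarrow> real) \<Rightarrow> bool" where
  "pseudometric_on S a \<longleftrightarrow> (\<forall>x\<in>S. a x x = 0) \<and> (\<forall>x\<in>S. \<forall>y\<in>S. 0 \<le> a x y \<and> a x y = a y x) \<and>
     (\<forall>x\<in>S. \<forall>y\<in>S. \<forall>z\<in>S. a x z \<le> a x y + a y z)"

lemma pseudometric_onD:
  assumes "pseudometric_on S a"
  shows "x \<in> S \<Longrightarrow> a x x = 0"
    and "x \<in> S \<Longrightarrow> y \<in> S \<Longrightarrow> 0 \<le> a x y"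
    and "x \<in> S \<Longrightarrow> y \<in> S \<Longrightarrow> a x y = a y x"
    and "x \<in> S \<Longrightarrow> y \<in> S \<Longrightarrow> z \<in> S \<Longrightarrow> a x z \<le> a x y + a y z"
  using assms unfolding pseudometric_on_def by blast+

lemma pseudometric_on_mdist: "pseudometric_on (mspace m) (mdist m)"
  unfolding pseudometric_on_def by (auto intro: mdist_triangle mdist_commute)

lemma pseudometric_on_vimage:
  assumes "pseudometric_on R a" "\<And>x. x \<in> S \<Longrightarrow> f x \<in> R"
  shows "pseudometric_on S (\<lambda>x y. a (f x) (f y))"
  using assms unfolding pseudometric_on_def by blast

lemma pseudometric_on_abs_diff:
  assumes a: "pseudometric_on S a" and S: "x \<in> S" "y \<in> S" "x' \<in> S" "y' \<in> S"
  shows "\<bar>a x y - a x' y'\<bar> \<le> a x x' + a y y'"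
  using pseudometric_onD(4)[OF a S(1,3,2)] pseudometric_onD(4)[OF a S(3,4,2)]
    pseudometric_onD(4)[OF a S(3,1,4)] pseudometric_onD(4)[OF a S(1,2,4)]
    pseudometric_onD(3)[OF a S(1,3)] pseudometric_onD(3)[OF a S(2,4)] by linarith

lemma pseudometric_on_limit:
  assumes a: "\<And>k. pseudometric_on (S k) (a k)" and T: "\<And>k x. x \<in> R \<Longrightarrow> T k x \<in> S k"
    and lim: "\<And>x y. x \<in> R \<Longrightarrow> y \<in> R \<Longrightarrow> (\<lambda>k. a k (T k x) (T k y)) \<longlonglongrightarrow> b x y"
  shows "pseudometric_on R b"
  unfolding pseudometric_on_def
proof (intro conjI ballI)
  fix x y z assume R: "x \<in> R" "y \<in> R" "z \<in> R"
  have "(\<lambda>k. a k (T k x) (T k x)) = (\<lambda>k. 0)"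
    using pseudometric_onD(1)[OF a T[OF R(1)]] by simp
  then show "b x x = 0"
    using lim[OF R(1) R(1)] LIMSEQ_unique[OF _ tendsto_const] by auto
  show "0 \<le> b x y"
    by (rule LIMSEQ_le_const[OF lim[OF R(1,2)]]) (use pseudometric_onD(2)[OF a T T] R in auto)
  have "(\<lambda>k. a k (T k x) (T k y)) = (\<lambda>k. a k (T k y) (T k x))"
    using pseudometric_onD(3)[OF a T[OF R(1)] T[OF R(2)]] by (rule ext)
  then show "b x y = b y x"
    using lim[OF R(1,2)] lim[OF R(2,1)] LIMSEQ_unique by auto
  show "b x z \<le> b x y + b y z"
    by (rule LIMSEQ_le[OF lim[OF R(1,3)] tendsto_add[OF lim[OF R(1,2)] lim[OF R(2,3)]]])
      (use pseudometric_onD(4)[OF a T T T] R in blast)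
qed

lemma convergent_if_eventually_close:
  fixes u :: "nat \<Rightarrow> real"
  assumes "\<And>e. 0 < e \<Longrightarrow> \<exists>l. \<forall>\<^sub>F k in sequentially. \<bar>u k - l\<bar> < e"
  shows "convergent u"
proof (rule Cauchy_convergent, rule metric_CauchyI)
  fix e :: real assume "0 < e"
  then obtain l N where l: "\<And>k. k \<ge> N \<Longrightarrow> \<bar>u k - l\<bar> < e / 2"
    using assms[of "e / 2"] unfolding eventually_sequentially by auto
  have "dist (u m) (u n) < e" if "m \<ge> N" "n \<ge> N" for m n
    using l[OF that(1)] l[OF that(2)] unfolding dist_real_def by linarith
  then show "\<exists>M. \<forall>m\<ge>M. \<forall>n\<ge>M. dist (u m) (u n) < e" by blast
qed

text \<open>An Arzela--Ascoli argument. On a countable dense set of pairs a diagonal subsequence converges, as the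
values are bounded for each pair, and the pulled back pseudometrics are asymptotically Lipschitz with
respect to the metric of \<open>X\<close>, which extends the convergence to all pairs.\<close>

lemma approximating_maps_pseudometric_limit:
  assumes T: "approximating_maps X Y T"
    and a: "\<And>k. pseudometric_on (mspace (fst (Y k))) (a k)"
    and le: "\<And>k y y'. y \<in> mspace (fst (Y k)) \<Longrightarrow> y' \<in> mspace (fst (Y k)) \<Longrightarrow> a k y y' \<le> mdist (fst (Y k)) y y'"
  shows "\<exists>s b. strict_mono s \<and> (\<forall>x\<in>mspace (fst X). \<forall>y\<in>mspace (fst X).
    (\<lambda>k. a (s k) (T (s k) x) (T (s k) y)) \<longlonglongrightarrow> b x y)"
proof -
  have X: "mm_space X" and Tm: "\<And>k x. x \<in> mspace (fst X) \<Longrightarrow> T k x \<in> mspace (fst (Y k))"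
    using T unfolding approximating_maps_def by blast+
  interpret X: metric_measure_space "fst X" "snd X" using X by (simp add: mm_space_iff)
  let ?d = "\<lambda>k x y. mdist (fst (Y k)) (T k x) (T k y)"
  let ?u = "\<lambda>k x y. a k (T k x) (T k y)"
  obtain C where C: "countable C" "C \<subseteq> mspace (fst X)"
      "\<And>x r. x \<in> mspace (fst X) \<Longrightarrow> r > 0 \<Longrightarrow> \<exists>y\<in>C. mdist (fst X) x y < r"
    using X.separable unfolding separable_space_mtopology_of_iff by blast
  have "\<exists>K>0. \<forall>k. ?d k x y \<le> K" if "x \<in> C" "y \<in> C" for x y
  proof -
    have "(\<lambda>k. ?d k x y) \<longlonglongrightarrow> mdist (fst X) x y"
      by (rule approximating_maps_dist[OF T]) (use that C(2) in auto)
    then have "Bseq (\<lambda>k. ?d k x y)" using convergentI convergent_imp_Bseq by blast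
    then obtain K where "K > 0" "\<And>k. norm (?d k x y) \<le> K" by (rule BseqE) blast
    then show ?thesis by (intro exI[of _ K]) auto
  qed
  then obtain K where K: "\<And>x y. x \<in> C \<Longrightarrow> y \<in> C \<Longrightarrow> 0 < K x y \<and> (\<forall>k. ?d k x y \<le> K x y)"
    by metis
  have u: "0 \<le> ?u k x y" "?u k x y \<le> ?d k x y" if "x \<in> mspace (fst X)" "y \<in> mspace (fst X)" for k x y
    using pseudometric_onD(2)[OF a Tm[OF that(1)] Tm[OF that(2)]] le[OF Tm[OF that(1)] Tm[OF that(2)]]
    by auto
  obtain s where s: "strict_mono (s :: nat \<Rightarrow> nat)"
    and conv: "\<And>z. z \<in> C \<times> C \<Longrightarrow> \<exists>l. (\<lambda>k. ?u (s k) (fst z) (snd z) / K (fst z) (snd z)) \<longlonglongrightarrow> l"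
  proof (rule function_convergent_subsequence[of "C \<times> C" "\<lambda>k z. ?u k (fst z) (snd z) / K (fst z) (snd z)" 1])
    show "countable (C \<times> C)" using C(1) by simp
    fix k z assume z: "z \<in> C \<times> C"
    then have zm: "fst z \<in> mspace (fst X)" "snd z \<in> mspace (fst X)" and Kz: "0 < K (fst z) (snd z)"
      "?d k (fst z) (snd z) \<le> K (fst z) (snd z)"
      using C(2) K[of "fst z" "snd z"] by (auto simp: mem_Times_iff)
    have "0 \<le> ?u k (fst z) (snd z)" "?u k (fst z) (snd z) \<le> K (fst z) (snd z)"
      using u[OF zm] order_trans[OF u(2)[OF zm] Kz(2)] by auto
    with Kz(1) show "norm (?u k (fst z) (snd z) / K (fst z) (snd z)) \<le> 1" by simp
  qed blast
  have convC: "convergent (\<lambda>k. ?u (s k) c c')" if c: "c \<in> C" "c' \<in> C" for c c'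
  proof -
    obtain l where "(\<lambda>k. ?u (s k) c c' / K c c') \<longlonglongrightarrow> l"
      using conv[of "(c, c')"] c by auto
    then have "(\<lambda>k. ?u (s k) c c' / K c c' * K c c') \<longlonglongrightarrow> l * K c c'"
      by (intro tendsto_mult_right)
    then show ?thesis using K[OF c] by (auto simp: convergent_def)
  qed
  have T': "approximating_maps X (\<lambda>k. Y (s k)) (\<lambda>k. T (s k))"
    by (rule approximating_maps_subseq[OF T s])
  have "convergent (\<lambda>k. ?u (s k) x y)" if xy: "x \<in> mspace (fst X)" "y \<in> mspace (fst X)" for x y
  proof (rule convergent_if_eventually_close)
    fix e :: real assume e: "0 < e"
    then obtain c c' where c: "c \<in> C" "mdist (fst X) x c < e / 4" "c' \<in> C" "mdist (fst X) y c' < e / 4"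
      using C(3)[of x "e / 4"] C(3)[of y "e / 4"] xy by auto
    have cm: "c \<in> mspace (fst X)" "c' \<in> mspace (fst X)" using c C(2) by auto
    obtain l where l: "(\<lambda>k. ?u (s k) c c') \<longlonglongrightarrow> l"
      using convC[OF c(1,3)] by (auto simp: convergent_def)
    have "\<forall>\<^sub>F k in sequentially. \<bar>?u (s k) c c' - l\<bar> < e / 2"
      using tendstoD[OF l, of "e / 2"] e by (simp add: dist_real_def)
    moreover have "\<forall>\<^sub>F k in sequentially. ?d (s k) x c < e / 4"
      by (rule order_tendstoD(2)[OF approximating_maps_dist[OF T' xy(1) cm(1)] c(2)])
    moreover have "\<forall>\<^sub>F k in sequentially. ?d (s k) y c' < e / 4"
      by (rule order_tendstoD(2)[OF approximating_maps_dist[OF T' xy(2) cm(2)] c(4)])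
    ultimately have "\<forall>\<^sub>F k in sequentially. \<bar>?u (s k) x y - l\<bar> < e"
    proof eventually_elim
      case (elim k)
      have "\<bar>?u (s k) x y - ?u (s k) c c'\<bar> \<le> ?u (s k) x c + ?u (s k) y c'"
        by (rule pseudometric_on_abs_diff[OF a]) (use xy cm Tm in auto)
      also have "\<dots> < e / 2"
        using u(2)[OF xy(1) cm(1), of "s k"] u(2)[OF xy(2) cm(2), of "s k"] elim by linarith
      finally show ?case using elim(1) by linarith
    qed
    then show "\<exists>l. \<forall>\<^sub>F k in sequentially. \<bar>?u (s k) x y - l\<bar> < e" ..
  qed
  then have "\<forall>x\<in>mspace (fst X). \<forall>y\<in>mspace (fst X).
      (\<lambda>k. ?u (s k) x y) \<longlonglongrightarrow> lim (\<lambda>k. ?u (s k) x y)"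
    by (simp add: convergent_LIMSEQ_iff)
  then show ?thesis using s by (intro exI[of _ s] exI[of _ "\<lambda>x y. lim (\<lambda>k. ?u (s k) x y)"]) simp
qed

text \<open>On a metric measure space the last condition says that the \<open>\<sigma>\<close>-algebras generated by the \<open>a\<close>-open and by the \<open>b\<close>-open sets are
independent. It is stated with test functions, rather than with events, to be closed under limits.\<close>

definition splitting :: "'a metric_measure \<Rightarrow> ('a \<Rightarrow> 'a \<Rightarrow> real) \<Rightarrow> ('a \<Rightarrow> 'a \<Rightarrow> real) \<Rightarrow> bool" where
  "splitting X a b \<longleftrightarrow> pseudometric_on (mspace (fst X)) a \<and> pseudometric_on (mspace (fst X)) b \<and>
     (\<forall>x\<in>mspace (fst X). \<forall>y\<in>mspace (fst X). mdist (fst X) x y = a x y + b x y) \<and>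
     (\<forall>n ps qs. 0 \<le> n \<longrightarrow> fst ` set ps \<subseteq> mspace (fst X) \<longrightarrow> fst ` set qs \<subseteq> mspace (fst X) \<longrightarrow>
        (\<integral>x. bump a n ps x * bump b n qs x \<partial>snd X) =
        integral\<^sup>L (snd X) (bump a n ps) * integral\<^sup>L (snd X) (bump b n qs))"

lemma splittingD:
  assumes "splitting X a b"
  shows "pseudometric_on (mspace (fst X)) a" "pseudometric_on (mspace (fst X)) b"
    and "\<And>x y. x \<in> mspace (fst X) \<Longrightarrow> y \<in> mspace (fst X) \<Longrightarrow> mdist (fst X) x y = a x y + b x y"
    and "\<And>n ps qs. 0 \<le> n \<Longrightarrow> fst ` set ps \<subseteq> mspace (fst X) \<Longrightarrow> fst ` set qs \<subseteq> mspace (fst X) \<Longrightarrow>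
        (\<integral>x. bump a n ps x * bump b n qs x \<partial>snd X) =
        integral\<^sup>L (snd X) (bump a n ps) * integral\<^sup>L (snd X) (bump b n qs)"
  using assms unfolding splitting_def by blast+

lemma splitting_commute: "splitting X a b \<Longrightarrow> splitting X b a"
  unfolding splitting_def by (simp add: mult.commute add.commute)

lemma splitting_le:
  assumes "splitting X a b" "x \<in> mspace (fst X)" "y \<in> mspace (fst X)"
  shows "a x y \<le> mdist (fst X) x y"
  using splittingD(3)[OF assms] pseudometric_onD(2)[OF splittingD(2)[OF assms(1)] assms(2,3)] by simp

lemma splitting_bump_lipschitz:
  assumes s: "splitting X a b" and n: "0 \<le> n" and ps: "fst ` set ps \<subseteq> mspace (fst X)"
    and xy: "x \<in> mspace (fst X)" "y \<in> mspace (fst X)"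
  shows "\<bar>bump a n ps x - bump a n ps y\<bar> \<le> n * mdist (fst X) x y"
proof (rule bump_lipschitz[OF _ n mdist_nonneg])
  fix p assume "p \<in> fst ` set ps"
  then have p: "p \<in> mspace (fst X)" using ps by blast
  show "\<bar>a p x - a p y\<bar> \<le> mdist (fst X) x y"
    using pseudometric_on_abs_diff[OF splittingD(1)[OF s] p xy(1) p xy(2)]
      pseudometric_onD(1)[OF splittingD(1)[OF s] p] splitting_le[OF s xy] by linarith
qed

text \<open>A test function for the first pseudometric depends on the first coordinate only, and likewise for the
second, so the integral of the product factorises by Fubini.\<close>

lemma mm_sum_splitting:
  assumes Y: "mm_space Y" and Z: "mm_space Z"
  shows "splitting (mm_sum Y Z) (\<lambda>u v. mdist (fst Y) (fst u) (fst v)) (\<lambda>u v. mdist (fst Z) (snd u) (snd v))"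
proof -
  interpret Y: metric_measure_space "fst Y" "snd Y" using Y by (simp add: mm_space_iff)
  interpret Z: metric_measure_space "fst Z" "snd Z" using Z by (simp add: mm_space_iff)
  have bm: "bump (mdist (fst W)) n rs \<in> borel_measurable (snd W)"
    if W: "metric_measure_space (fst W) (snd W)" and n: "0 \<le> n" and rs: "fst ` set rs \<subseteq> mspace (fst W)"
    for W :: "'c metric_measure" and n rs
  proof (rule metric_measure_space.lipschitz_measurable[OF W])
    fix x y assume xy: "x \<in> mspace (fst W)" "y \<in> mspace (fst W)"
    show "\<bar>bump (mdist (fst W)) n rs x - bump (mdist (fst W)) n rs y\<bar> \<le> n * mdist (fst W) x y"
    proof (rule bump_lipschitz[OF _ n mdist_nonneg])
      fix p assume "p \<in> fst ` set rs"
      then have "p \<in> mspace (fst W)" using rs by blast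
      then show "\<bar>mdist (fst W) p x - mdist (fst W) p y\<bar> \<le> mdist (fst W) x y"
        using mdist_triangle[of p "fst W" x y] mdist_triangle[of p "fst W" y x] xy
          mdist_commute[of "fst W" x y] by (simp add: abs_le_iff)
    qed
  qed
  show ?thesis
    unfolding splitting_def
  proof (intro conjI ballI allI impI)
    fix n :: real and ps qs :: "(('a \<times> 'b) \<times> real) list"
    assume n: "0 \<le> n" and ps: "fst ` set ps \<subseteq> mspace (fst (mm_sum Y Z))"
      and qs: "fst ` set qs \<subseteq> mspace (fst (mm_sum Y Z))"
    define f where "f = bump (mdist (fst Y)) n (map (apfst fst) ps)"
    define g where "g = bump (mdist (fst Z)) n (map (apfst snd) qs)"
    have fg: "bump (\<lambda>u v. mdist (fst Y) (fst u) (fst v)) n ps u = f (fst u)"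
      "bump (\<lambda>u v. mdist (fst Z) (snd u) (snd v)) n qs u = g (snd u)" for u
      by (simp_all add: f_def g_def bump_map bump_comp)
    have fm: "f \<in> borel_measurable (snd Y)"
      unfolding f_def
      by (rule bm[OF Y.metric_measure_space_axioms n]) (use ps in \<open>force simp: mm_sum_def\<close>)
    have gm: "g \<in> borel_measurable (snd Z)"
      unfolding g_def
      by (rule bm[OF Z.metric_measure_space_axioms n]) (use qs in \<open>force simp: mm_sum_def\<close>)
    have r: "0 \<le> f y \<and> f y \<le> 1" "0 \<le> g z \<and> g z \<le> 1" for y z
      unfolding f_def g_def by (rule bump_range)+
    have "(\<integral>u. f (fst u) \<partial>snd (mm_sum Y Z)) = integral\<^sup>L (snd Y) f"
      using integral_mm_sum_product[OF Y Z fm r(1), of "\<lambda>_. 1"] by (simp add: Z.prob_space[unfolded Z.space_M])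
    moreover have "(\<integral>u. g (snd u) \<partial>snd (mm_sum Y Z)) = integral\<^sup>L (snd Z) g"
      using integral_mm_sum_product[OF Y Z _ _ gm r(2), of "\<lambda>_. 1"] by (simp add: Y.prob_space[unfolded Y.space_M])
    ultimately show "(\<integral>u. bump (\<lambda>u v. mdist (fst Y) (fst u) (fst v)) n ps u *
          bump (\<lambda>u v. mdist (fst Z) (snd u) (snd v)) n qs u \<partial>snd (mm_sum Y Z)) =
        integral\<^sup>L (snd (mm_sum Y Z)) (bump (\<lambda>u v. mdist (fst Y) (fst u) (fst v)) n ps) *
        integral\<^sup>L (snd (mm_sum Y Z)) (bump (\<lambda>u v. mdist (fst Z) (snd u) (snd v)) n qs)"
      unfolding fg using integral_mm_sum_product[OF Y Z fm r(1) gm r(2)] by simp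
  next
    show "pseudometric_on (mspace (fst (mm_sum Y Z))) (\<lambda>u v. mdist (fst Y) (fst u) (fst v))"
      by (rule pseudometric_on_vimage[OF pseudometric_on_mdist]) (auto simp: mm_sum_def)
    show "pseudometric_on (mspace (fst (mm_sum Y Z))) (\<lambda>u v. mdist (fst Z) (snd u) (snd v))"
      by (rule pseudometric_on_vimage[OF pseudometric_on_mdist]) (auto simp: mm_sum_def)
  qed (simp add: mm_sum_def)
qed

text \<open>Test functions on \<open>X\<close> with centres \<open>p\<close> are pointwise limits of the test functions on \<open>Y k\<close> with centres
\<open>T k p\<close>. These and their products are equi-Lipschitz with values in the unit interval, so all three
integrals in the independence condition converge.\<close>

lemma splitting_limit:
  assumes T: "approximating_maps X Y T" and split: "\<And>k. splitting (Y k) (a k) (b k)"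
    and a: "\<And>x y. x \<in> mspace (fst X) \<Longrightarrow> y \<in> mspace (fst X) \<Longrightarrow> (\<lambda>k. a k (T k x) (T k y)) \<longlonglongrightarrow> a' x y"
    and b: "\<And>x y. x \<in> mspace (fst X) \<Longrightarrow> y \<in> mspace (fst X) \<Longrightarrow> (\<lambda>k. b k (T k x) (T k y)) \<longlonglongrightarrow> b' x y"
  shows "splitting X a' b'"
proof -
  have Tm: "\<And>k x. x \<in> mspace (fst X) \<Longrightarrow> T k x \<in> mspace (fst (Y k))"
    using T unfolding approximating_maps_def by blast
  show ?thesis
    unfolding splitting_def
  proof (intro conjI ballI allI impI)
    show "pseudometric_on (mspace (fst X)) a'"
      by (rule pseudometric_on_limit[OF splittingD(1)[OF split] Tm a])
    show "pseudometric_on (mspace (fst X)) b'"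
      by (rule pseudometric_on_limit[OF splittingD(2)[OF split] Tm b])
  next
    fix x y assume xy: "x \<in> mspace (fst X)" "y \<in> mspace (fst X)"
    have "(\<lambda>k. mdist (fst (Y k)) (T k x) (T k y)) = (\<lambda>k. a k (T k x) (T k y) + b k (T k x) (T k y))"
      using splittingD(3)[OF split Tm[OF xy(1)] Tm[OF xy(2)]] by (rule ext)
    then show "mdist (fst X) x y = a' x y + b' x y"
      using LIMSEQ_unique[OF approximating_maps_dist[OF T xy]] tendsto_add[OF a[OF xy] b[OF xy]] by simp
  next
    fix n :: real and ps qs :: "('a \<times> real) list"
    assume n: "0 \<le> n" and ps: "fst ` set ps \<subseteq> mspace (fst X)" and qs: "fst ` set qs \<subseteq> mspace (fst X)"
    define f where "f k = bump (a k) n (map (apfst (T k)) ps)" for k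
    define g where "g k = bump (b k) n (map (apfst (T k)) qs)" for k
    have ps': "fst ` set (map (apfst (T k)) ps) \<subseteq> mspace (fst (Y k))"
      and qs': "fst ` set (map (apfst (T k)) qs) \<subseteq> mspace (fst (Y k))" for k
      using ps qs Tm by force+
    have fr: "0 \<le> f k y \<and> f k y \<le> 1" and gr: "0 \<le> g k y \<and> g k y \<le> 1" for k y
      unfolding f_def g_def by (rule bump_range)+
    have flip: "\<bar>f k y - f k y'\<bar> \<le> n * mdist (fst (Y k)) y y'"
      and glip: "\<bar>g k y - g k y'\<bar> \<le> n * mdist (fst (Y k)) y y'"
      if "y \<in> mspace (fst (Y k))" "y' \<in> mspace (fst (Y k))" for k y y'
      unfolding f_def g_def
      using splitting_bump_lipschitz[OF split n ps' that]
        splitting_bump_lipschitz[OF splitting_commute[OF split] n qs' that] by auto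
    have fl: "(\<lambda>k. f k (T k x)) \<longlonglongrightarrow> bump a' n ps x" and gl: "(\<lambda>k. g k (T k x)) \<longlonglongrightarrow> bump b' n qs x"
      if x: "x \<in> mspace (fst X)" for x
      unfolding f_def g_def bump_map bump_comp
      using ps qs x by (auto intro!: bump_tendsto a b)
    have "(\<lambda>k. \<integral>y. f k y * g k y \<partial>snd (Y k)) \<longlonglongrightarrow> (\<integral>x. bump a' n ps x * bump b' n qs x \<partial>snd X)"
    proof (rule approximating_maps_integral[OF T, where L = "2 * n"])
      show "0 \<le> f k y * g k y \<and> f k y * g k y \<le> 1" for k y
        using fr[of k y] gr[of k y] by (simp add: mult_le_one)
      show "(\<lambda>k. f k (T k x) * g k (T k x)) \<longlonglongrightarrow> bump a' n ps x * bump b' n qs x" if "x \<in> mspace (fst X)" for x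
        by (rule tendsto_mult[OF fl[OF that] gl[OF that]])
      fix k y y' assume y: "y \<in> mspace (fst (Y k))" "y' \<in> mspace (fst (Y k))"
      have "\<bar>f k y * g k y - f k y' * g k y'\<bar> = \<bar>(f k y - f k y') * g k y + f k y' * (g k y - g k y')\<bar>"
        by (simp add: algebra_simps)
      also have "\<dots> \<le> \<bar>f k y - f k y'\<bar> * g k y + f k y' * \<bar>g k y - g k y'\<bar>"
        using abs_triangle_ineq[of "(f k y - f k y') * g k y" "f k y' * (g k y - g k y')"]
          fr[of k y'] gr[of k y] by (simp add: abs_mult)
      also have "\<dots> \<le> \<bar>f k y - f k y'\<bar> + \<bar>g k y - g k y'\<bar>"
        using fr[of k y'] gr[of k y]
        by (intro add_mono mult_left_le mult_left_le_one_le) auto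
      also have "\<dots> \<le> 2 * n * mdist (fst (Y k)) y y'"
        using flip[OF y] glip[OF y] by simp
      finally show "\<bar>f k y * g k y - f k y' * g k y'\<bar> \<le> 2 * n * mdist (fst (Y k)) y y'" .
    qed (use n in simp)
    moreover have "(\<lambda>k. integral\<^sup>L (snd (Y k)) (f k) * integral\<^sup>L (snd (Y k)) (g k))
        \<longlonglongrightarrow> integral\<^sup>L (snd X) (bump a' n ps) * integral\<^sup>L (snd X) (bump b' n qs)"
      by (intro tendsto_mult approximating_maps_integral[OF T n] fr gr flip glip fl gl)
    moreover have "(\<lambda>k. \<integral>y. f k y * g k y \<partial>snd (Y k)) = (\<lambda>k. integral\<^sup>L (snd (Y k)) (f k) * integral\<^sup>L (snd (Y k)) (g k))"
      unfolding f_def g_def by (rule ext) (rule splittingD(4)[OF split n ps' qs'])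
    ultimately show "(\<integral>x. bump a' n ps x * bump b' n qs x \<partial>snd X) =
        integral\<^sup>L (snd X) (bump a' n ps) * integral\<^sup>L (snd X) (bump b' n qs)"
      by (auto intro: LIMSEQ_unique)
  qed
qed


section \<open>From a splitting back to a sum\<close>

text \<open>The situation is symmetric in \<open>a\<close> and \<open>b\<close>. Facts are proved for \<open>a\<close> and transferred to \<open>b\<close> by
interpreting the locale with the roles exchanged.\<close>

locale split_space = metric_measure_space m M for m :: "'a metric" and M :: "'a measure" +
  fixes a b :: "'a \<Rightarrow> 'a \<Rightarrow> real"
  assumes split: "splitting (m, M) a b"
begin

lemma split_space_commute: "split_space m M b a"
  by unfold_locales (rule splitting_commute[OF split])

lemmas psm_a = splittingD(1)[OF split, unfolded fst_conv]
lemmas psm_b = splittingD(2)[OF split, unfolded fst_conv]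
lemmas mdist_eq = splittingD(3)[OF split, unfolded fst_conv]

lemma a_le: "x \<in> mspace m \<Longrightarrow> y \<in> mspace m \<Longrightarrow> a x y \<le> mdist m x y"
  using splitting_le[OF split] by simp

lemma bump_a_measurable:
  assumes "0 \<le> n" "fst ` set ps \<subseteq> mspace m"
  shows "bump a n ps \<in> borel_measurable M"
  by (rule lipschitz_measurable[OF splitting_bump_lipschitz[OF split, unfolded fst_conv, OF assms]])

lemma integral_bump_a_pos:
  assumes x: "x \<in> mspace m" and e: "0 < e"
  shows "0 < expectation (bump a 1 [(x, e)])"
proof -
  have "min 1 (e / 2) * measure M (mball_of m x (e / 2)) \<le> expectation (bump a 1 [(x, e)])"
  proof (rule integral_ball_le)
    show "bump a 1 [(x, e)] \<in> borel_measurable M"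
      by (rule bump_a_measurable) (use x in auto)
    fix y assume "y \<in> mball_of m x (e / 2)"
    then have y: "y \<in> mspace m" "mdist m x y < e / 2" by auto
    then have "e / 2 \<le> e - a x y" using a_le[OF x y(1)] by linarith
    then show "min 1 (e / 2) \<le> bump a 1 [(x, e)] y"
      by (auto simp: max_def min_def)
  qed (rule bump_range)
  moreover have "0 < min 1 (e / 2) * measure M (mball_of m x (e / 2))"
    using measure_ball_pos[OF x, of "e / 2"] e by simp
  ultimately show ?thesis by linarith
qed

text \<open>By independence the mass of \<open>{z. a x z < e \<and> b y z < e}\<close> is, up to the use of test functions, a product
of two positive numbers.\<close>

lemma ex_close_in_both:
  assumes x: "x \<in> mspace m" and y: "y \<in> mspace m" and e: "0 < e"
  shows "\<exists>z\<in>mspace m. a x z < e \<and> b y z < e"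
proof (rule ccontr)
  interpret S: split_space m M b a by (rule split_space_commute)
  assume *: "\<not> ?thesis"
  have "bump a 1 [(x, e)] z * bump b 1 [(y, e)] z = 0" if "z \<in> mspace m" for z
  proof -
    have "e \<le> a x z \<or> e \<le> b y z" using * that by fastforce
    then show ?thesis
      using bump_eq_0[of 1 "[(x, e)]" a z] bump_eq_0[of 1 "[(y, e)]" b z] by auto
  qed
  then have "(\<integral>z. bump a 1 [(x, e)] z * bump b 1 [(y, e)] z \<partial>M) = (\<integral>z. 0 \<partial>M)"
    by (intro Bochner_Integration.integral_cong) auto
  then have "expectation (bump a 1 [(x, e)]) * expectation (bump b 1 [(y, e)]) = 0"
    using splittingD(4)[OF split, of 1 "[(x, e)]" "[(y, e)]"] x y by simp
  then show False
    using integral_bump_a_pos[OF x e] S.integral_bump_a_pos[OF y e] by auto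
qed

text \<open>Choose \<open>z k\<close> that is \<open>\<delta> k\<close>-close to \<open>x\<close> for \<open>a\<close> and to \<open>y\<close> for \<open>b\<close>. As \<open>d = a + b\<close>, these points form
a Cauchy sequence, and its limit is as required.\<close>

lemma ex_meet:
  assumes x: "x \<in> mspace m" and y: "y \<in> mspace m"
  shows "\<exists>z\<in>mspace m. a x z = 0 \<and> b y z = 0"
proof -
  interpret S: split_space m M b a by (rule split_space_commute)
  define \<delta> where "\<delta> k = inverse (real (Suc k))" for k
  have \<delta>: "0 < \<delta> k" "\<delta> \<longlonglongrightarrow> 0" for k
    unfolding \<delta>_def using LIMSEQ_inverse_real_of_nat by auto
  have "\<forall>k. \<exists>z. z \<in> mspace m \<and> a x z < \<delta> k \<and> b y z < \<delta> k"
    using ex_close_in_both[OF x y \<delta>(1)] by blast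
  then obtain z where z: "\<And>k. z k \<in> mspace m" "\<And>k. a x (z k) < \<delta> k" "\<And>k. b y (z k) < \<delta> k"
    by metis
  have d: "mdist m (z j) (z k) < 2 * \<delta> j + 2 * \<delta> k" for j k
  proof -
    have "a (z j) (z k) \<le> a x (z j) + a x (z k)" "b (z j) (z k) \<le> b y (z j) + b y (z k)"
      using pseudometric_onD(4)[OF psm_a z(1) x z(1)] pseudometric_onD(3)[OF psm_a x z(1)]
        pseudometric_onD(4)[OF psm_b z(1) y z(1)] pseudometric_onD(3)[OF psm_b y z(1)] by simp_all
    then show ?thesis
      using mdist_eq[OF z(1) z(1), of j k] z(2)[of j] z(2)[of k] z(3)[of j] z(3)[of k] by linarith
  qed
  have "\<exists>N. \<forall>n n'. N \<le> n \<longrightarrow> N \<le> n' \<longrightarrow> mdist m (z n) (z n') < e" if e: "0 < e" for e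
  proof -
    obtain N where N: "\<And>n. N \<le> n \<Longrightarrow> \<delta> n < e / 4"
      using order_tendstoD(2)[OF \<delta>(2), of "e / 4"] e unfolding eventually_sequentially by auto
    have "mdist m (z n) (z n') < e" if "N \<le> n" "N \<le> n'" for n n'
      using d[of n n'] N[OF that(1)] N[OF that(2)] by linarith
    then show ?thesis by blast
  qed
  moreover have "range z \<subseteq> mspace m" using z(1) by blast
  ultimately obtain w where w: "w \<in> mspace m" "\<And>e. 0 < e \<Longrightarrow> \<exists>N. \<forall>n\<ge>N. mdist m (z n) w < e"
    using mcomplete_of_iff[THEN iffD1, OF complete, THEN spec, of z] by blast
  have "a x w \<le> e \<and> b y w \<le> e" if e: "0 < e" for e
  proof -
    obtain N where N: "\<And>n. N \<le> n \<Longrightarrow> \<delta> n < e / 2"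
      using order_tendstoD(2)[OF \<delta>(2), of "e / 2"] e unfolding eventually_sequentially by auto
    obtain K where K: "\<And>n. K \<le> n \<Longrightarrow> mdist m (z n) w < e / 2"
      using w(2)[of "e / 2"] e by auto
    let ?n = "max N K"
    have "a x w \<le> a x (z ?n) + a (z ?n) w" "b y w \<le> b y (z ?n) + b (z ?n) w"
      by (rule pseudometric_onD(4)[OF psm_a x z(1) w(1)] pseudometric_onD(4)[OF psm_b y z(1) w(1)])+
    then show ?thesis
      using N[of ?n] K[of ?n] z(2)[of ?n] z(3)[of ?n] a_le[OF z(1) w(1), of ?n] S.a_le[OF z(1) w(1), of ?n]
      by (simp del: max.bounded_iff)
  qed
  then have "a x w \<le> 0" "b y w \<le> 0" by (blast intro: field_le_epsilon[of _ 0, simplified])+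
  then have "a x w = 0 \<and> b y w = 0"
    using pseudometric_onD(2)[OF psm_a x w(1)] pseudometric_onD(2)[OF psm_b y w(1)] by auto
  then show ?thesis using w(1) by blast
qed

lemma meet_unique:
  assumes m: "x \<in> mspace m" "y \<in> mspace m" "z \<in> mspace m" "w \<in> mspace m"
    and z: "a x z = 0" "b y z = 0" and w: "a x w = 0" "b y w = 0"
  shows "z = w"
proof -
  have "a z w \<le> 0" "b z w \<le> 0"
    using pseudometric_onD(4)[OF psm_a m(3,1,4)] pseudometric_onD(3)[OF psm_a m(3,1)]
      pseudometric_onD(4)[OF psm_b m(3,2,4)] pseudometric_onD(3)[OF psm_b m(3,2)] z w by simp_all
  then have "mdist m z w \<le> 0" using mdist_eq[OF m(3,4)] by simp
  then show ?thesis using m(3,4) by (metis antisym mdist_nonneg mdist_zero)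
qed

text \<open>In a sum this is the copy of the first factor through the second coordinate of \<open>x0\<close>, and \<open>fibre_proj\<close>
is the first projection. The chosen point exists by \<open>ex_meet\<close> and is unique by \<open>meet_unique\<close>.\<close>

definition fibre :: "'a \<Rightarrow> 'a metric" where
  "fibre x0 = submetric m {z \<in> mspace m. b x0 z = 0}"

definition fibre_proj :: "'a \<Rightarrow> 'a \<Rightarrow> 'a" where
  "fibre_proj x0 x = (SOME z. z \<in> mspace m \<and> a x z = 0 \<and> b x0 z = 0)"

definition fibre_space :: "'a \<Rightarrow> 'a metric_measure" where
  "fibre_space x0 = (fibre x0, distr M (borel_metric (fibre x0)) (fibre_proj x0))"

lemma mspace_fibre [simp]: "mspace (fibre x0) = {z \<in> mspace m. b x0 z = 0}"
  and mdist_fibre [simp]: "mdist (fibre x0) = mdist m"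
  unfolding fibre_def by auto

context
  fixes x0
  assumes x0: "x0 \<in> mspace m"
begin

lemma fibre_proj:
  assumes "x \<in> mspace m"
  shows "fibre_proj x0 x \<in> mspace m" "a x (fibre_proj x0 x) = 0" "b x0 (fibre_proj x0 x) = 0"
proof -
  have "\<exists>z. z \<in> mspace m \<and> a x z = 0 \<and> b x0 z = 0"
    using ex_meet[OF assms x0] by blast
  from someI_ex[OF this]
  show "fibre_proj x0 x \<in> mspace m" "a x (fibre_proj x0 x) = 0" "b x0 (fibre_proj x0 x) = 0"
    unfolding fibre_proj_def by blast+
qed

lemma a_fibre_proj:
  assumes "x \<in> mspace m" "y \<in> mspace m"
  shows "a (fibre_proj x0 x) (fibre_proj x0 y) = a x y"
  using pseudometric_on_abs_diff[OF psm_a assms fibre_proj(1)[OF assms(1)] fibre_proj(1)[OF assms(2)]]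
    fibre_proj(2)[OF assms(1)] fibre_proj(2)[OF assms(2)] by simp

lemma mdist_eq_a_on_fibre:
  assumes "x \<in> mspace (fibre x0)" "y \<in> mspace (fibre x0)"
  shows "mdist m x y = a x y"
proof -
  have "b x y \<le> b x0 x + b x0 y"
    using pseudometric_onD(4)[OF psm_b, of x x0 y] pseudometric_onD(3)[OF psm_b, of x x0] assms x0 by simp
  then have "b x y = 0"
    using pseudometric_onD(2)[OF psm_b, of x y] assms by simp
  then show ?thesis using mdist_eq[of x y] assms by simp
qed

lemma mdist_fibre_proj:
  assumes "x \<in> mspace m" "y \<in> mspace m"
  shows "mdist m (fibre_proj x0 x) (fibre_proj x0 y) = a x y"
  using mdist_eq_a_on_fibre[of "fibre_proj x0 x" "fibre_proj x0 y"] fibre_proj[OF assms(1)]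
    fibre_proj[OF assms(2)] a_fibre_proj[OF assms] by simp

lemma fibre_proj_eq:
  assumes "x \<in> mspace m" "z \<in> mspace (fibre x0)" "a x z = 0"
  shows "fibre_proj x0 x = z"
  by (rule meet_unique[OF assms(1) x0]) (use assms fibre_proj[OF assms(1)] in auto)

lemma fibre_proj_vimage_open:
  assumes U: "openin (mtopology_of (fibre x0)) U"
    and x: "x \<in> mspace m" "fibre_proj x0 x \<in> U"
  shows "\<exists>r>0. \<forall>y\<in>mspace m. a x y < r \<longrightarrow> fibre_proj x0 y \<in> U"
proof -
  obtain r where r: "r > 0" "mball_of (fibre x0) (fibre_proj x0 x) r \<subseteq> U"
    using U x unfolding openin_mtopology_of by blast
  have "fibre_proj x0 y \<in> U" if "y \<in> mspace m" "a x y < r" for y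
    using r(2) that mdist_fibre_proj[OF x(1) that(1)] fibre_proj[OF x(1)] fibre_proj[OF that(1)]
    by (auto simp: subset_iff)
  then show ?thesis using r(1) by blast
qed

lemma openin_fibre_proj_vimage:
  assumes U: "openin (mtopology_of (fibre x0)) U"
  shows "openin (mtopology_of m) (fibre_proj x0 -` U \<inter> mspace m)"
  unfolding openin_mtopology_of
proof (intro conjI ballI)
  fix x assume x: "x \<in> fibre_proj x0 -` U \<inter> mspace m"
  then obtain r where r: "r > 0" "\<And>y. y \<in> mspace m \<Longrightarrow> a x y < r \<Longrightarrow> fibre_proj x0 y \<in> U"
    using fibre_proj_vimage_open[OF U] by blast
  have "mball_of m x r \<subseteq> fibre_proj x0 -` U \<inter> mspace m"
  proof
    fix y assume "y \<in> mball_of m x r"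
    then have "x \<in> mspace m" "y \<in> mspace m" "mdist m x y < r" by auto
    then show "y \<in> fibre_proj x0 -` U \<inter> mspace m"
      using a_le[of x y] r(2)[of y] by simp
  qed
  with r(1) show "\<exists>r>0. mball_of m x r \<subseteq> fibre_proj x0 -` U \<inter> mspace m" by blast
qed auto

lemma fibre_proj_measurable: "fibre_proj x0 \<in> measurable M (borel_metric (fibre x0))"
  by (rule measurable_borel_metric)
    (use fibre_proj in \<open>auto intro!: sets_open[OF openin_fibre_proj_vimage]\<close>)

lemma fibre_complete: "mcomplete_of (fibre x0)"
proof (rule mcomplete_of_iff[THEN iffD2], intro allI impI)
  fix \<sigma> :: "nat \<Rightarrow> 'a"
  assume \<sigma>: "range \<sigma> \<subseteq> mspace (fibre x0)"
    and C: "\<forall>\<epsilon>>0. \<exists>N. \<forall>n n'. N \<le> n \<longrightarrow> N \<le> n' \<longrightarrow> mdist (fibre x0) (\<sigma> n) (\<sigma> n') < \<epsilon>"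
  interpret S: split_space m M b a by (rule split_space_commute)
  have \<sigma>': "\<sigma> n \<in> mspace m" "b x0 (\<sigma> n) = 0" for n using \<sigma> by auto
  then have "range \<sigma> \<subseteq> mspace m" by blast
  then obtain z where z: "z \<in> mspace m" "\<forall>\<epsilon>>0. \<exists>N. \<forall>n\<ge>N. mdist m (\<sigma> n) z < \<epsilon>"
    using mcomplete_of_iff[THEN iffD1, OF complete, THEN spec, of \<sigma>] C by auto
  have "b x0 z \<le> 0"
  proof (rule field_le_epsilon)
    fix e :: real assume "0 < e"
    then obtain n where "mdist m (\<sigma> n) z < e" using z(2) by blast
    then show "b x0 z \<le> 0 + e"
      using pseudometric_onD(4)[OF psm_b x0 \<sigma>'(1) z(1), of n] \<sigma>'(2)[of n] S.a_le[OF \<sigma>'(1) z(1), of n]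
      by linarith
  qed
  then have "b x0 z = 0" using pseudometric_onD(2)[OF psm_b x0 z(1)] by simp
  then show "\<exists>x\<in>mspace (fibre x0). \<forall>\<epsilon>>0. \<exists>N. \<forall>n\<ge>N. mdist (fibre x0) (\<sigma> n) x < \<epsilon>"
    using z by (intro bexI[of _ z]) auto
qed

lemma fibre_separable: "separable_space (mtopology_of (fibre x0))"
proof -
  obtain C where C: "countable C" "C \<subseteq> mspace m" "\<And>x r. x \<in> mspace m \<Longrightarrow> r > 0 \<Longrightarrow> \<exists>y\<in>C. mdist m x y < r"
    using separable unfolding separable_space_mtopology_of_iff by blast
  have "\<exists>y\<in>fibre_proj x0 ` C. mdist (fibre x0) z y < r" if z: "z \<in> mspace (fibre x0)" and r: "r > 0" for z r
  proof -
    obtain c where c: "c \<in> C" "mdist m z c < r" using C(3)[of z r] z r by auto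
    have zc: "z \<in> mspace m" "c \<in> mspace m" using z c C by auto
    have "fibre_proj x0 z = z"
      by (rule fibre_proj_eq[OF zc(1) z pseudometric_onD(1)[OF psm_a zc(1)]])
    then have "mdist m z (fibre_proj x0 c) < r"
      using mdist_fibre_proj[OF zc] a_le[OF zc] c(2) by simp
    then show ?thesis using c(1) by auto
  qed
  then show ?thesis
    unfolding separable_space_mtopology_of_iff using C(1,2) fibre_proj
    by (intro exI[of _ "fibre_proj x0 ` C"]) auto
qed

lemma mm_space_fibre: "mm_space (fibre_space x0)"
  unfolding mm_space_def fibre_space_def prod.case
proof (intro conjI allI impI)
  show "prob_space (distr M (borel_metric (fibre x0)) (fibre_proj x0))"
    by (rule prob_space_distr[OF fibre_proj_measurable])
  fix U assume U: "openin (mtopology_of (fibre x0)) U" "U \<noteq> {}"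
  then obtain z where z: "z \<in> U" "z \<in> mspace (fibre x0)"
    unfolding openin_mtopology_of by blast
  then have zm: "z \<in> mspace m" by simp
  have "fibre_proj x0 z = z"
    by (rule fibre_proj_eq[OF zm z(2) pseudometric_onD(1)[OF psm_a zm]])
  then have "fibre_proj x0 -` U \<inter> mspace m \<noteq> {}" using z by auto
  then have "0 < prob (fibre_proj x0 -` U \<inter> mspace m)"
    by (rule full_support[OF openin_fibre_proj_vimage[OF U(1)]])
  then show "0 < measure (distr M (borel_metric (fibre x0)) (fibre_proj x0)) U"
    by (simp add: measure_distr[OF fibre_proj_measurable openin_borel_metric[OF U(1)]])
qed (simp_all add: fibre_complete fibre_separable)

end

text \<open>By separability \<open>U\<close> is the union of countably many \<open>a\<close>-balls with centres in a dense sequence and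
rational radii. Using the first \<open>n\<close> of them with slope \<open>n\<close> makes a single limit suffice.\<close>

lemma bump_approximates_open:
  assumes U: "\<And>x. x \<in> U \<Longrightarrow> \<exists>r>0. \<forall>y\<in>mspace m. a x y < r \<longrightarrow> y \<in> U" "U \<subseteq> mspace m"
  shows "\<exists>ps :: nat \<Rightarrow> _. (\<forall>n. fst ` set (ps n) \<subseteq> mspace m) \<and>
    (\<forall>x\<in>mspace m. (\<lambda>n. bump a (real n) (ps n) x) \<longlonglongrightarrow> indicator U x)"
proof -
  obtain C where C: "countable C" "C \<subseteq> mspace m" "\<And>x r. x \<in> mspace m \<Longrightarrow> r > 0 \<Longrightarrow> \<exists>y\<in>C. mdist m x y < r"
    using separable unfolding separable_space_mtopology_of_iff by blast
  define I where "I = {(c, q). c \<in> C \<and> q \<in> \<rat> \<and> {y \<in> mspace m. a c y < q} \<subseteq> U}"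
  have "I \<subseteq> C \<times> \<rat>" by (auto simp: I_def)
  then have cI: "countable I" using C(1) countable_rat by (meson countable_SIGMA countable_subset)
  obtain x0 where "x0 \<in> mspace m" using mspace_nonempty by blast
  then obtain c0 where c0: "c0 \<in> C" using C(3)[of x0 1] by auto
  \<comment> \<open>An empty ball guarantees that there is something to enumerate even if \<open>U\<close> is empty.\<close>
  have "{y \<in> mspace m. a c0 y < 0} = {}"
    using pseudometric_onD(2)[OF psm_a] c0 C(2) by fastforce
  then have "(c0, 0) \<in> I" using c0 by (auto simp: I_def)
  then have "I \<noteq> {}" by blast
  then have rI: "range (from_nat_into I) = I" by (rule range_from_nat_into[OF _ cI])
  define ps where "ps n = map (from_nat_into I) [0..<n]" for n
  have ps: "set (ps n) \<subseteq> I" for n using rI by (auto simp: ps_def)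
  have "(\<lambda>n. bump a (real n) (ps n) x) \<longlonglongrightarrow> indicator U x" if x: "x \<in> mspace m" for x
  proof (cases "x \<in> U")
    case False
    have "bump a (real n) (ps n) x = 0" for n
    proof (rule bump_eq_0)
      fix p s assume "(p, s) \<in> set (ps n)"
      then have "{y \<in> mspace m. a p y < s} \<subseteq> U" using ps unfolding I_def by blast
      then show "s \<le> a p x" using False x by force
    qed simp
    then show ?thesis using False by simp
  next
    case True
    then obtain r where r: "r > 0" "\<And>y. y \<in> mspace m \<Longrightarrow> a x y < r \<Longrightarrow> y \<in> U" using U(1) by blast
    obtain c where c: "c \<in> C" "mdist m x c < r / 4" using C(3)[OF x, of "r / 4"] r by auto
    have cm: "c \<in> mspace m" using c C by blast
    have ac: "a x c < r / 4" "a c x < r / 4"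
      using a_le[OF x cm] c(2) pseudometric_onD(3)[OF psm_a x cm] by auto
    obtain q where q: "q \<in> \<rat>" "r / 4 < q" "q < r / 2"
      using Rats_dense_in_real[of "r / 4" "r / 2"] r(1) by auto
    have "y \<in> U" if "y \<in> mspace m" "a c y < q" for y
      using r(2)[OF that(1)] pseudometric_onD(4)[OF psm_a x cm that(1)] ac(1) q(3) that(2) r(1) by linarith
    then have "(c, q) \<in> I" using c q by (auto simp: I_def)
    then obtain i where i: "from_nat_into I i = (c, q)" using rI by (metis imageE)
    obtain N :: nat where N: "1 / (q - a c x) < real N" using reals_Archimedean2 by blast
    have "bump a (real n) (ps n) x = 1" if n: "n \<ge> max N (Suc i)" for n
    proof -
      have "(c, q) \<in> set (ps n)"
        using n i by (auto simp: ps_def intro!: image_eqI[of _ _ i])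
      then have le: "min 1 (real n * (q - a c x)) \<le> bump a (real n) (ps n) x"
        by (rule bump_ge)
      have pos: "0 < q - a c x" using ac(2) q(2) by linarith
      have "1 \<le> real N * (q - a c x)" using N pos by (simp add: pos_divide_less_eq)
      also have "\<dots> \<le> real n * (q - a c x)" using n pos by (intro mult_right_mono) auto
      finally show ?thesis using le bump_range[of a "real n" "ps n" x] by auto
    qed
    then have "\<forall>\<^sub>F n in sequentially. bump a (real n) (ps n) x = indicator U x"
      unfolding eventually_sequentially using True by (intro exI[of _ "max N (Suc i)"]) auto
    then show ?thesis by (rule tendsto_eventually)
  qed
  moreover have "fst ` set (ps n) \<subseteq> mspace m" for n
    using ps[of n] C(2) unfolding I_def by auto
  ultimately show ?thesis by blast
qed

text \<open>Independence of events is recovered from that of test functions: both indicators are pointwise limits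
of test functions with values in the unit interval.\<close>

lemma prob_open_Int:
  assumes U: "\<And>x. x \<in> U \<Longrightarrow> \<exists>r>0. \<forall>y\<in>mspace m. a x y < r \<longrightarrow> y \<in> U" "U \<in> sets M"
    and V: "\<And>x. x \<in> V \<Longrightarrow> \<exists>r>0. \<forall>y\<in>mspace m. b x y < r \<longrightarrow> y \<in> V" "V \<in> sets M"
  shows "prob (U \<inter> V) = prob U * prob V"
proof -
  interpret S: split_space m M b a by (rule split_space_commute)
  have UV: "U \<subseteq> mspace m" "V \<subseteq> mspace m" using sets.sets_into_space[OF U(2)] sets.sets_into_space[OF V(2)] by simp_all
  obtain ps :: "nat \<Rightarrow> _" where ps: "\<And>n. fst ` set (ps n) \<subseteq> mspace m"
    and psl: "\<And>x. x \<in> mspace m \<Longrightarrow> (\<lambda>n. bump a (real n) (ps n) x) \<longlonglongrightarrow> indicator U x"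
    using bump_approximates_open[OF U(1) UV(1)] by blast
  obtain qs :: "nat \<Rightarrow> _" where qs: "\<And>n. fst ` set (qs n) \<subseteq> mspace m"
    and qsl: "\<And>x. x \<in> mspace m \<Longrightarrow> (\<lambda>n. bump b (real n) (qs n) x) \<longlonglongrightarrow> indicator V x"
    using S.bump_approximates_open[OF V(1) UV(2)] by blast
  have pm [measurable]: "bump a (real n) (ps n) \<in> borel_measurable M"
    and qm [measurable]: "bump b (real n) (qs n) \<in> borel_measurable M" for n
    by (rule bump_a_measurable[OF _ ps] S.bump_a_measurable[OF _ qs]; simp)+
  note [measurable] = U(2) V(2)
  have lim: "(\<lambda>n. expectation (f n)) \<longlonglongrightarrow> prob W"
    if W: "W \<in> sets M" and fm: "\<And>n. f n \<in> borel_measurable M"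
      and f1: "\<And>n x. 0 \<le> f n x \<and> f n x \<le> 1"
      and fl: "\<And>x. x \<in> mspace m \<Longrightarrow> (\<lambda>n. f n x) \<longlonglongrightarrow> indicator W x"
    for W and f :: "nat \<Rightarrow> 'a \<Rightarrow> real"
  proof -
    have "(\<lambda>n. expectation (f n)) \<longlonglongrightarrow> expectation (indicator W)"
      by (rule integral_dominated_convergence[where w = "\<lambda>_. 1"])
        (use W fm f1 fl in \<open>auto intro!: AE_I2\<close>)
    moreover have "W \<inter> mspace m = W" using sets.sets_into_space[OF W] by auto
    ultimately show ?thesis by simp
  qed
  have "(\<lambda>n. \<integral>x. bump a (real n) (ps n) x * bump b (real n) (qs n) x \<partial>M) \<longlonglongrightarrow> prob (U \<inter> V)"
  proof (rule lim)
    show "0 \<le> bump a (real n) (ps n) x * bump b (real n) (qs n) x \<and>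
        bump a (real n) (ps n) x * bump b (real n) (qs n) x \<le> 1" for n x
      using bump_range[of a "real n" "ps n" x] bump_range[of b "real n" "qs n" x] by (simp add: mult_le_one)
    show "(\<lambda>n. bump a (real n) (ps n) x * bump b (real n) (qs n) x) \<longlonglongrightarrow> indicator (U \<inter> V) x"
      if "x \<in> mspace m" for x
      using tendsto_mult[OF psl[OF that] qsl[OF that]] by (simp add: indicator_inter_arith)
  qed measurable
  moreover have "(\<lambda>n. expectation (bump a (real n) (ps n)) * expectation (bump b (real n) (qs n)))
      \<longlonglongrightarrow> prob U * prob V"
    by (intro tendsto_mult lim U(2) V(2) pm qm bump_range psl qsl)
  moreover have "(\<integral>x. bump a (real n) (ps n) x * bump b (real n) (qs n) x \<partial>M) =
      expectation (bump a (real n) (ps n)) * expectation (bump b (real n) (qs n))" for n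
    using splittingD(4)[OF split, of "real n" "ps n" "qs n"] ps qs by simp
  ultimately show ?thesis by (auto intro: LIMSEQ_unique)
qed

text \<open>The isomorphism is \<open>x \<mapsto> (fibre_proj x0 x, S.fibre_proj x0 x)\<close>. It is isometric since \<open>d = a + b\<close> and onto
by \<open>ex_meet\<close>. The joint distribution is a product because the preimages of open sets, which are stable
under intersection and generate the Borel sets, are independent.\<close>

lemma mm_iso_fibres:
  assumes x0: "x0 \<in> mspace m"
  shows "mm_iso (m, M) (mm_sum (fibre_space x0) (split_space.fibre_space m M b a x0))"
proof -
  interpret S: split_space m M b a by (rule split_space_commute)
  let ?A = "borel_metric (fibre x0)" and ?B = "borel_metric (S.fibre x0)"
  let ?p = "fibre_proj x0" and ?q = "S.fibre_proj x0"
  note p = fibre_proj[OF x0] and q = S.fibre_proj[OF x0]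
  note pm = fibre_proj_measurable[OF x0] and qm = S.fibre_proj_measurable[OF x0]
  let ?E = "{?p -` U \<inter> space M | U. openin (mtopology_of (fibre x0)) U}"
  let ?F = "{?q -` V \<inter> space M | V. openin (mtopology_of (S.fibre x0)) V}"
  have "indep_set ?E ?F"
  proof (rule indep_setI)
    show "?E \<subseteq> events" using sets_open[OF openin_fibre_proj_vimage[OF x0]] by auto
    show "?F \<subseteq> events" using sets_open[OF S.openin_fibre_proj_vimage[OF x0]] by auto
    fix U' V' assume "U' \<in> ?E" "V' \<in> ?F"
    then obtain U V where UV: "openin (mtopology_of (fibre x0)) U" "U' = ?p -` U \<inter> mspace m"
        "openin (mtopology_of (S.fibre x0)) V" "V' = ?q -` V \<inter> mspace m"
      by auto
    show "prob (U' \<inter> V') = prob U' * prob V'"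
    proof (rule prob_open_Int)
      show "U' \<in> events" "V' \<in> events"
        unfolding UV by (intro sets_open openin_fibre_proj_vimage[OF x0] S.openin_fibre_proj_vimage[OF x0] UV)+
      show "\<exists>r>0. \<forall>y\<in>mspace m. a x y < r \<longrightarrow> y \<in> U'" if "x \<in> U'" for x
        using fibre_proj_vimage_open[OF x0 UV(1), of x] that unfolding UV(2) by blast
      show "\<exists>r>0. \<forall>y\<in>mspace m. b x y < r \<longrightarrow> y \<in> V'" if "x \<in> V'" for x
        using S.fibre_proj_vimage_open[OF x0 UV(3), of x] that unfolding UV(4) by blast
    qed
  qed
  moreover have stable: "Int_stable {f -` U \<inter> space M | U. openin T U}" for f :: "'a \<Rightarrow> 'a" and T
    unfolding Int_stable_def
  proof (intro ballI)
    fix A B assume "A \<in> {f -` U \<inter> space M | U. openin T U}" "B \<in> {f -` U \<inter> space M | U. openin T U}"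
    then obtain U V where "openin T U" "A = f -` U \<inter> space M" "openin T V" "B = f -` V \<inter> space M" by blast
    then show "A \<inter> B \<in> {f -` U \<inter> space M | U. openin T U}"
      by (intro CollectI exI[of _ "U \<inter> V"]) auto
  qed
  ultimately have "indep_set (sigma_sets (space M) ?E) (sigma_sets (space M) ?F)"
    by (intro indep_set_sigma_sets stable)
  moreover have "sigma_sets (space M) ?E = {?p -` A \<inter> space M | A. A \<in> sets ?A}"
    unfolding sets_borel_metric
    by (subst sigma_sets_vimage_commute) (use p in auto)
  moreover have "sigma_sets (space M) ?F = {?q -` A \<inter> space M | A. A \<in> sets ?B}"
    unfolding sets_borel_metric
    by (subst sigma_sets_vimage_commute) (use q in auto)
  moreover have "sigma_sets (space M) {f -` A \<inter> space M | A. A \<in> sets N} = {f -` A \<inter> space M | A. A \<in> sets N}"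
    if "f \<in> space M \<rightarrow> space N" for f :: "'a \<Rightarrow> 'a" and N :: "'a measure"
    using sigma_sets_vimage_commute[OF that, of "sets N"] sets.sigma_sets_eq[of N] by simp
  ultimately have "indep_var ?A ?p ?B ?q"
    unfolding indep_var_eq using pm qm p q by simp
  then have eq: "distr M ?A ?p \<Otimes>\<^sub>M distr M ?B ?q = distr M (?A \<Otimes>\<^sub>M ?B) (\<lambda>x. (?p x, ?q x))"
    unfolding indep_var_distribution_eq by blast
  show ?thesis
    unfolding mm_iso_def mm_sum_def fibre_space_def S.fibre_space_def fst_conv snd_conv prod.case
  proof (intro exI conjI)
    show "isometric_embedding m (sum_metric (fibre x0) (S.fibre x0)) (\<lambda>x. (?p x, ?q x))"
      unfolding isometric_embedding_def
    proof (intro conjI ballI Pi_I)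
      show "(?p x, ?q x) \<in> mspace (sum_metric (fibre x0) (S.fibre x0))" if "x \<in> mspace m" for x
        using p q that by auto
      show "mdist (sum_metric (fibre x0) (S.fibre x0)) (?p x, ?q x) (?p y, ?q y) = mdist m x y"
        if "x \<in> mspace m" "y \<in> mspace m" for x y
        by (simp add: mdist_fibre_proj[OF x0 that] S.mdist_fibre_proj[OF x0 that] mdist_eq[OF that])
    qed
    show "(\<lambda>x. (?p x, ?q x)) ` mspace m = mspace (sum_metric (fibre x0) (S.fibre x0))"
    proof (intro equalityI subsetI)
      fix w assume "w \<in> mspace (sum_metric (fibre x0) (S.fibre x0))"
      then obtain u v where w: "w = (u, v)" "u \<in> mspace (fibre x0)" "v \<in> mspace (S.fibre x0)" by auto
      then have uv: "u \<in> mspace m" "v \<in> mspace m" by auto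
      obtain z where z: "z \<in> mspace m" "a u z = 0" "b v z = 0" using ex_meet[OF uv] by blast
      have "?p z = u" "?q z = v"
        using z pseudometric_onD(3)[OF psm_a uv(1) z(1)] pseudometric_onD(3)[OF psm_b uv(2) z(1)]
        by (auto intro: fibre_proj_eq[OF x0 z(1) w(2)] S.fibre_proj_eq[OF x0 z(1) w(3)])
      then show "w \<in> (\<lambda>x. (?p x, ?q x)) ` mspace m" using w(1) z(1) by auto
    qed (use p q in auto)
    have "distr M (borel_metric (sum_metric (fibre x0) (S.fibre x0))) (\<lambda>x. (?p x, ?q x))
        = distr M (?A \<Otimes>\<^sub>M ?B) (\<lambda>x. (?p x, ?q x))"
      by (rule distr_cong)
        (simp_all add: sets_sum_metric[OF fibre_separable[OF x0] S.fibre_separable[OF x0]])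
    then show "distr M (borel_metric (sum_metric (fibre x0) (S.fibre x0))) (\<lambda>x. (?p x, ?q x))
        = distr M ?A ?p \<Otimes>\<^sub>M distr M ?B ?q"
      using eq by simp
  qed
qed

lemma fibre_not_unit:
  assumes x0: "x0 \<in> mspace m" and xy: "x \<in> mspace m" "y \<in> mspace m" "a x y \<noteq> 0"
  shows "mm_class (fibre_space x0) \<noteq> mm_unit"
  unfolding mm_class_not_unit_iff[OF mm_space_fibre[OF x0]]
proof (intro bexI)
  have "mdist m (fibre_proj x0 x) (fibre_proj x0 y) \<noteq> 0"
    using mdist_fibre_proj[OF x0 xy(1,2)] xy(3) by simp
  then show "fibre_proj x0 x \<noteq> fibre_proj x0 y"
    using fibre_proj(1)[OF x0 xy(2)] by auto
qed (use fibre_proj[OF x0] xy in \<open>auto simp: fibre_space_def\<close>)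

end

lemma splitting_imp_mm_plus:
  assumes X: "mm_space X" and split: "splitting X a b"
    and a: "x \<in> mspace (fst X)" "y \<in> mspace (fst X)" "a x y \<noteq> 0"
    and b: "u \<in> mspace (fst X)" "v \<in> mspace (fst X)" "b u v \<noteq> 0"
  shows "\<exists>\<Y> \<Z>. \<Y> \<noteq> mm_unit \<and> \<Z> \<noteq> mm_unit \<and> mm_class X = \<Y> \<boxplus> \<Z>"
proof -
  interpret X: metric_measure_space "fst X" "snd X" using X by (simp add: mm_space_iff)
  interpret A: split_space "fst X" "snd X" a b by unfold_locales (simp add: split)
  interpret B: split_space "fst X" "snd X" b a by (rule A.split_space_commute)
  let ?Y = "A.fibre_space x" and ?Z = "B.fibre_space x"
  have Y: "mm_space ?Y" and Z: "mm_space ?Z"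
    using A.mm_space_fibre[OF a(1)] B.mm_space_fibre[OF a(1)] .
  have "mm_iso X (mm_sum ?Y ?Z)" using A.mm_iso_fibres[OF a(1)] by simp
  then have "mm_class X = mm_class ?Y \<boxplus> mm_class ?Z"
    by (simp add: mm_class_eq_iff[OF X mm_space_sum[OF Y Z]] flip: mm_class_sum[OF Y Z])
  then show ?thesis
    using A.fibre_not_unit[OF a(1) a] B.fibre_not_unit[OF a(1) b] by blast
qed


section \<open>Attaching a pendant point\<close>

text \<open>The new point \<open>None\<close> hangs from \<open>x0\<close> by an edge of length \<open>R\<close>: every path to it passes through \<open>x0\<close>.\<close>

fun pendant_dist :: "'a metric \<Rightarrow> 'a \<Rightarrow> real \<Rightarrow> 'a option \<Rightarrow> 'a option \<Rightarrow> real" where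
  "pendant_dist m x0 R (Some x) (Some y) = mdist m x y"
| "pendant_dist m x0 R None (Some x) = R + mdist m x0 x"
| "pendant_dist m x0 R (Some x) None = R + mdist m x0 x"
| "pendant_dist m x0 R None None = 0"

definition pendant_metric :: "'a metric \<Rightarrow> 'a \<Rightarrow> real \<Rightarrow> 'a option metric" where
  "pendant_metric m x0 R = metric (insert None (Some ` mspace m), pendant_dist m x0 R)"

text \<open>The mixture of the Dirac mass at the new point, with weight \<open>e\<close>, and of the old measure.\<close>

definition pendant :: "'a metric_measure \<Rightarrow> 'a \<Rightarrow> real \<Rightarrow> real \<Rightarrow> 'a option metric_measure" where
  "pendant X x0 R e = (let N = borel_metric (pendant_metric (fst X) x0 R) in
     (pendant_metric (fst X) x0 R,
      measure_pmf (bernoulli_pmf e) \<bind> (\<lambda>s. if s then return N None else distr (snd X) N Some)))"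

locale pendant_space = metric_measure_space m M for m :: "'a metric" and M :: "'a measure" +
  fixes x0 :: 'a and R e :: real
  assumes x0: "x0 \<in> mspace m" and R: "0 < R" and e: "0 < e" "e < 1"
begin

abbreviation P where "P \<equiv> pendant_metric m x0 R"
abbreviation N where "N \<equiv> snd (pendant (m, M) x0 R e)"

lemma fst_pendant: "fst (pendant (m, M) x0 R e) = P"
  by (simp add: pendant_def Let_def)

lemma Metric_space_pendant: "Metric_space (insert None (Some ` mspace m)) (pendant_dist m x0 R)"
  (is "Metric_space ?S ?d")
proof
  fix u v
  show "0 \<le> ?d u v"
    using R by (cases u; cases v) (auto intro!: add_nonneg_nonneg)
  show "?d u v = ?d v u"
    by (cases u; cases v) (auto simp: mdist_commute)
next
  fix u v assume "u \<in> ?S" "v \<in> ?S"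
  moreover have "R + mdist m x0 x \<noteq> 0" for x
    using R mdist_nonneg[of m x0 x] by linarith
  ultimately show "?d u v = 0 \<longleftrightarrow> u = v" by auto
next
  have *: "mdist m x0 y \<le> mdist m x0 x + mdist m x y"
    "mdist m x y \<le> 2 * R + (mdist m x0 x + mdist m x0 y)"
    "mdist m x0 x \<le> mdist m x y + mdist m x0 y"
    if "x \<in> mspace m" "y \<in> mspace m" for x y
    using mdist_triangle[OF x0 that] mdist_triangle[OF x0 that(2,1)] mdist_triangle[OF that(1) x0 that(2)] R
      mdist_commute[of m x x0] mdist_commute[of m x y] by linarith+
  fix u v w assume "u \<in> ?S" "v \<in> ?S" "w \<in> ?S"
  then show "?d u w \<le> ?d u v + ?d v w"
    using R by (auto intro: * mdist_triangle)
qed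

lemma mspace_P: "mspace P = insert None (Some ` mspace m)"
  unfolding pendant_metric_def by (rule Metric_space.mspace_metric[OF Metric_space_pendant])

lemma mdist_P [simp]: "mdist P = pendant_dist m x0 R"
  unfolding pendant_metric_def by (rule Metric_space.mdist_metric[OF Metric_space_pendant])

lemma isometric_embedding_Some: "isometric_embedding m P Some"
  by (simp add: isometric_embedding_def mspace_P)

text \<open>The new point is isolated by the distance \<open>R\<close>, so a Cauchy sequence eventually stays at it or
eventually stays in the old space.\<close>

lemma complete_P: "mcomplete_of P"
proof (rule mcomplete_of_iff[THEN iffD2], intro allI impI)
  fix \<sigma> :: "nat \<Rightarrow> _"
  assume \<sigma>: "range \<sigma> \<subseteq> mspace P"
    and C: "\<forall>\<epsilon>>0. \<exists>j. \<forall>n n'. j \<le> n \<longrightarrow> j \<le> n' \<longrightarrow> mdist P (\<sigma> n) (\<sigma> n') < \<epsilon>"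
  \<comment> \<open>Closer than \<open>R\<close> to each other, the terms are all equal to \<open>None\<close> or all different from it.\<close>
  obtain K where K: "\<And>n. K \<le> n \<Longrightarrow> mdist P (\<sigma> K) (\<sigma> n) < R"
    using C R by blast
  have far: "\<not> R + mdist m x0 x < R" for x
    by (simp add: not_less)
  show "\<exists>x\<in>mspace P. \<forall>\<epsilon>>0. \<exists>j. \<forall>n\<ge>j. mdist P (\<sigma> n) x < \<epsilon>"
  proof (cases "\<sigma> K")
    case None
    have "\<sigma> n = None" if "K \<le> n" for n
      using K[OF that] None far by (cases "\<sigma> n") auto
    then show ?thesis
      by (intro bexI[of _ None] allI impI exI[of _ K]) (auto simp: mspace_P)
  next
    case (Some z)
    have "\<exists>x. \<sigma> n = Some x" if "K \<le> n" for n
      using K[OF that] Some far by (cases "\<sigma> n") auto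
    then have "\<forall>n. \<exists>x. \<sigma> (n + K) = Some x" by simp
    then obtain \<tau> where \<tau>: "\<And>n. \<sigma> (n + K) = Some (\<tau> n)" by metis
    have "\<tau> n \<in> mspace m" for n
    proof -
      have "\<sigma> (n + K) \<in> mspace P" using \<sigma> by blast
      then show ?thesis unfolding \<tau> mspace_P by auto
    qed
    moreover have "\<exists>j. \<forall>n n'. j \<le> n \<longrightarrow> j \<le> n' \<longrightarrow> mdist m (\<tau> n) (\<tau> n') < \<epsilon>" if e': "\<epsilon> > 0" for \<epsilon>
    proof -
      obtain j where j: "\<And>n n'. j \<le> n \<Longrightarrow> j \<le> n' \<Longrightarrow> mdist P (\<sigma> n) (\<sigma> n') < \<epsilon>"
        using C e' by blast
      have "mdist m (\<tau> n) (\<tau> n') < \<epsilon>" if "j \<le> n" "j \<le> n'" for n n'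
        using j[of "n + K" "n' + K"] that by (simp add: \<tau>)
      then show ?thesis by blast
    qed
    ultimately obtain x where x: "x \<in> mspace m" "\<forall>\<epsilon>>0. \<exists>j. \<forall>n\<ge>j. mdist m (\<tau> n) x < \<epsilon>"
      using mcomplete_of_iff[THEN iffD1, OF complete, THEN spec, of \<tau>] by blast
    have "\<exists>j. \<forall>n\<ge>j. mdist P (\<sigma> n) (Some x) < \<epsilon>" if e': "\<epsilon> > 0" for \<epsilon>
    proof -
      obtain j where j: "\<And>n. n \<ge> j \<Longrightarrow> mdist m (\<tau> n) x < \<epsilon>" using x(2) e' by blast
      have "mdist P (\<sigma> n) (Some x) < \<epsilon>" if "n \<ge> j + K" for n
        using j[of "n - K"] \<tau>[of "n - K"] that by simp
      then show ?thesis by blast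
    qed
    then show ?thesis using x(1) by (intro bexI[of _ "Some x"]) (auto simp: mspace_P)
  qed
qed

lemma separable_P: "separable_space (mtopology_of P)"
proof -
  obtain C where C: "countable C" "C \<subseteq> mspace m" "\<And>x r. x \<in> mspace m \<Longrightarrow> r > 0 \<Longrightarrow> \<exists>y\<in>C. mdist m x y < r"
    using separable unfolding separable_space_mtopology_of_iff by blast
  have "\<exists>v\<in>insert None (Some ` C). mdist P u v < r" if "u \<in> mspace P" "r > 0" for u r
    using that C(3) by (cases u) (auto simp: mspace_P)
  then show ?thesis
    unfolding separable_space_mtopology_of_iff using C(1,2)
    by (intro exI[of _ "insert None (Some ` C)"]) (auto simp: mspace_P)
qed

lemma kernel: "(\<lambda>s. if s then return (borel_metric P) None else distr M (borel_metric P) Some)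
    \<in> measurable (measure_pmf (bernoulli_pmf e)) (subprob_algebra (borel_metric P))"
proof -
  note Some = measurable_mm[OF sets_M isometric_embedding_Some]
  have "return (borel_metric P) None \<in> space (subprob_algebra (borel_metric P))"
    by (auto simp: space_subprob_algebra mspace_P intro!: prob_space_imp_subprob_space prob_space_return)
  moreover have "distr M (borel_metric P) Some \<in> space (subprob_algebra (borel_metric P))"
    by (auto simp: space_subprob_algebra intro!: prob_space_imp_subprob_space prob_space_distr Some)
  ultimately show ?thesis by auto
qed

lemma N_eq: "N = measure_pmf (bernoulli_pmf e) \<bind>
    (\<lambda>s. if s then return (borel_metric P) None else distr M (borel_metric P) Some)"
  by (simp add: pendant_def Let_def cong del: if_weak_cong)

lemma sets_N: "sets N = sets (borel_metric P)"
  unfolding N_eq by (rule sets_bind) auto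

lemma prob_space_N: "prob_space N"
  unfolding N_eq
proof (rule prob_space.prob_space_bind[OF _ _ kernel])
  show "AE s in measure_pmf (bernoulli_pmf e).
      prob_space (if s then return (borel_metric P) None else distr M (borel_metric P) Some)"
    using measurable_mm[OF sets_M isometric_embedding_Some]
    by (auto intro!: AE_I2 prob_space_return prob_space_distr simp: mspace_P)
qed (rule prob_space_measure_pmf)

lemma measure_N:
  assumes B: "B \<in> sets (borel_metric P)"
  shows "measure N B = e * indicator B None + (1 - e) * measure M (Some -` B \<inter> mspace m)"
proof -
  have "measure N B = (\<integral>s. measure (if s then return (borel_metric P) None else distr M (borel_metric P) Some) B
      \<partial>measure_pmf (bernoulli_pmf e))"
    unfolding N_eq by (rule subprob_space.measure_bind[OF
        prob_space_imp_subprob_space[OF prob_space_measure_pmf] kernel B])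
  also have "\<dots> = measure (return (borel_metric P) None) B * e + measure (distr M (borel_metric P) Some) B * (1 - e)"
    using e by simp
  finally show ?thesis
    by (simp add: measure_return B measure_distr[OF measurable_mm[OF sets_M isometric_embedding_Some] B])
qed

lemma mm_space_pendant: "mm_space (pendant (m, M) x0 R e)"
  unfolding mm_space_iff fst_pendant
proof (intro metric_measure_space.intro metric_measure_space_axioms.intro
    prob_space_N complete_P separable_P sets_N)
  fix U assume U: "openin (mtopology_of P) U" "U \<noteq> {}"
  have o: "openin (mtopology_of m) (Some -` U \<inter> mspace m)"
    by (rule isometric_embedding_open_vimage[OF isometric_embedding_Some U(1)])
  show "0 < measure N U"
  proof (cases "None \<in> U")
    case True
    then show ?thesis
      using e by (simp add: measure_N[OF openin_borel_metric[OF U(1)]] add_pos_nonneg)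
  next
    case False
    have "U \<subseteq> insert None (Some ` mspace m)"
      using openin_subset[OF U(1)] by (simp add: mspace_P)
    then have "Some -` U \<inter> mspace m \<noteq> {}" using U(2) False by blast
    then show ?thesis
      using e full_support[OF o] False by (simp add: measure_N[OF openin_borel_metric[OF U(1)]])
  qed
qed

lemma gpr_pendant_le: "gpr (m, M) (pendant (m, M) x0 R e) \<le> e"
proof (rule bridge_imp_gpr_le[OF _ mm_space_pendant])
  show mm: "mm_space (m, M)" by (simp add: mm_space_iff metric_measure_space_axioms)
  have tri: "mdist P (Some x) u \<le> mdist P (Some x) v + mdist P v u"
    if "x \<in> mspace m" "u \<in> mspace P" "v \<in> mspace P" for x u v
    by (rule mdist_triangle) (use that in \<open>auto simp: mspace_P\<close>)
  show "bridge (m, M) (pendant (m, M) x0 R e) e (\<lambda>x. mdist (fst (pendant (m, M) x0 R e)) (Some x))"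
  proof (rule bridge_embedding, unfold fst_pendant fst_conv snd_conv)
    fix A assume A: "A \<in> sets (borel_metric m)"
    then have Am: "A \<subseteq> mspace m" using sets.sets_into_space by fastforce
    let ?W = "{u \<in> mspace P. \<exists>x\<in>A. mdist P (Some x) u < e}"
    have W: "openin (mtopology_of P) ?W"
      by (rule openin_bridge_enlargement) (use tri Am in blast)
    have sub: "A \<subseteq> Some -` ?W \<inter> mspace m"
    proof
      fix x assume x: "x \<in> A"
      then have "mdist P (Some x) (Some x) < e" using Am e(1) by auto
      with x show "x \<in> Some -` ?W \<inter> mspace m" using Am by (auto simp: mspace_P simp del: mdist_P)
    qed
    have "measure M A \<le> measure M (Some -` ?W \<inter> mspace m)"
      by (rule finite_measure_mono[OF sub sets_open])
        (rule isometric_embedding_open_vimage[OF isometric_embedding_Some W])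
    then have "(1 - e) * measure M A \<le> (1 - e) * measure M (Some -` ?W \<inter> mspace m)"
      using e(2) by (intro mult_left_mono) simp_all
    moreover have "0 \<le> e * indicator ?W None" using e(1) by simp
    ultimately have "(1 - e) * measure M A \<le> measure N ?W"
      using measure_N[OF openin_borel_metric[OF W]] by linarith
    moreover have "e * measure M A \<le> e" using e by simp
    ultimately show "measure M A \<le> measure N ?W + e" by (simp add: algebra_simps)
  next
    fix B assume B: "B \<in> sets (borel_metric P)"
    then have Bm: "B \<subseteq> mspace P" using sets.sets_into_space by fastforce
    let ?V = "{x \<in> mspace m. \<exists>u\<in>B. mdist P (Some x) u < e}"
    have V: "openin (mtopology_of m) ?V"
    proof (rule openin_bridge_enlargement)
      fix u x y assume h: "u \<in> B" "x \<in> mspace m" "y \<in> mspace m"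
      then have "mdist P (Some x) u \<le> mdist P (Some x) (Some y) + mdist P (Some y) u"
        using tri[of x u "Some y"] Bm by (auto simp: mspace_P)
      then show "mdist P (Some x) u \<le> mdist P (Some y) u + mdist m y x"
        by (simp add: mdist_commute[of m x y])
    qed
    have "Some -` B \<inter> mspace m \<subseteq> ?V"
    proof
      fix x assume x: "x \<in> Some -` B \<inter> mspace m"
      then have "mdist P (Some x) (Some x) < e" using e(1) by auto
      with x show "x \<in> ?V" by blast
    qed
    then have le: "measure M (Some -` B \<inter> mspace m) \<le> measure M ?V"
      by (rule finite_measure_mono[OF _ sets_open[OF V]])
    have "measure N B \<le> e + measure M (Some -` B \<inter> mspace m)"
      unfolding measure_N[OF B]
      by (intro add_mono) (use e in \<open>auto simp: indicator_def mult_left_le_one_le\<close>)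
    then show "measure N B \<le> measure M ?V + e" using le by linarith
  qed (use isometric_embedding_Some e in auto)
qed

lemma pendant_not_unit: "mm_class (pendant (m, M) x0 R e) \<noteq> mm_unit"
  unfolding mm_class_not_unit_iff[OF mm_space_pendant] fst_pendant
  by (intro bexI[of _ None] bexI[of _ "Some x0"]) (use x0 in \<open>auto simp: mspace_P\<close>)

text \<open>If the space were a product of two spaces with at least two points, the new point would be some \<open>(p, q)\<close>
and lie between suitable points \<open>(p', q)\<close> and \<open>(p, q')\<close> of the old space. But the way between two old
points \<open>x\<close> and \<open>y\<close> through the new one has length \<open>2 * R + d x x0 + d x0 y\<close>, which exceeds \<open>d x y\<close>.\<close>

lemma pendant_irreducible: "mm_irreducible (mm_class (pendant (m, M) x0 R e))"
proof (rule ccontr)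
  assume "\<not> ?thesis"
  then obtain \<Y> \<Z> where YZ: "\<Y> \<noteq> mm_unit" "\<Z> \<noteq> mm_unit"
      "mm_class (pendant (m, M) x0 R e) = \<Y> \<boxplus> \<Z>"
    using pendant_not_unit by (auto simp: not_mm_irreducible_iff)
  let ?Y = "rep_mm \<Y>" and ?Z = "rep_mm \<Z>"
  have "mm_iso (pendant (m, M) x0 R e) (mm_sum ?Y ?Z)"
    using YZ(3) mm_class_eq_iff[OF mm_space_pendant mm_space_sum[OF mm_space_rep mm_space_rep]]
    unfolding mm_plus_def by blast
  then obtain f where f: "isometric_embedding P (sum_metric (fst ?Y) (fst ?Z)) f"
      "f ` mspace P = mspace (fst ?Y) \<times> mspace (fst ?Z)"
    unfolding mm_iso_def mm_sum_def using fst_pendant by (auto split: prod.splits)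
  have fd: "mdist P u v = mdist (fst ?Y) (fst (f u)) (fst (f v)) + mdist (fst ?Z) (snd (f u)) (snd (f v))"
    if "u \<in> mspace P" "v \<in> mspace P" for u v
    using f(1) that unfolding isometric_embedding_def by (metis mdist_sum_metric)
  have None: "None \<in> mspace P" by (simp add: mspace_P)
  obtain p q where pq: "f None = (p, q)" "p \<in> mspace (fst ?Y)" "q \<in> mspace (fst ?Z)"
    using f(2) None by (cases "f None") blast
  have other: "\<exists>w'\<in>mspace (fst (rep_mm \<W>)). w' \<noteq> w" if W: "\<W> \<noteq> mm_unit" for \<W> w
  proof -
    obtain y y' where y: "y \<in> mspace (fst (rep_mm \<W>))" "y' \<in> mspace (fst (rep_mm \<W>))" "y \<noteq> y'"
      using W mm_class_not_unit_iff[OF mm_space_rep, of \<W>] by auto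
    then show ?thesis by (cases "y = w") auto
  qed
  obtain p' where p': "p' \<in> mspace (fst ?Y)" "p' \<noteq> p" using other[OF YZ(1)] by blast
  obtain q' where q': "q' \<in> mspace (fst ?Z)" "q' \<noteq> q" using other[OF YZ(2)] by blast
  have "(p', q) \<in> f ` mspace P" "(p, q') \<in> f ` mspace P"
    unfolding f(2) using pq p' q' by simp_all
  then obtain u v where uv: "u \<in> mspace P" "f u = (p', q)" "v \<in> mspace P" "f v = (p, q')"
    by (elim imageE) auto
  have "u \<noteq> None" "v \<noteq> None"
    using uv(2,4) pq(1) p'(2) q'(2) by (metis prod.inject)+
  then obtain x y where xy: "u = Some x" "v = Some y" "x \<in> mspace m" "y \<in> mspace m"
    using uv(1,3) by (auto simp: mspace_P)
  have "mdist P u v = mdist P u None + mdist P None v"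
    using fd[OF uv(1,3)] fd[OF uv(1) None] fd[OF None uv(3)] uv(2,4) pq by simp
  then have "mdist m x y = 2 * R + mdist m x0 x + mdist m x0 y"
    by (simp add: xy)
  then show False
    using mdist_triangle[OF xy(3) x0 xy(4)] R by (simp add: mdist_commute[of m x x0])
qed

end

text \<open>Any section \<open>x \<mapsto> (x, w)\<close> embeds \<open>X\<close> isometrically into the sum, and the points of the sum above
\<open>x\<close> are all within \<open>e\<close> of \<open>(x, w)\<close>.\<close>

lemma gpr_mm_sum_le:
  assumes X: "mm_space X" and W: "mm_space W" and e: "0 < e"
    and small: "\<And>w w'. w \<in> mspace (fst W) \<Longrightarrow> w' \<in> mspace (fst W) \<Longrightarrow> mdist (fst W) w w' < e"
  shows "gpr X (mm_sum X W) \<le> e"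
proof -
  interpret X: metric_measure_space "fst X" "snd X" using X by (simp add: mm_space_iff)
  interpret W: metric_measure_space "fst W" "snd W" using W by (simp add: mm_space_iff)
  interpret S: metric_measure_space "fst (mm_sum X W)" "snd (mm_sum X W)"
    using mm_space_sum[OF X W] by (simp add: mm_space_iff)
  obtain w where w: "w \<in> mspace (fst W)" using W.mspace_nonempty by blast
  have prod: "measure (snd (mm_sum X W)) (A \<times> mspace (fst W)) = measure (snd X) A" if "A \<in> sets (snd X)" for A
    using W.emeasure_pair_measure_Times[OF that sets.top[of "snd W"]] W.emeasure_space_1
    by (simp add: measure_def mm_sum_def)
  have ts: "A \<times> mspace (fst W) \<in> sets (snd (mm_sum X W))" if "A \<in> sets (snd X)" for A
    using pair_measureI[OF that sets.top[of "snd W"]] by (simp add: mm_sum_def)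
  have "bridge X (mm_sum X W) e (\<lambda>x. mdist (fst (mm_sum X W)) (x, w))"
  proof (rule bridge_embedding)
    show "isometric_embedding (fst X) (fst (mm_sum X W)) (\<lambda>x. (x, w))"
      using w by (simp add: isometric_embedding_def mm_sum_def)
  next
    fix A assume A: "A \<in> sets (borel_metric (fst X))"
    then have Am: "A \<subseteq> mspace (fst X)" using sets.sets_into_space by fastforce
    let ?V = "{u \<in> mspace (fst (mm_sum X W)). \<exists>x\<in>A. mdist (fst (mm_sum X W)) (x, w) u < e}"
    have V: "openin (mtopology_of (fst (mm_sum X W))) ?V"
    proof (rule openin_bridge_enlargement)
      fix x u v assume "x \<in> A" "u \<in> mspace (fst (mm_sum X W))" "v \<in> mspace (fst (mm_sum X W))"
      then show "mdist (fst (mm_sum X W)) (x, w) u \<le> mdist (fst (mm_sum X W)) (x, w) v + mdist (fst (mm_sum X W)) v u"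
        using Am w by (intro mdist_triangle) (auto simp: mm_sum_def)
    qed
    have "A \<times> mspace (fst W) \<subseteq> ?V"
    proof
      fix u assume "u \<in> A \<times> mspace (fst W)"
      then have u: "fst u \<in> A" "snd u \<in> mspace (fst W)" by auto
      have "mdist (fst (mm_sum X W)) (fst u, w) u < e"
        using small[OF w u(2)] u(1) Am by (auto simp: mm_sum_def)
      then show "u \<in> ?V" using u Am by (auto simp: mm_sum_def mem_Times_iff)
    qed
    then have "measure (snd (mm_sum X W)) (A \<times> mspace (fst W)) \<le> measure (snd (mm_sum X W)) ?V"
      by (rule S.finite_measure_mono[OF _ S.sets_open[OF V]])
    then show "measure (snd X) A \<le> measure (snd (mm_sum X W)) ?V + e"
      using prod[of A] A e by (simp add: X.sets_M)
  next
    fix B assume B: "B \<in> sets (borel_metric (fst (mm_sum X W)))"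
    then have Bm: "B \<subseteq> mspace (fst X) \<times> mspace (fst W)"
      using sets.sets_into_space by (fastforce simp: mm_sum_def)
    let ?V = "{x \<in> mspace (fst X). \<exists>u\<in>B. mdist (fst (mm_sum X W)) (x, w) u < e}"
    have V: "openin (mtopology_of (fst X)) ?V"
    proof (rule openin_bridge_enlargement)
      fix u x y assume h: "u \<in> B" "x \<in> mspace (fst X)" "y \<in> mspace (fst X)"
      then have "mdist (fst X) x (fst u) \<le> mdist (fst X) x y + mdist (fst X) y (fst u)"
        using Bm by (intro mdist_triangle) auto
      then show "mdist (fst (mm_sum X W)) (x, w) u \<le> mdist (fst (mm_sum X W)) (y, w) u + mdist (fst X) y x"
        by (simp add: mm_sum_def mdist_commute[of "fst X" x y])
    qed
    have "B \<subseteq> ?V \<times> mspace (fst W)"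
    proof
      fix u assume u: "u \<in> B"
      then have um: "fst u \<in> mspace (fst X)" "snd u \<in> mspace (fst W)" using Bm by auto
      have "mdist (fst (mm_sum X W)) (fst u, w) u < e"
        using small[OF w um(2)] um by (auto simp: mm_sum_def)
      then have "fst u \<in> ?V" using um(1) u by blast
      then show "u \<in> ?V \<times> mspace (fst W)" using um(2) by (simp only: mem_Times_iff)
    qed
    then have "measure (snd (mm_sum X W)) B \<le> measure (snd (mm_sum X W)) (?V \<times> mspace (fst W))"
      by (rule S.finite_measure_mono[OF _ ts[OF X.sets_open[OF V]]])
    then show "measure (snd (mm_sum X W)) B \<le> measure (snd X) ?V + e"
      using prod[OF X.sets_open[OF V]] e by simp
  qed (rule e)
  then show ?thesis by (rule bridge_imp_gpr_le[OF X mm_space_sum[OF X W]])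
qed

lemma irreducible_dense:
  assumes e: "0 < e"
  shows "\<exists>\<Y>. mm_irreducible \<Y> \<and> gpr_dist \<X> \<Y> < e"
proof -
  let ?X = "rep_mm \<X>"
  have X: "mm_space ?X" by (rule mm_space_rep)
  interpret X: metric_measure_space "fst ?X" "snd ?X" using X by (simp add: mm_space_iff)
  obtain x0 where x0: "x0 \<in> mspace (fst ?X)" using X.mspace_nonempty by blast
  define r where "r = min (e / 2) (1 / 2)"
  interpret P: pendant_space "fst ?X" "snd ?X" x0 1 r
    by unfold_locales (use x0 e in \<open>auto simp: r_def\<close>)
  let ?P = "pendant ?X x0 1 r"
  have "gpr_dist \<X> (mm_class ?P) = gpr ?X ?P"
    using gpr_dist_mm_class[OF X, of ?P] P.mm_space_pendant by simp
  also have "\<dots> \<le> r" using P.gpr_pendant_le by simp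
  finally have "gpr_dist \<X> (mm_class ?P) < e" using e by (simp add: r_def)
  then show ?thesis using P.pendant_irreducible by auto
qed

text \<open>The small summand is a two-point space, obtained by attaching a pendant point to a one-point space.\<close>

lemma reducible_dense:
  assumes e: "0 < e"
  shows "\<exists>\<Y>. \<not> mm_irreducible \<Y> \<and> gpr_dist \<X> \<Y> < e"
proof (cases "\<X> = mm_unit")
  case True
  then show ?thesis
    using gpr_dist_self[OF e] not_mm_irreducible_iff by blast
next
  case False
  let ?X = "rep_mm \<X>" and ?E = "one_point_space ()"
  have X: "mm_space ?X" and E: "mm_space ?E" by (rule mm_space_rep mm_space_one_point)+
  interpret E: metric_measure_space "fst ?E" "snd ?E" using E by (simp add: mm_space_iff)
  interpret P: pendant_space "fst ?E" "snd ?E" "()" "e / 3" "1 / 2"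
    by unfold_locales (use e in \<open>auto simp: one_point_space_def\<close>)
  let ?P = "pendant ?E () (e / 3) (1 / 2)"
  have P: "mm_space ?P" using P.mm_space_pendant by simp
  have eq: "mm_class (mm_sum ?X ?P) = \<X> \<boxplus> mm_class ?P"
    by (simp add: mm_class_sum[OF X P])
  have "gpr_dist \<X> (mm_class (mm_sum ?X ?P)) = gpr ?X (mm_sum ?X ?P)"
    using gpr_dist_mm_class[OF X mm_space_sum[OF X P]] by simp
  also have "\<dots> \<le> e / 2"
  proof (rule gpr_mm_sum_le[OF X P])
    fix u v assume "u \<in> mspace (fst ?P)" "v \<in> mspace (fst ?P)"
    moreover have "fst ?P = P.P" using P.fst_pendant by simp
    ultimately show "mdist (fst ?P) u v < e / 2"
      using e P.mdist_P by (cases u; cases v) (auto simp: one_point_space_def)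
  qed (use e in simp)
  finally have "gpr_dist \<X> (\<X> \<boxplus> mm_class ?P) < e" using e eq by simp
  moreover have "\<not> mm_irreducible (\<X> \<boxplus> mm_class ?P)"
    using False P.pendant_not_unit by (auto simp: not_mm_irreducible_iff)
  ultimately show ?thesis by blast
qed


section \<open>Density and the countable intersection\<close>

text \<open>The predicate \<open>Q\<close> lets the approximating spaces keep a concrete form, such as that of a sum, which
arbitrarily chosen representatives of their classes do not have.\<close>

lemma closure_approximating_maps:
  assumes \<X>: "\<X> \<in> closure S"
    and rep: "\<And>\<Y>. \<Y> \<in> S \<Longrightarrow> \<exists>Y. mm_space Y \<and> mm_class Y = \<Y> \<and> Q Y"
  shows "\<exists>Y T. approximating_maps (rep_mm \<X>) Y T \<and> (\<forall>k. Q (Y k))"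
proof -
  have "\<exists>Y. mm_space Y \<and> Q Y \<and> gpr (rep_mm \<X>) Y < inverse (real (Suc k))" for k
  proof -
    have "0 < inverse (real (Suc k))" by simp
    then obtain \<Y> where "\<Y> \<in> S" "gpr_dist \<X> \<Y> < inverse (real (Suc k))"
      using \<X> in_closure_mm_iff by blast
    moreover obtain Y where "mm_space Y" "mm_class Y = \<Y>" "Q Y" using rep[OF \<open>\<Y> \<in> S\<close>] by blast
    ultimately show ?thesis
      using gpr_dist_mm_class[OF mm_space_rep \<open>mm_space Y\<close>, of \<X>] by (intro exI[of _ Y]) simp
  qed
  then obtain Y where Y: "\<And>k. mm_space (Y k)" "\<And>k. Q (Y k)"
      "\<And>k. gpr (rep_mm \<X>) (Y k) < inverse (real (Suc k))"
    by metis
  have "0 \<le> gpr (rep_mm \<X>) (Y k)" for k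
  proof (rule gpr_greatest[OF mm_space_rep Y(1)])
    fix Z :: "(real + 'a) metric" and \<phi> \<psi>
    interpret X: metric_measure_space "fst (rep_mm \<X>)" "snd (rep_mm \<X>)"
      using mm_space_rep[of \<X>] by (simp add: mm_space_iff)
    interpret Y: metric_measure_space "fst (Y k)" "snd (Y k)" using Y(1)[of k] by (simp add: mm_space_iff)
    assume "isometric_embedding (fst (rep_mm \<X>)) Z \<phi>" "isometric_embedding (fst (Y k)) Z \<psi>"
    then show "0 \<le> prohorov_dist Z (distr (snd (rep_mm \<X>)) (borel_metric Z) \<phi>) (distr (snd (Y k)) (borel_metric Z) \<psi>)"
      by (intro prohorov_dist_nonneg X.prob_space_distr Y.prob_space_distr
          measurable_mm[OF X.sets_M] measurable_mm[OF Y.sets_M])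
  qed
  then have "(\<lambda>k. gpr (rep_mm \<X>) (Y k)) \<longlonglongrightarrow> 0"
    using Y(3) by (intro real_tendsto_sandwich[OF _ _ tendsto_const LIMSEQ_inverse_real_of_nat])
      (auto intro!: always_eventually less_imp_le)
  from gpr_limit_approximating_maps[OF mm_space_rep Y(1) this] show ?thesis
    using Y(2) by blast
qed

text \<open>Asymptotically isometric maps into one-point spaces force all distances in the limit to vanish.\<close>

lemma closed_mm_unit: "closure {mm_unit} = {mm_unit}"
proof -
  have "\<X> = mm_unit" if \<X>: "\<X> \<in> closure {mm_unit}" for \<X>
  proof -
    obtain Y :: "nat \<Rightarrow> unit metric_measure" and T
      where T: "approximating_maps (rep_mm \<X>) Y T" and Y: "\<And>k. \<exists>y. mspace (fst (Y k)) = {y}"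
      using closure_approximating_maps[OF \<X>, of "\<lambda>Y :: unit metric_measure. \<exists>y. mspace (fst Y) = {y}"]
        mm_space_one_point mm_unit_def
      by (metis one_point_metric(1) one_point_space_def fst_conv singletonD)
    have "x = x'" if x: "x \<in> mspace (fst (rep_mm \<X>))" "x' \<in> mspace (fst (rep_mm \<X>))" for x x'
    proof -
      have "T k x = T k x'" "T k x \<in> mspace (fst (Y k))" for k
        using T x Y[of k] unfolding approximating_maps_def by (metis singletonD)+
      then have "mdist (fst (Y k)) (T k x) (T k x') = 0" for k by simp
      then have "mdist (fst (rep_mm \<X>)) x x' = 0"
        using approximating_maps_dist[OF T x] by (simp add: LIMSEQ_const_iff)
      then show ?thesis using x by simp
    qed
    then show ?thesis
      using mm_class_not_unit_iff[OF mm_space_rep, of \<X>] by auto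
  qed
  then show ?thesis using closure_subset[of "{mm_unit}"] by blast
qed

text \<open>The bound \<open>c\<close> is inherited by the integral of \<open>min 1 (a' x0 x)\<close>, as this function is the pointwise
limit of the corresponding 1-Lipschitz functions on the approximating spaces.\<close>

lemma splitting_limit_nontrivial:
  assumes T: "approximating_maps X Y T" and split: "\<And>k. splitting (Y k) (a k) (b k)"
    and a: "\<And>x y. x \<in> mspace (fst X) \<Longrightarrow> y \<in> mspace (fst X) \<Longrightarrow> (\<lambda>k. a k (T k x) (T k y)) \<longlonglongrightarrow> a' x y"
    and x0: "x0 \<in> mspace (fst X)" and c: "0 < c"
    and spread: "\<And>k y. y \<in> mspace (fst (Y k)) \<Longrightarrow> c \<le> (\<integral>u. min 1 (a k y u) \<partial>snd (Y k))"
  shows "\<exists>x\<in>mspace (fst X). a' x0 x \<noteq> 0"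
proof (rule ccontr)
  assume *: "\<not> ?thesis"
  have X: "mm_space X" and Tm: "\<And>k x. x \<in> mspace (fst X) \<Longrightarrow> T k x \<in> mspace (fst (Y k))"
    using T unfolding approximating_maps_def by blast+
  have "(\<lambda>k. \<integral>u. min 1 (a k (T k x0) u) \<partial>snd (Y k)) \<longlonglongrightarrow> (\<integral>x. min 1 (a' x0 x) \<partial>snd X)"
  proof (rule approximating_maps_integral[OF T zero_le_one])
    fix k y y' assume y: "y \<in> mspace (fst (Y k))" "y' \<in> mspace (fst (Y k))"
    note ps = splittingD(1)[OF split, of k]
    have "\<bar>a k (T k x0) y - a k (T k x0) y'\<bar> \<le> mdist (fst (Y k)) y y'"
      using pseudometric_on_abs_diff[OF ps Tm[OF x0] y(1) Tm[OF x0] y(2)]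
        pseudometric_onD(1)[OF ps Tm[OF x0]] splitting_le[OF split y] by linarith
    then show "\<bar>min 1 (a k (T k x0) y) - min 1 (a k (T k x0) y')\<bar> \<le> 1 * mdist (fst (Y k)) y y'"
      by (auto simp: min_def abs_le_iff)
  next
    show "0 \<le> min 1 (a k (T k x0) y) \<and> min 1 (a k (T k x0) y) \<le> 1" if "y \<in> mspace (fst (Y k))" for k y
      using pseudometric_onD(2)[OF splittingD(1)[OF split] Tm[OF x0] that] by simp
    show "(\<lambda>k. min 1 (a k (T k x0) (T k x))) \<longlonglongrightarrow> min 1 (a' x0 x)" if "x \<in> mspace (fst X)" for x
      by (intro tendsto_min tendsto_const a x0 that)
  qed
  then have "c \<le> (\<integral>x. min 1 (a' x0 x) \<partial>snd X)"
    by (rule LIMSEQ_le_const) (use spread Tm x0 in blast)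
  also have "\<dots> = (\<integral>x. 0 \<partial>snd X)"
  proof (rule Bochner_Integration.integral_cong)
    fix x assume "x \<in> space (snd X)"
    then have "x \<in> mspace (fst X)"
      using metric_measure_space.space_M[of "fst X" "snd X"] X by (simp add: mm_space_iff)
    then show "min 1 (a' x0 x) = 0" using * by auto
  qed simp
  finally show False using c by simp
qed

definition spread_sums :: "real \<Rightarrow> mm set" where
  "spread_sums c = {\<Y> \<boxplus> \<Z> | \<Y> \<Z>. spread c (rep_mm \<Y>) \<and> spread c (rep_mm \<Z>)}"

text \<open>The pseudometrics of the two summands converge along a subsequence to a splitting of the metric of the
limit, and neither part vanishes because all summands are spread out by the same amount.\<close>

lemma closure_spread_sums_reducible:
  assumes c: "0 < c" and \<X>: "\<X> \<in> closure (spread_sums c)"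
  shows "\<exists>\<Y> \<Z>. \<Y> \<noteq> mm_unit \<and> \<Z> \<noteq> mm_unit \<and> \<X> = \<Y> \<boxplus> \<Z>"
proof -
  let ?X = "rep_mm \<X>"
  let ?Q = "\<lambda>Y. \<exists>(A :: real metric_measure) (B :: real metric_measure). mm_space A \<and> mm_space B \<and> spread c A \<and> spread c B \<and> Y = mm_sum A B"
  have "\<exists>Y. mm_space Y \<and> mm_class Y = \<Y> \<and> ?Q Y" if \<Y>: "\<Y> \<in> spread_sums c" for \<Y>
  proof -
    obtain \<A> \<B> where AB: "\<Y> = \<A> \<boxplus> \<B>" "spread c (rep_mm \<A>)" "spread c (rep_mm \<B>)"
      using \<Y> unfolding spread_sums_def by blast
    show ?thesis
      by (intro exI[of _ "mm_sum (rep_mm \<A>) (rep_mm \<B>)"] conjI exI[of _ "rep_mm \<A>"]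
          exI[of _ "rep_mm \<B>"] mm_space_sum mm_space_rep AB(2,3) refl)
        (simp add: AB(1) mm_plus_def)
  qed
  from closure_approximating_maps[OF \<X>, of ?Q, OF this]
  obtain Y T where T: "approximating_maps ?X Y T" and Q: "\<forall>k. ?Q (Y k)" by blast
  obtain A B where AB: "\<And>k. mm_space (A k)" "\<And>k. mm_space (B k)" "\<And>k. spread c (A k)" "\<And>k. spread c (B k)"
    and Y: "\<And>k. Y k = mm_sum (A k) (B k)"
    using Q by metis
  define a where "a k u v = mdist (fst (A k)) (fst u) (fst v)" for k and u v :: "real \<times> real"
  define b where "b k u v = mdist (fst (B k)) (snd u) (snd v)" for k and u v :: "real \<times> real"
  have split: "splitting (Y k) (a k) (b k)" for k
    unfolding Y a_def b_def by (rule mm_sum_splitting[OF AB(1,2)])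
  have Ym: "mspace (fst (Y k)) = mspace (fst (A k)) \<times> mspace (fst (B k))" for k
    by (simp add: Y mm_sum_def)
  have A: "metric_measure_space (fst (A k)) (snd (A k))" and B: "metric_measure_space (fst (B k)) (snd (B k))" for k
    using AB(1,2) by (simp_all add: mm_space_iff)
  have one: "integral\<^sup>L (snd (A k)) (\<lambda>_. 1) = (1 :: real)" "integral\<^sup>L (snd (B k)) (\<lambda>_. 1) = (1 :: real)" for k
  proof -
    interpret A: metric_measure_space "fst (A k)" "snd (A k)" by (rule A)
    interpret B: metric_measure_space "fst (B k)" "snd (B k)" by (rule B)
    show "integral\<^sup>L (snd (A k)) (\<lambda>_. 1) = (1 :: real)" "integral\<^sup>L (snd (B k)) (\<lambda>_. 1) = (1 :: real)"
      by (simp_all add: A.prob_space[unfolded A.space_M] B.prob_space[unfolded B.space_M])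
  qed
  have sa: "c \<le> (\<integral>u. min 1 (a k y u) \<partial>snd (Y k))" if y: "y \<in> mspace (fst (Y k))" for k y
  proof -
    have m: "mdist (fst (A k)) (fst y) \<in> borel_measurable (snd (A k))"
      by (rule metric_measure_space.mdist_measurable[OF A]) (use y Ym in auto)
    have "(\<integral>u. min 1 (mdist (fst (A k)) (fst y) (fst u)) * 1 \<partial>snd (Y k))
        = (\<integral>x. min 1 (mdist (fst (A k)) (fst y) x) \<partial>snd (A k)) * integral\<^sup>L (snd (B k)) (\<lambda>_. 1)"
      unfolding Y by (rule integral_mm_sum_product[OF AB(1,2)]) (use m in auto)
    then show ?thesis
      using AB(3)[of k] y Ym[of k] unfolding one spread_def a_def by auto
  qed
  have sb: "c \<le> (\<integral>u. min 1 (b k y u) \<partial>snd (Y k))" if y: "y \<in> mspace (fst (Y k))" for k y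
  proof -
    have m: "mdist (fst (B k)) (snd y) \<in> borel_measurable (snd (B k))"
      by (rule metric_measure_space.mdist_measurable[OF B]) (use y Ym in auto)
    have "(\<integral>u. 1 * min 1 (mdist (fst (B k)) (snd y) (snd u)) \<partial>snd (Y k))
        = integral\<^sup>L (snd (A k)) (\<lambda>_. 1) * (\<integral>x. min 1 (mdist (fst (B k)) (snd y) x) \<partial>snd (B k))"
      unfolding Y by (rule integral_mm_sum_product[OF AB(1,2)]) (use m in auto)
    then show ?thesis
      using AB(4)[of k] y Ym[of k] unfolding one spread_def b_def by auto
  qed
  obtain s a' where s: "strict_mono s"
    and a': "\<And>x y. x \<in> mspace (fst ?X) \<Longrightarrow> y \<in> mspace (fst ?X) \<Longrightarrow>
      (\<lambda>k. a (s k) (T (s k) x) (T (s k) y)) \<longlonglongrightarrow> a' x y"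
    using approximating_maps_pseudometric_limit[OF T splittingD(1)[OF split] splitting_le[OF split]] by blast
  have Ts: "approximating_maps ?X (\<lambda>k. Y (s k)) (\<lambda>k. T (s k))"
    by (rule approximating_maps_subseq[OF T s])
  have Tm: "\<And>k x. x \<in> mspace (fst ?X) \<Longrightarrow> T k x \<in> mspace (fst (Y k))"
    using T unfolding approximating_maps_def by blast
  have b': "(\<lambda>k. b (s k) (T (s k) x) (T (s k) y)) \<longlonglongrightarrow> mdist (fst ?X) x y - a' x y"
    if xy: "x \<in> mspace (fst ?X)" "y \<in> mspace (fst ?X)" for x y
  proof -
    have "(\<lambda>k. mdist (fst (Y (s k))) (T (s k) x) (T (s k) y) - a (s k) (T (s k) x) (T (s k) y))
        \<longlonglongrightarrow> mdist (fst ?X) x y - a' x y"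
      by (rule tendsto_diff[OF approximating_maps_dist[OF Ts xy] a'[OF xy]])
    then show ?thesis
      using splittingD(3)[OF split Tm[OF xy(1)] Tm[OF xy(2)]] by simp
  qed
  have split': "splitting ?X a' (\<lambda>x y. mdist (fst ?X) x y - a' x y)"
    by (rule splitting_limit[OF Ts split a' b'])
  obtain x0 where x0: "x0 \<in> mspace (fst ?X)"
    using metric_measure_space.mspace_nonempty mm_space_rep[of \<X>] unfolding mm_space_iff by blast
  obtain x where x: "x \<in> mspace (fst ?X)" "a' x0 x \<noteq> 0"
    using splitting_limit_nontrivial[OF Ts split a' x0 c sa] by blast
  obtain y where y: "y \<in> mspace (fst ?X)" "mdist (fst ?X) x0 y - a' x0 y \<noteq> 0"
    using splitting_limit_nontrivial[OF Ts splitting_commute[OF split] b' x0 c sb] by blast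
  show ?thesis
    using splitting_imp_mm_plus[OF mm_space_rep split' x0 x x0 y] by simp
qed

lemma sum_in_spread_sums:
  assumes "\<Y> \<noteq> mm_unit" "\<Z> \<noteq> mm_unit"
  shows "\<exists>n. \<Y> \<boxplus> \<Z> \<in> spread_sums (inverse (real (Suc n)))"
proof -
  have ex: "\<exists>c>0. spread c (rep_mm \<W>)" if "\<W> \<noteq> mm_unit" for \<W>
    using that mm_class_not_unit_iff[OF mm_space_rep, of \<W>] spread_exists[OF mm_space_rep, of _ \<W>] by auto
  obtain c d where cd: "0 < c" "spread c (rep_mm \<Y>)" "0 < d" "spread d (rep_mm \<Z>)"
    using ex assms by metis
  then obtain n where n: "inverse (real (Suc n)) < min c d"
    using reals_Archimedean[of "min c d"] by auto
  have "spread (inverse (real (Suc n))) (rep_mm \<Y>)" "spread (inverse (real (Suc n))) (rep_mm \<Z>)"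
    using cd(2,4) n unfolding spread_def by fastforce+
  then show ?thesis unfolding spread_sums_def by blast
qed

text \<open>The unit needs a separate term because limits of spread out sums are never trivial, and the closures
are harmless because they add reducible classes only.\<close>

lemma irreducible_eq_Inter:
  "{\<X>. mm_irreducible \<X>} =
     (\<Inter>n. - (closure {mm_unit} \<union> closure (spread_sums (inverse (real (Suc n))))))"
proof (intro set_eqI iffI)
  fix \<X> assume irr: "\<X> \<in> {\<X>. mm_irreducible \<X>}"
  have "\<X> \<notin> closure (spread_sums (inverse (real (Suc n))))" for n
    using closure_spread_sums_reducible[of "inverse (real (Suc n))" \<X>] irr not_mm_irreducible_iff[of \<X>] by auto
  moreover have "\<X> \<noteq> mm_unit" using irr not_mm_irreducible_iff[of \<X>] by auto
  ultimately show "\<X> \<in> (\<Inter>n. - (closure {mm_unit} \<union> closure (spread_sums (inverse (real (Suc n))))))"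
    by (simp add: closed_mm_unit)
next
  fix \<X> assume *: "\<X> \<in> (\<Inter>n. - (closure {mm_unit} \<union> closure (spread_sums (inverse (real (Suc n))))))"
  show "\<X> \<in> {\<X>. mm_irreducible \<X>}"
  proof (rule ccontr)
    assume "\<X> \<notin> {\<X>. mm_irreducible \<X>}"
    moreover have "\<X> \<noteq> mm_unit" using * by (auto simp: closed_mm_unit)
    ultimately obtain n where "\<X> \<in> spread_sums (inverse (real (Suc n)))"
      using sum_in_spread_sums not_mm_irreducible_iff[of \<X>] by auto
    then show False using * closure_subset by blast
  qed
qed

theorem proposition4p2:
  shows "closure {\<X>. mm_irreducible \<X>} = (UNIV :: mm set) \<and>
         closure (- {\<X>. mm_irreducible \<X>}) = (UNIV :: mm set) \<and>
         gdelta {\<X>. mm_irreducible \<X>}"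
proof (intro conjI)
  show "closure {\<X>. mm_irreducible \<X>} = (UNIV :: mm set)"
    using irreducible_dense by (auto simp: in_closure_mm_iff set_eq_iff)
  show "closure (- {\<X>. mm_irreducible \<X>}) = (UNIV :: mm set)"
    using reducible_dense by (auto simp: in_closure_mm_iff set_eq_iff)
  show "gdelta {\<X>. mm_irreducible \<X>}"
    unfolding irreducible_eq_Inter by (rule gdelta.intros) (auto intro!: open_Compl)
qed

end
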